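(* Let $J=\{j_1,\dots,j_k\}$ be any set of integers $j_l\ge3$. Any spatial $J$-graph $G\subset\mathbb R^3$ is non-rigidly isotopic (i.e. ambient isotopic) to a spatial graph that can be projected into $\mathbb R^2$ with a unique singular point.
   Context: A finite graph is a (non-empty) finite 1-dimensional CW-complex; it is non-oriented, may be disconnected, and may have self-loops and multiple edges. Graphs are considered up to homeomorphism, so vertices of degree 2 may be regarded as ordinary points of edges, and circle components are allowed. A $J$-graph is a finite graph in which every vertex has degree $2$ or degree in $J$. A spatial graph is a subset $G\subset\mathbb R^3$ homeomorphic to a finite graph, with edges finite polygonal lines, such that a neighbourhood of every vertex lies in a plane (or in a union of two half-planes with common boundary line). Spatial graphs $G,H$ are non-rigidly isotopic if there is a continuous family of PL homeomorphisms $\phi_t:\mathbb R^3\to\mathbb R^3$, $t\in[0,1]$, with $\phi_0=\mathrm{id}$ and $\phi_1(G)=H$ (with no planarity condition at vertices during the isotopy). "Projected" refers to an orthogonal projection $\mathbb R^3\to\mathbb R^2$; a singular point of the projection of a spatial graph is a point of the image that is the image of at least two points of the graph or of a vertex of degree $\ge3$. *)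

theory Defs
  imports "HOL-Analysis.Analysis"
begin

text \<open>
  A finite CW structure of dimension 1 on a set \<open>G\<close>, with 0-cells \<open>V\<close> and with 1-cells given by
  their characteristic maps \<open>E\<close> on \<open>{0..1}\<close>. For subsets of a Hausdorff space the listed conditions
  are all of the CW axioms, since there are only finitely many cells. The open cells are nonempty
  and disjoint, so distinct members of \<open>E\<close> are distinct cells. Self-loops and multiple edges are
  allowed, and a circle component carries at least one vertex, of degree 2.
\<close>

definition graph_structure ::
  "'a::t2_space set \<Rightarrow> 'a set \<Rightarrow> (real \<Rightarrow> 'a) set \<Rightarrow> bool" where
  "graph_structure G V E \<longleftrightarrow>
     finite V \<and> finite E \<and> E \<noteq> {} \<and>
     (\<forall>c\<in>E. path c \<and> pathstart c \<in> V \<and> pathfinish c \<in> V \<and>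
        inj_on c {0<..<1} \<and> disjnt (c ` {0<..<1}) V) \<and>
     pairwise (\<lambda>c d. disjnt (c ` {0<..<1}) (d ` {0<..<1})) E \<and>
     G = V \<union> (\<Union>c\<in>E. path_image c)"

definition degree_at :: "(real \<Rightarrow> 'a::topological_space) set \<Rightarrow> 'a \<Rightarrow> nat" where
  "degree_at E v = card {c\<in>E. pathstart c = v} + card {c\<in>E. pathfinish c = v}"

definition polygonal_line :: "'a::real_vector set \<Rightarrow> bool" where
  "polygonal_line S \<longleftrightarrow>
     (\<exists>xs. 2 \<le> length xs \<and> S = (\<Union>i<length xs - 1. closed_segment (xs ! i) (xs ! Suc i)))"

definition half_plane :: "(real^3) set \<Rightarrow> (real^3) set \<Rightarrow> bool" where
  "half_plane H L \<longleftrightarrow>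
     affine L \<and> aff_dim L = 1 \<and>
     (\<exists>w. (\<forall>a\<in>L. a + w \<notin> L) \<and> H = {a + r *\<^sub>R w | a r. a \<in> L \<and> 0 \<le> r})"

definition locally_planar :: "(real^3) set \<Rightarrow> real^3 \<Rightarrow> bool" where
  "locally_planar G v \<longleftrightarrow>
     (\<exists>\<epsilon>>0. (\<exists>P. affine P \<and> aff_dim P = 2 \<and> G \<inter> ball v \<epsilon> \<subseteq> P) \<or>
            (\<exists>L A B. half_plane A L \<and> half_plane B L \<and> G \<inter> ball v \<epsilon> \<subseteq> A \<union> B))"

definition spatial_structure ::
  "(real^3) set \<Rightarrow> (real^3) set \<Rightarrow> (real \<Rightarrow> real^3) set \<Rightarrow> bool" where
  "spatial_structure G V E \<longleftrightarrow>
     graph_structure G V E \<and> (\<forall>c\<in>E. polygonal_line (path_image c)) \<and>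
     (\<forall>v\<in>V. locally_planar G v)"

definition spatial_graph :: "(real^3) set \<Rightarrow> bool" where
  "spatial_graph G \<longleftrightarrow> (\<exists>V E. spatial_structure G V E)"

definition spatial_J_graph :: "nat set \<Rightarrow> (real^3) set \<Rightarrow> bool" where
  "spatial_J_graph J G \<longleftrightarrow>
     (\<exists>V E. spatial_structure G V E \<and> (\<forall>v\<in>V. degree_at E v = 2 \<or> degree_at E v \<in> J))"

text \<open>
  Degrees other than 2 do not depend on the structure chosen on \<open>G\<close>, so being a vertex of degree
  at least 3 is a property of a point of the set \<open>G\<close>.
\<close>

definition branch_vertex :: "(real^3) set \<Rightarrow> real^3 \<Rightarrow> bool" where
  "branch_vertex G v \<longleftrightarrow> (\<exists>V E. graph_structure G V E \<and> v \<in> V \<and> 3 \<le> degree_at E v)"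

definition pl_map :: "('a::euclidean_space \<Rightarrow> 'b::euclidean_space) \<Rightarrow> bool" where
  "pl_map f \<longleftrightarrow>
     (\<exists>\<C>. locally_finite_in euclidean \<C> \<and> \<Union>\<C> = UNIV \<and>
        (\<forall>C\<in>\<C>. polytope C \<and> (\<exists>g b. linear g \<and> (\<forall>x\<in>C. f x = g x + b))))"

definition pl_homeomorphism :: "('a::euclidean_space \<Rightarrow> 'a) \<Rightarrow> bool" where
  "pl_homeomorphism f \<longleftrightarrow> pl_map f \<and> (\<exists>g. homeomorphism UNIV UNIV f g)"

definition non_rigidly_isotopic :: "(real^3) set \<Rightarrow> (real^3) set \<Rightarrow> bool" where
  "non_rigidly_isotopic G H \<longleftrightarrow>
     (\<exists>\<phi> :: real \<Rightarrow> real^3 \<Rightarrow> real^3.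
        continuous_on ({0..1} \<times> UNIV) (\<lambda>(t, x). \<phi> t x) \<and>
        (\<forall>t\<in>{0..1}. pl_homeomorphism (\<phi> t)) \<and>
        \<phi> 0 = id \<and> \<phi> 1 ` G = H)"

text \<open>
  Orthogonal projection along an arbitrary direction: \<open>u, v\<close> is an orthonormal basis of the image
  plane, which identifies that plane with \<open>\<real>\<^sup>2\<close>.
\<close>

definition orthogonal_projection :: "(real^3 \<Rightarrow> real^2) \<Rightarrow> bool" where
  "orthogonal_projection \<pi> \<longleftrightarrow>
     (\<exists>u v. norm u = 1 \<and> norm v = 1 \<and> orthogonal u v \<and> (\<forall>x. \<pi> x = vector [u \<bullet> x, v \<bullet> x]))"

definition singular_points :: "(real^3 \<Rightarrow> real^2) \<Rightarrow> (real^3) set \<Rightarrow> (real^2) set" where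
  "singular_points \<pi> G =
     {q. (\<exists>x\<in>G. \<exists>y\<in>G. x \<noteq> y \<and> \<pi> x = q \<and> \<pi> y = q) \<or> (\<exists>v. branch_vertex G v \<and> \<pi> v = q)}"

end

theory Submission
  imports Defs
begin

text \<open>
  A piecewise affine homeomorphism \<open>\<Phi>\<close> at bounded distance from the identity is isotopic to the
  identity through \<open>x \<mapsto> t \<Phi>(x / t)\<close>. So it suffices to move the graph by such homeomorphisms, and
  these realise every linear motion of the vertices of a straight-line graph through embeddings:
  the displacement of a short motion extends to a contraction of space.

  Put the graph in general position with respect to the direction \<open>x\<^sub>2\<close>, cut it at its vertices and
  at all undercrossings, and choose the height \<open>x\<^sub>3\<close> to be injective on the cut points. Push the cut
  points behind everything else. The arcs between them then have disjoint projections monotone in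
  \<open>x\<^sub>3\<close>, so a motion preserving heights can order them from left to right, while the cut points are
  gathered on one vertical axis. Each arc now lies in its own sector around the axis, hence the
  projection along the axis is a bouquet of simple loops, singular only at its base point.
\<close>

section \<open>Piecewise affine maps and the Alexander trick\<close>

text \<open>An end of an arc that lies behind everything over it can recede without meeting
  anything. This is why each crossing is cut on its farther strand: all cut points can then be
  pushed back at the same time. While the arcs are sorted, heights stay fixed and distinct heights
  let the cut points share one axis; afterwards the slopes around the axis keep the petals apart, so
  their heights are free to change.

  The technical obstacle is to extend a motion of a graph to homeomorphisms of space. No
  triangulation of the complement is chosen. Each short step is the identity plus a bounded
  piecewise affine map with Lipschitz constant below 1, hence a homeomorphism by the contraction
  principle. The steps can be of equal length because, by compactness, one constant compares
  barycentric with Euclidean distance at all times of a motion. Only the composite of all steps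
  enters the Alexander trick; the time parameter of the motion is discarded.\<close>

definition affine_on :: "('a::euclidean_space \<Rightarrow> 'b::euclidean_space) \<Rightarrow> 'a set \<Rightarrow> bool" where
  "affine_on f C \<longleftrightarrow> (\<exists>g b. linear g \<and> (\<forall>x\<in>C. f x = g x + b))"

text \<open>The pieces may be unbounded and may overlap in any way, provided that there are finitely
  many. Compositions and pairs are then handled by intersecting pieces, and minima over finite
  families stay in the class.\<close>

definition pw_affine :: "('a::euclidean_space \<Rightarrow> 'b::euclidean_space) \<Rightarrow> bool" where
  "pw_affine f \<longleftrightarrow>
     (\<exists>\<C>. finite \<C> \<and> \<Union>\<C> = UNIV \<and> (\<forall>C\<in>\<C>. polyhedron C \<and> affine_on f C))"

section \<open>Closure properties of piecewise affine maps\<close>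

lemma affine_on_compose:
  assumes "affine_on g C" "affine_on f D" "g ` C \<subseteq> D"
  shows "affine_on (\<lambda>x. f (g x)) C"
proof -
  obtain l b where l: "linear l" "\<And>x. x \<in> C \<Longrightarrow> g x = l x + b"
    using assms(1) by (auto simp: affine_on_def)
  obtain m c where m: "linear m" "\<And>x. x \<in> D \<Longrightarrow> f x = m x + c"
    using assms(2) by (auto simp: affine_on_def)
  have "f (g x) = (m \<circ> l) x + (m b + c)" if "x \<in> C" for x
  proof -
    have "g x \<in> D" using assms(3) that by blast
    then show ?thesis using m l(2)[OF that] by (simp add: linear_add)
  qed
  moreover have "linear (m \<circ> l)" using l m linear_compose by blast
  ultimately show ?thesis unfolding affine_on_def by blast
qed

lemma affine_on_subset: "affine_on f C \<Longrightarrow> D \<subseteq> C \<Longrightarrow> affine_on f D"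
  unfolding affine_on_def by blast

lemma polyhedron_affine_preimage:
  fixes g :: "'a::euclidean_space \<Rightarrow> 'b::euclidean_space"
  assumes "linear g" "polyhedron D"
  shows "polyhedron {x. g x + b \<in> D}"
proof -
  obtain F where F: "finite F" "D = \<Inter>F" "\<And>h. h \<in> F \<Longrightarrow> \<exists>a b. a \<noteq> 0 \<and> h = {x. a \<bullet> x \<le> b}"
    using assms(2) unfolding polyhedron_def by metis
  have "polyhedron {x. g x + b \<in> h}" if hF: "h \<in> F" for h
  proof -
    obtain a c where h: "h = {x. a \<bullet> x \<le> c}" using F(3)[OF hF] by blast
    have "{x. g x + b \<in> h} = {x. adjoint g a \<bullet> x \<le> c - a \<bullet> b}"
      using adjoint_works[OF assms(1)] by (auto simp: h inner_add_right inner_commute algebra_simps)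
    then show ?thesis by (simp add: polyhedron_halfspace_le)
  qed
  moreover have "{x. g x + b \<in> D} = \<Inter>((\<lambda>h. {x. g x + b \<in> h}) ` F)"
    using F(2) by auto
  ultimately show ?thesis using F(1) by (metis (no_types, lifting) finite_imageI imageE polyhedron_Inter)
qed

lemma pw_affine_compose:
  assumes "pw_affine f" "pw_affine g"
  shows "pw_affine (\<lambda>x. f (g x))"
proof -
  obtain \<C> where C: "finite \<C>" "\<Union>\<C> = UNIV" "\<And>C. C \<in> \<C> \<Longrightarrow> polyhedron C \<and> affine_on g C"
    using assms(2) unfolding pw_affine_def by blast
  obtain \<D> where D: "finite \<D>" "\<Union>\<D> = UNIV" "\<And>C. C \<in> \<D> \<Longrightarrow> polyhedron C \<and> affine_on f C"
    using assms(1) unfolding pw_affine_def by blast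
  let ?P = "\<lambda>(C, D). C \<inter> {x. g x \<in> D}"
  have "polyhedron (C \<inter> {x. g x \<in> D})" if CD: "C \<in> \<C>" "D \<in> \<D>" for C D
  proof -
    obtain l b where l: "linear l" "\<And>x. x \<in> C \<Longrightarrow> g x = l x + b"
      using C(3)[OF CD(1)] by (auto simp: affine_on_def)
    have "C \<inter> {x. g x \<in> D} = C \<inter> {x. l x + b \<in> D}" using l(2) by auto
    then show ?thesis
      using polyhedron_affine_preimage[OF l(1)] C(3)[OF CD(1)] D(3)[OF CD(2)] by simp
  qed
  moreover have "affine_on (\<lambda>x. f (g x)) (C \<inter> {x. g x \<in> D})" if "C \<in> \<C>" "D \<in> \<D>" for C D
    using C(3)[OF that(1)] D(3)[OF that(2)]
    by (intro affine_on_compose[of g _ f D]) (auto intro: affine_on_subset)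
  moreover have "\<Union>(?P ` (\<C> \<times> \<D>)) = UNIV"
  proof -
    have "x \<in> \<Union>(?P ` (\<C> \<times> \<D>))" for x
    proof -
      obtain A B where "A \<in> \<C>" "x \<in> A" "B \<in> \<D>" "g x \<in> B" using C(2) D(2) by blast
      then show ?thesis by (intro UN_I[of "(A, B)"]) auto
    qed
    then show ?thesis by auto
  qed
  ultimately show ?thesis unfolding pw_affine_def
    using C(1) D(1) by (intro exI[of _ "?P ` (\<C> \<times> \<D>)"]) auto
qed

lemma pw_affine_Pair:
  assumes "pw_affine f" "pw_affine g"
  shows "pw_affine (\<lambda>x. (f x, g x))"
proof -
  obtain \<C> where C: "finite \<C>" "\<Union>\<C> = UNIV" "\<And>C. C \<in> \<C> \<Longrightarrow> polyhedron C \<and> affine_on f C"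
    using assms(1) unfolding pw_affine_def by blast
  obtain \<D> where D: "finite \<D>" "\<Union>\<D> = UNIV" "\<And>C. C \<in> \<D> \<Longrightarrow> polyhedron C \<and> affine_on g C"
    using assms(2) unfolding pw_affine_def by blast
  let ?P = "\<lambda>(C, D). C \<inter> D"
  have "affine_on (\<lambda>x. (f x, g x)) (C \<inter> D)" if CD: "C \<in> \<C>" "D \<in> \<D>" for C D
  proof -
    obtain l b where l: "linear l" "\<And>x. x \<in> C \<Longrightarrow> f x = l x + b"
      using C(3)[OF CD(1)] by (auto simp: affine_on_def)
    obtain m c where m: "linear m" "\<And>x. x \<in> D \<Longrightarrow> g x = m x + c"
      using D(3)[OF CD(2)] by (auto simp: affine_on_def)
    have "linear (\<lambda>x. (l x, m x))"
      using l(1) m(1) by (auto simp: linear_iff)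
    moreover have "(f x, g x) = (l x, m x) + (b, c)" if "x \<in> C \<inter> D" for x
      using that l m by simp
    ultimately show ?thesis unfolding affine_on_def by blast
  qed
  moreover have "\<Union>(?P ` (\<C> \<times> \<D>)) = UNIV"
  proof -
    have "x \<in> \<Union>(?P ` (\<C> \<times> \<D>))" for x
    proof -
      obtain A B where "A \<in> \<C>" "x \<in> A" "B \<in> \<D>" "x \<in> B" using C(2) D(2) by blast
      then show ?thesis by (intro UN_I[of "(A, B)"]) auto
    qed
    then show ?thesis by auto
  qed
  ultimately show ?thesis unfolding pw_affine_def
    using C D by (intro exI[of _ "?P ` (\<C> \<times> \<D>)"]) auto
qed

lemma pw_affine_affine:
  assumes "linear g" shows "pw_affine (\<lambda>x. g x + b)"
  unfolding pw_affine_def affine_on_def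
  using assms by (intro exI[of _ "{UNIV}"]) auto

lemma pw_affine_linear: "linear g \<Longrightarrow> pw_affine g"
  using pw_affine_affine[of g 0] by simp

lemma pw_affine_const: "pw_affine (\<lambda>x. b)"
  using pw_affine_affine[of "\<lambda>x. 0" b] by (simp add: linear_iff)

lemma pw_affine_add:
  assumes "pw_affine f" "pw_affine g" shows "pw_affine (\<lambda>x. f x + g x)"
  using pw_affine_compose[OF pw_affine_linear pw_affine_Pair[OF assms], of "\<lambda>p. fst p + snd p"]
  by (auto simp: linear_iff algebra_simps)

text \<open>It suffices to treat the maximum as a function on the plane, where it is linear on
  either side of the diagonal.\<close>

lemma pw_affine_max:
  fixes f g :: "_ \<Rightarrow> real"
  assumes "pw_affine f" "pw_affine g" shows "pw_affine (\<lambda>x. max (f x) (g x))"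
proof -
  have "pw_affine (\<lambda>p::real\<times>real. max (fst p) (snd p))"
  proof -
    let ?A = "{p::real\<times>real. (1, -1) \<bullet> p \<le> 0}" and ?B = "{p::real\<times>real. (1, -1) \<bullet> p \<ge> 0}"
    have "linear (fst::real\<times>real\<Rightarrow>real)" "linear (snd::real\<times>real\<Rightarrow>real)"
      by (auto simp: linear_iff)
    moreover have "polyhedron ?A" "polyhedron ?B"
      using polyhedron_halfspace_le polyhedron_halfspace_ge by blast+
    moreover have "\<forall>p\<in>?A. max (fst p) (snd p) = snd p + 0" "\<forall>p\<in>?B. max (fst p) (snd p) = fst p + 0"
      by (auto simp: inner_prod_def)
    ultimately show ?thesis unfolding pw_affine_def affine_on_def
      by (intro exI[of _ "{?A, ?B}"]) (auto simp: inner_prod_def)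
  qed
  from pw_affine_compose[OF this pw_affine_Pair[OF assms]] show ?thesis by simp
qed

lemma pw_affine_linear_compose: "linear l \<Longrightarrow> pw_affine f \<Longrightarrow> pw_affine (\<lambda>x. l (f x))"
  using pw_affine_compose pw_affine_linear by blast

lemma pw_affine_minus: "pw_affine f \<Longrightarrow> pw_affine (\<lambda>x. - f x)"
  by (rule pw_affine_linear_compose[of uminus]) (auto simp: linear_iff)

lemma pw_affine_diff: "pw_affine f \<Longrightarrow> pw_affine g \<Longrightarrow> pw_affine (\<lambda>x. f x - g x)"
  using pw_affine_add[OF _ pw_affine_minus] by auto

lemma pw_affine_cmult: "pw_affine f \<Longrightarrow> pw_affine (\<lambda>x. c * f x :: real)"
  by (rule pw_affine_linear_compose[of "\<lambda>x. c * x"]) (auto simp: linear_iff algebra_simps)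

lemma pw_affine_scaleR_const: "pw_affine f \<Longrightarrow> pw_affine (\<lambda>x. f x *\<^sub>R w)"
  by (rule pw_affine_linear_compose[of "\<lambda>x. x *\<^sub>R w"]) (auto simp: linear_iff algebra_simps)

lemma pw_affine_min:
  fixes f g :: "_ \<Rightarrow> real"
  assumes "pw_affine f" "pw_affine g" shows "pw_affine (\<lambda>x. min (f x) (g x))"
proof -
  have "(\<lambda>x. min (f x) (g x)) = (\<lambda>x. - max (- f x) (- g x))" by auto
  then show ?thesis using assms by (auto intro!: pw_affine_minus pw_affine_max)
qed

lemma pw_affine_abs:
  fixes f :: "_ \<Rightarrow> real"
  assumes "pw_affine f" shows "pw_affine (\<lambda>x. \<bar>f x\<bar>)"
proof -
  have "(\<lambda>x. \<bar>f x\<bar>) = (\<lambda>x. max (f x) (- f x))" by auto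
  then show ?thesis using assms by (auto intro!: pw_affine_minus pw_affine_max)
qed

lemma pw_affine_sum:
  assumes "\<And>i. i \<in> I \<Longrightarrow> pw_affine (f i)" shows "pw_affine (\<lambda>x. \<Sum>i\<in>I. f i x)"
  using assms by (induction I rule: infinite_finite_induct) (auto intro: pw_affine_const pw_affine_add)

lemma pw_affine_Min:
  fixes f :: "_ \<Rightarrow> _ \<Rightarrow> real"
  assumes "finite I" "I \<noteq> {}" "\<And>i. i \<in> I \<Longrightarrow> pw_affine (f i)"
  shows "pw_affine (\<lambda>x. Min ((\<lambda>i. f i x) ` I))"
  using assms by (induction I rule: finite_ne_induct) (auto intro: pw_affine_min)

text \<open>Unbounded pieces have to be divided into polytopes. Space is cut into concentric cubical
  shells between sup-norm \<open>n\<close> and \<open>n + 1\<close>, and each shell into caps over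
  the faces of the cube, with outward normal \<open>b\<close>; \<open>?B (n, b, C)\<close> is the
  part of \<open>C\<close> in one cap. The cover is locally finite because a unit ball meets only
  boundedly many shells.\<close>

lemma pw_affine_imp_pl_map:
  fixes f :: "'a::euclidean_space \<Rightarrow> 'b::euclidean_space"
  assumes "pw_affine f" shows "pl_map f"
proof -
  obtain \<C> where C: "finite \<C>" "\<Union>\<C> = UNIV" "\<And>C. C \<in> \<C> \<Longrightarrow> polyhedron C \<and> affine_on f C"
    using assms unfolding pw_affine_def by blast
  let ?K = "\<lambda>n. cbox (- (real n + 1) *\<^sub>R One) ((real n + 1) *\<^sub>R One) :: 'a set"
  let ?B = "\<lambda>(n, b, C). (?K n \<inter> {x. b \<bullet> x \<ge> real n}) \<inter> C"
  let ?I = "UNIV \<times> (Basis \<union> uminus ` Basis) \<times> \<C>"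
  have sub: "{i \<in> ?I. ?B i \<inter> ball x 1 \<noteq> {}} \<subseteq> {..nat \<lceil>norm x + 1\<rceil>} \<times> (Basis \<union> uminus ` Basis) \<times> \<C>" for x
  proof
    fix i assume i: "i \<in> {i \<in> ?I. ?B i \<inter> ball x 1 \<noteq> {}}"
    obtain n b C where nbC: "i = (n, b, C)" by (metis prod_cases3)
    then have *: "b \<in> Basis \<union> uminus ` Basis" "C \<in> \<C>" "?B (n, b, C) \<inter> ball x 1 \<noteq> {}"
      using i by auto
    then obtain y where y: "real n \<le> b \<bullet> y" "dist x y < 1" by auto
    have "norm b = 1" using *(1) by auto
    then have "real n \<le> norm y" using y(1) norm_cauchy_schwarz[of b y] by simp
    also have "\<dots> \<le> norm x + 1" using y(2) norm_triangle_sub[of y x] by (simp add: dist_norm norm_minus_commute)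
    finally have "n \<in> {..nat \<lceil>norm x + 1\<rceil>}" by simp linarith
    then show "i \<in> {..nat \<lceil>norm x + 1\<rceil>} \<times> (Basis \<union> uminus ` Basis) \<times> \<C>"
      using * nbC by auto
  qed
  have "locally_finite_in euclidean (?B ` ?I)"
    unfolding locally_finite_in_def
  proof (intro conjI ballI)
    fix x :: 'a
    have "{U \<in> ?B ` ?I. U \<inter> ball x 1 \<noteq> {}} = ?B ` {i \<in> ?I. ?B i \<inter> ball x 1 \<noteq> {}}"
      by blast
    moreover have "finite {i \<in> ?I. ?B i \<inter> ball x 1 \<noteq> {}}"
      using sub[of x] by (rule finite_subset) (use C(1) in auto)
    ultimately show "\<exists>V. openin euclidean V \<and> x \<in> V \<and> finite {U \<in> ?B ` ?I. U \<inter> V \<noteq> {}}"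
      by (intro exI[of _ "ball x 1"]) auto
  qed auto
  moreover have "\<Union>(?B ` ?I) = UNIV"
  proof -
    have "x \<in> \<Union>(?B ` ?I)" for x :: 'a
    proof -
      obtain C0 where C0: "C0 \<in> \<C>" "x \<in> C0" using C(2) by blast
      define m where "m = Max ((\<lambda>b. \<bar>x \<bullet> b\<bar>) ` Basis)"
      have "m \<in> (\<lambda>b. \<bar>x \<bullet> b\<bar>) ` Basis" unfolding m_def by (intro Max_in) auto
      then obtain b where b: "b \<in> Basis" "m = \<bar>x \<bullet> b\<bar>" by auto
      have le: "\<bar>x \<bullet> c\<bar> \<le> m" if "c \<in> Basis" for c using that unfolding m_def by auto
      define c where "c = (if x \<bullet> b \<ge> 0 then b else - b)"
      have c: "c \<in> Basis \<union> uminus ` Basis" "c \<bullet> x = m"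
        using b by (auto simp: c_def inner_commute)
      define n where "n = nat \<lfloor>m\<rfloor>"
      have "m \<ge> 0" using b by auto
      then have n: "real n \<le> m" "m \<le> real n + 1" unfolding n_def by linarith+
      have "x \<in> ?K n"
        using le n(2) by (force simp: mem_box abs_le_iff)
      then show ?thesis using C0 c n by (intro UN_I[of "(n, c, C0)"]) auto
    qed
    then show ?thesis by auto
  qed
  moreover have "\<forall>D \<in> ?B ` ?I. polytope D \<and> (\<exists>g b. linear g \<and> (\<forall>x\<in>D. f x = g x + b))"
  proof
    fix D assume "D \<in> ?B ` ?I"
    obtain n b C' where D: "D = (?K n \<inter> {x. b \<bullet> x \<ge> real n}) \<inter> C'" "C' \<in> \<C>"
      using \<open>D \<in> _\<close> by auto
    have "polyhedron D" unfolding D(1)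
      using C(3)[OF D(2)] polyhedron_halfspace_ge by auto
    moreover have "bounded D" unfolding D(1) by (simp add: bounded_Int)
    ultimately have "polytope D" by (simp add: polytope_eq_bounded_polyhedron)
    moreover have "affine_on f D" using C(3)[OF D(2)] D(1) by (auto intro: affine_on_subset)
    ultimately show "polytope D \<and> (\<exists>g b. linear g \<and> (\<forall>x\<in>D. f x = g x + b))"
      unfolding affine_on_def by simp
  qed
  ultimately show ?thesis unfolding pl_map_def
    by (intro exI[of _ "?B ` ?I"] conjI)
qed

section \<open>Piecewise affine homeomorphisms at bounded distance from the identity\<close>

definition pl_shift :: "('a::euclidean_space \<Rightarrow> 'a) \<Rightarrow> bool" where
  "pl_shift \<Phi> \<longleftrightarrow> pw_affine \<Phi> \<and> (\<exists>\<Psi>. homeomorphism UNIV UNIV \<Phi> \<Psi>) \<and> (\<exists>B. \<forall>x. norm (\<Phi> x - x) \<le> B)"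

definition pl_equiv :: "'a::euclidean_space set \<Rightarrow> 'a set \<Rightarrow> bool" where
  "pl_equiv G H \<longleftrightarrow> (\<exists>\<Phi>. pl_shift \<Phi> \<and> \<Phi> ` G = H)"

lemma pl_shift_compose:
  assumes "pl_shift \<Phi>" "pl_shift \<Psi>" shows "pl_shift (\<lambda>x. \<Psi> (\<Phi> x))"
proof -
  obtain B C where B: "\<And>x. norm (\<Phi> x - x) \<le> B" and C: "\<And>x. norm (\<Psi> x - x) \<le> C"
    using assms unfolding pl_shift_def by metis
  have "norm (\<Psi> (\<Phi> x) - x) \<le> C + B" for x
    using norm_triangle_mono[OF C[of "\<Phi> x"] B[of x]] by simp
  moreover have "\<exists>\<Theta>. homeomorphism UNIV UNIV (\<lambda>x. \<Psi> (\<Phi> x)) \<Theta>"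
    using assms homeomorphism_compose unfolding pl_shift_def o_def by blast
  ultimately show ?thesis
    using assms pw_affine_compose unfolding pl_shift_def by blast
qed

lemma pl_equiv_trans: "pl_equiv G H \<Longrightarrow> pl_equiv H K \<Longrightarrow> pl_equiv G K"
  unfolding pl_equiv_def using pl_shift_compose by (metis image_image)

lemma pl_equiv_refl: "pl_equiv G G"
proof -
  have "pl_shift (\<lambda>x::'a. x)" unfolding pl_shift_def
    by (intro conjI pw_affine_linear exI[of _ "0::real"] exI[of _ "\<lambda>x. x"] homeomorphism_ident)
      (auto simp: linear_iff)
  then show ?thesis unfolding pl_equiv_def by (metis image_ident)
qed

text \<open>Adding a contraction to the identity shrinks distances by a factor of at least
  \<open>1 - L\<close>, so the sum is injective with Lipschitz inverse. A point \<open>y\<close> is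
  attained at the fixed point of the contraction sending \<open>x\<close> to
  \<open>y - g x\<close>.\<close>

lemma pl_shift_add_contraction:
  fixes g :: "'a::euclidean_space \<Rightarrow> 'a"
  assumes "pw_affine g" "L < 1" "\<And>x y. norm (g x - g y) \<le> L * norm (x - y)" "\<And>x. norm (g x) \<le> B"
  shows "pl_shift (\<lambda>x. x + g x)"
proof -
  let ?f = "\<lambda>x. x + g x"
  have L: "L \<ge> 0"
  proof -
    obtain b :: 'a where "b \<in> Basis" using nonempty_Basis by blast
    have "0 \<le> norm (g b - g 0)" by simp
    also have "\<dots> \<le> L * norm (b - 0)" using assms(3) by blast
    finally show ?thesis using \<open>b \<in> Basis\<close> by simp
  qed
  have low: "(1 - L) * norm (x - y) \<le> norm (?f x - ?f y)" for x y
  proof -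
    have "norm (x - y) \<le> norm (?f x - ?f y) + norm (g x - g y)"
      using norm_triangle_ineq4[of "?f x - ?f y" "g x - g y"] by (simp add: algebra_simps)
    then show ?thesis using assms(3)[of x y] by (simp add: algebra_simps)
  qed
  have "inj ?f"
  proof (rule injI)
    fix x y assume "?f x = ?f y"
    then have "norm (x - y) \<le> 0" using low[of x y] assms(2) by (simp add: mult_le_0_iff)
    then show "x = y" by simp
  qed
  have "\<exists>x. ?f x = y" for y
  proof -
    have "\<exists>!x. (\<lambda>x. y - g x) x = x"
    proof (rule banach_fix_type[of L])
      show "\<forall>x z. dist (y - g x) (y - g z) \<le> L * dist x z"
      proof (intro allI)
        fix x z
        have "(y - g x) - (y - g z) = g z - g x" by simp
        then show "dist (y - g x) (y - g z) \<le> L * dist x z"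
          using assms(3)[of z x] by (simp only: dist_norm norm_minus_commute[of x z])
      qed
    qed (use L assms in auto)
    then show ?thesis by (metis diff_add_cancel)
  qed
  then have "surj ?f" by (metis surjI)
  have cont: "continuous_on UNIV ?f"
  proof -
    have "L-lipschitz_on UNIV g"
      using L assms(3) by (auto simp: lipschitz_on_def dist_norm)
    then show ?thesis by (intro continuous_intros lipschitz_on_continuous_on)
  qed
  have "continuous_on UNIV (inv ?f)"
  proof -
    have "(1 / (1 - L))-lipschitz_on UNIV (inv ?f)"
    proof (rule lipschitz_onI)
      fix x y
      have "(1 - L) * norm (inv ?f x - inv ?f y) \<le> norm (x - y)"
        using low[of "inv ?f x" "inv ?f y"] surj_f_inv_f[OF \<open>surj ?f\<close>] by metis
      then show "dist (inv ?f x) (inv ?f y) \<le> 1 / (1 - L) * dist x y"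
        using assms(2) by (simp add: dist_norm field_simps)
    qed (use assms(2) in auto)
    then show ?thesis by (rule lipschitz_on_continuous_on)
  qed
  then have "homeomorphism UNIV UNIV ?f (inv ?f)"
    using cont inv_f_f[OF \<open>inj ?f\<close>] surj_f_inv_f[OF \<open>surj ?f\<close>] by (intro homeomorphismI) auto
  moreover have "pw_affine ?f"
    by (intro pw_affine_add assms(1) pw_affine_linear linear_id[unfolded id_def])
  moreover have "norm (?f x - x) \<le> B" for x using assms(4)[of x] by simp
  ultimately show ?thesis unfolding pl_shift_def by blast
qed

text \<open>The Alexander trick: \<open>\<Phi>\<close> moves points a bounded distance, so the conjugates of \<open>\<Phi>\<close> by
  homotheties of ratio \<open>t\<close> tend to the identity as \<open>t\<close> tends to 0.\<close>

lemma pl_equiv_imp_non_rigidly_isotopic: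
  assumes "pl_equiv G H" shows "non_rigidly_isotopic G H"
proof -
  obtain \<Phi> \<Psi> B where P: "pw_affine \<Phi>" "homeomorphism UNIV UNIV \<Phi> \<Psi>"
    and B: "\<And>x. norm (\<Phi> x - x) \<le> B" and im: "\<Phi> ` G = H"
    using assms unfolding pl_equiv_def pl_shift_def by metis
  define \<phi> where "\<phi> = (\<lambda>t x. if t = (0::real) then x else t *\<^sub>R \<Phi> ((1 / t) *\<^sub>R x))"
  have "B \<ge> 0" using norm_ge_zero B order_trans by blast
  have contP: "continuous_on UNIV \<Phi>" "continuous_on UNIV \<Psi>"
    using P(2) by (auto simp: homeomorphism_def)
  have close: "norm (\<phi> t x - x) \<le> \<bar>t\<bar> * B" for t x
  proof (cases "t = 0")
    case False
    then have "\<phi> t x - x = t *\<^sub>R (\<Phi> ((1 / t) *\<^sub>R x) - (1 / t) *\<^sub>R x)"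
      by (simp add: \<phi>_def algebra_simps)
    then show ?thesis using B[of "(1 / t) *\<^sub>R x"] by (simp add: mult_left_mono)
  qed (simp add: \<phi>_def)
  have "continuous (at (t, x) within {0..1} \<times> UNIV) (\<lambda>(t, x). \<phi> t x)" if "t \<in> {0..1}" for t x
  proof (cases "t = 0")
    case True
    show ?thesis unfolding continuous_within Lim_within
    proof (intro allI impI)
      fix e :: real assume "e > 0"
      \<comment> \<open>Near time 0 the error is at most \<open>\<bar>s\<bar> * B\<close> from the
        map plus the distance of the arguments; this \<open>d\<close> keeps each of the two within
        \<open>e / 2\<close>.\<close>
      define d where "d = e / (2 * (B + 1))"
      have d: "d > 0" "d \<le> e / 2" "d * B < e / 2"
        using \<open>e > 0\<close> \<open>B \<ge> 0\<close> by (auto simp: d_def field_simps add_pos_nonneg)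
      have "dist (\<phi> s y) (\<phi> t x) < e" if "dist (s, y) (t, x) < d" for s y
      proof -
        have "\<bar>s\<bar> < d" "dist y x < d"
          using that True dist_fst_le[of "(s, y)" "(t, x)"] dist_snd_le[of "(s, y)" "(t, x)"]
          by (auto simp: dist_real_def)
        have "dist (\<phi> s y) x \<le> norm (\<phi> s y - y) + dist y x"
          using norm_triangle_ineq[of "\<phi> s y - y" "y - x"] by (simp add: dist_norm)
        also have "\<dots> < e"
          using close[of s y] \<open>\<bar>s\<bar> < d\<close> \<open>dist y x < d\<close> d mult_right_mono[of "\<bar>s\<bar>" d B] \<open>B \<ge> 0\<close>
          by linarith
        finally show ?thesis using True by (simp add: \<phi>_def)
      qed
      then show "\<exists>d>0. \<forall>z\<in>{0..1} \<times> UNIV. 0 < dist z (t, x) \<and> dist z (t, x) < d \<longrightarrow>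
          dist (case z of (t, x) \<Rightarrow> \<phi> t x) (case (t, x) of (t, x) \<Rightarrow> \<phi> t x) < e"
        using d(1) by (intro exI[of _ d]) auto
    qed
  next
    case False
    have "continuous_on ((- {0}) \<times> UNIV) (\<lambda>z. fst z *\<^sub>R \<Phi> ((1 / fst z) *\<^sub>R snd z))"
      by (intro continuous_intros continuous_on_compose2[OF contP(1)]) auto
    then have "continuous_on ((- {0}) \<times> UNIV) (\<lambda>(t, x). \<phi> t x)"
      by (rule continuous_on_eq) (auto simp: \<phi>_def split: prod.split)
    moreover have "open ((- {0::real}) \<times> (UNIV::(real^3) set))"
      by (intro open_Times) auto
    ultimately have "isCont (\<lambda>(t, x). \<phi> t x) (t, x)"
      using False by (auto simp: continuous_on_eq_continuous_at)
    then show ?thesis by (rule continuous_at_imp_continuous_at_within)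
  qed
  then have "continuous_on ({0..1} \<times> UNIV) (\<lambda>(t, x). \<phi> t x)"
    by (auto simp: continuous_on_eq_continuous_within)
  moreover have "pl_homeomorphism (\<phi> t)" if "t \<in> {0..1}" for t
  proof (cases "t = 0")
    case True
    then have "\<phi> t = (\<lambda>x. x)" by (auto simp: \<phi>_def)
    then show ?thesis unfolding pl_homeomorphism_def
      using homeomorphism_ident by (auto intro!: pw_affine_imp_pl_map pw_affine_linear simp: linear_iff)
  next
    case False
    have lin: "linear (\<lambda>x. c *\<^sub>R x)" for c :: real by (auto simp: linear_iff algebra_simps)
    have eq: "\<phi> t = (\<lambda>x. t *\<^sub>R \<Phi> ((1 / t) *\<^sub>R x))" using False by (auto simp: \<phi>_def)
    have "homeomorphism UNIV UNIV (\<phi> t) (\<lambda>x. t *\<^sub>R \<Psi> ((1 / t) *\<^sub>R x))"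
    proof (rule homeomorphismI)
      show "continuous_on UNIV (\<phi> t)" unfolding eq
        by (intro continuous_intros continuous_on_compose2[OF contP(1)]) auto
      show "continuous_on UNIV (\<lambda>x. t *\<^sub>R \<Psi> ((1 / t) *\<^sub>R x))"
        by (intro continuous_intros continuous_on_compose2[OF contP(2)]) auto
    qed (use P(2) False in \<open>auto simp: eq homeomorphism_def\<close>)
    moreover have "pw_affine (\<phi> t)" unfolding eq
      by (intro pw_affine_linear_compose[OF lin] pw_affine_compose[OF P(1)] pw_affine_linear lin)
    ultimately show ?thesis unfolding pl_homeomorphism_def using pw_affine_imp_pl_map by blast
  qed
  moreover have "\<phi> 0 = id" "\<phi> 1 ` G = H" using im by (auto simp: \<phi>_def)
  ultimately show ?thesis unfolding non_rigidly_isotopic_def by blast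
qed

section \<open>Straight-line graphs\<close>

definition edge_pt :: "('v \<Rightarrow> 'a::real_vector) \<Rightarrow> 'v \<times> 'v \<Rightarrow> real \<Rightarrow> 'a" where
  "edge_pt p e s = (1 - s) *\<^sub>R p (fst e) + s *\<^sub>R p (snd e)"

definition realization :: "('v \<Rightarrow> 'a::real_vector) \<Rightarrow> ('v \<times> 'v) set \<Rightarrow> 'a set" where
  "realization p E = (\<Union>e\<in>E. closed_segment (p (fst e)) (p (snd e)))"

definition barycentric :: "'v \<times> 'v \<Rightarrow> real \<Rightarrow> 'v \<Rightarrow> real" where
  "barycentric e s v = (1 - s) * of_bool (v = fst e) + s * of_bool (v = snd e)"

text \<open>Injectivity on the abstract graph rather than on pairs of an edge and a parameter:
  equality of barycentric coordinates identifies common ends of edges and the two orientations of an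
  edge without case distinctions.\<close>

definition straight_embedding :: "('v \<Rightarrow> 'a::real_vector) \<Rightarrow> ('v \<times> 'v) set \<Rightarrow> bool" where
  "straight_embedding p E \<longleftrightarrow>
     (\<forall>e\<in>E. \<forall>f\<in>E. \<forall>s\<in>{0..1}. \<forall>t\<in>{0..1}.
        edge_pt p e s = edge_pt p f t \<longrightarrow> barycentric e s = barycentric f t)"

text \<open>The 1-norm distance of two points of the abstract graph. Only the ends of the two edges
  can carry a nonzero coordinate, and the set notation counts a common end once.\<close>

definition bary_dist :: "'v \<times> 'v \<Rightarrow> real \<Rightarrow> 'v \<times> 'v \<Rightarrow> real \<Rightarrow> real" where
  "bary_dist e s f t =
     (\<Sum>v\<in>{fst e, snd e, fst f, snd f}. \<bar>barycentric e s v - barycentric f t v\<bar>)"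

lemma mem_realization:
  "x \<in> realization p E \<longleftrightarrow> (\<exists>e\<in>E. \<exists>s\<in>{0..1}. x = edge_pt p e s)"
  unfolding realization_def edge_pt_def closed_segment_def by (auto simp: Bex_def)

lemma edge_pt_swap: "edge_pt p (prod.swap e) s = edge_pt p e (1 - s)"
  by (simp add: edge_pt_def)

lemma barycentric_swap: "barycentric (prod.swap e) s = barycentric e (1 - s)"
  by (auto simp: barycentric_def fun_eq_iff)

lemma bary_dist_swap_left: "bary_dist (prod.swap e) s f t = bary_dist e (1 - s) f t"
proof -
  have "{snd e, fst e, fst f, snd f} = {fst e, snd e, fst f, snd f}" by auto
  then show ?thesis by (simp add: bary_dist_def barycentric_swap)
qed

lemma bary_dist_swap_right: "bary_dist e s (prod.swap f) t = bary_dist e s f (1 - t)"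
proof -
  have "{fst e, snd e, snd f, fst f} = {fst e, snd e, fst f, snd f}" by auto
  then show ?thesis by (simp add: bary_dist_def barycentric_swap)
qed

text \<open>With both orientations of every edge available, a common vertex of two edges may be
  assumed to come first in both.\<close>

lemma straight_embedding_swap:
  assumes "straight_embedding p E" shows "straight_embedding p (E \<union> prod.swap ` E)"
proof -
  have *: "\<exists>e'\<in>E. \<exists>s'\<in>{0..1}. edge_pt p e s = edge_pt p e' s' \<and> barycentric e s = barycentric e' s'"
    if e: "e \<in> E \<union> prod.swap ` E" and s: "s \<in> {0..1}" for e s
  proof (cases "e \<in> E")
    case False
    then obtain e' where "e' \<in> E" "e = prod.swap e'" using e by blast
    then show ?thesis using s
      by (intro bexI[of _ e'] bexI[of _ "1 - s"]) (auto simp: edge_pt_swap barycentric_swap)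
  qed (use s in blast)
  show ?thesis unfolding straight_embedding_def
  proof (intro ballI impI)
    fix e f s t
    assume e: "e \<in> E \<union> prod.swap ` E" and f: "f \<in> E \<union> prod.swap ` E"
      and s: "s \<in> {0..1::real}" and t: "t \<in> {0..1::real}" and eq: "edge_pt p e s = edge_pt p f t"
    obtain e' s' where e': "e' \<in> E" "s' \<in> {0..1}" "edge_pt p e s = edge_pt p e' s'"
        "barycentric e s = barycentric e' s'" using *[OF e s] by blast
    obtain f' t' where f': "f' \<in> E" "t' \<in> {0..1}" "edge_pt p f t = edge_pt p f' t'"
        "barycentric f t = barycentric f' t'" using *[OF f t] by blast
    show "barycentric e s = barycentric f t"
      using assms e' f' eq unfolding straight_embedding_def by metis
  qed
qed

text \<open>Interpolation along edges is linear in the barycentric coordinates, so a bound on the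
  vertex values is a Lipschitz constant with respect to \<open>bary_dist\<close>.\<close>

lemma norm_edge_pt_diff_le:
  fixes \<delta> :: "'v \<Rightarrow> 'a::real_normed_vector"
  assumes "\<And>v. v \<in> {fst e, snd e, fst f, snd f} \<Longrightarrow> norm (\<delta> v) \<le> D"
  shows "norm (edge_pt \<delta> e s - edge_pt \<delta> f t) \<le> D * bary_dist e s f t"
proof -
  let ?W = "{fst e, snd e, fst f, snd f}"
  have sub: "edge_pt \<delta> e s = (\<Sum>v\<in>?W. barycentric e s v *\<^sub>R \<delta> v)"
    if e: "fst e \<in> ?W" "snd e \<in> ?W" for e s
  proof -
    have "(\<Sum>v\<in>?W. barycentric e s v *\<^sub>R \<delta> v) =
      (\<Sum>v\<in>?W. if v = fst e then (1 - s) *\<^sub>R \<delta> v else 0) + (\<Sum>v\<in>?W. if v = snd e then s *\<^sub>R \<delta> v else 0)"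
      unfolding sum.distrib[symmetric]
      by (intro sum.cong) (auto simp: barycentric_def scaleR_add_left[symmetric])
    also have "\<dots> = (1 - s) *\<^sub>R \<delta> (fst e) + s *\<^sub>R \<delta> (snd e)"
      using e by (simp only: sum.delta finite_insert finite.emptyI if_True)
    finally show ?thesis by (simp add: edge_pt_def)
  qed
  have "edge_pt \<delta> e s - edge_pt \<delta> f t = (\<Sum>v\<in>?W. (barycentric e s v - barycentric f t v) *\<^sub>R \<delta> v)"
    using sub[of e s] sub[of f t] by (simp add: sum_subtractf[symmetric] scaleR_diff_left del: sum.insert)
  also have "norm \<dots> \<le> (\<Sum>v\<in>?W. \<bar>barycentric e s v - barycentric f t v\<bar> * D)"
    by (intro sum_norm_le) (auto intro!: mult_left_mono assms)
  also have "\<dots> = D * bary_dist e s f t"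
    unfolding bary_dist_def sum_distrib_left by (simp add: mult.commute)
  finally show ?thesis .
qed

text \<open>Displacements are extended from the graph to the whole space coordinatewise by McShane's
  formula. Replacing the nearest point of the infimum by the nearest point on each edge makes the
  formula piecewise affine without changing it on the graph.\<close>

lemma pl_shift_extending_displacement:
  fixes p q :: "'v \<Rightarrow> 'a::euclidean_space"
  assumes E: "finite E" "E \<noteq> {}" and D: "\<And>e. e \<in> E \<Longrightarrow> norm (q (fst e) - p (fst e)) \<le> D \<and> norm (q (snd e) - p (snd e)) \<le> D"
    and K: "K \<ge> 0" "\<And>e f s t. e \<in> E \<Longrightarrow> f \<in> E \<Longrightarrow> s \<in> {0..1} \<Longrightarrow> t \<in> {0..1} \<Longrightarrow>
       bary_dist e s f t \<le> K * norm (edge_pt p e s - edge_pt p f t)"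
    and neq: "\<And>e. e \<in> E \<Longrightarrow> p (fst e) \<noteq> p (snd e)"
    and small: "real (DIM('a) * (1 + 2 * DIM('a))) * (D * K) < 1"
  shows "\<exists>\<Phi>. pl_shift \<Phi> \<and> (\<forall>e\<in>E. \<forall>s\<in>{0..1}. \<Phi> (edge_pt p e s) = edge_pt q e s)"
proof -
  define \<delta> where "\<delta> = (\<lambda>v. q v - p v)"
  define d where "d = (\<lambda>e. p (snd e) - p (fst e))"
  \<comment> \<open>Orthogonal projection to the line of \<open>e\<close>, clamped to the edge:
    \<open>\<sigma> e x\<close> is the parameter of the point \<open>y e x\<close> of
    \<open>e\<close> nearest to \<open>x\<close>.\<close>
  define \<sigma> where "\<sigma> = (\<lambda>e x. max 0 (min 1 (((x - p (fst e)) \<bullet> d e) / (norm (d e))\<^sup>2)))"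
  define y where "y = (\<lambda>e x. edge_pt p e (\<sigma> e x))"
  \<comment> \<open>The 1-norm replaces the Euclidean norm in McShane's formula because it is
    piecewise affine. As it is the larger of the two, the formula still extends the given
    displacement.\<close>
  define T where "T = (\<lambda>i e x. edge_pt \<delta> e (\<sigma> e x) \<bullet> i + K * D * (\<Sum>b\<in>Basis. \<bar>(x - y e x) \<bullet> b\<bar>))"
  \<comment> \<open>Truncation at \<open>D\<close> makes the displacement bounded on all of space.
    It changes nothing on the graph, where the coordinates are at most \<open>D\<close> in absolute
    value.\<close>
  define h where "h = (\<lambda>i x. max (- D) (min D (Min ((\<lambda>e. T i e x) ` E))))"
  define g where "g = (\<lambda>x. \<Sum>i\<in>Basis. h i x *\<^sub>R i)"
  define N where "N = real DIM('a)"
  have D0: "D \<ge> 0" using E D norm_ge_zero order_trans by blast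
  have d0: "norm (d e) > 0" if "e \<in> E" for e using neq[OF that] by (simp add: d_def)
  have \<sigma>01: "\<sigma> e x \<in> {0..1}" for e x by (auto simp: \<sigma>_def)
  have del: "norm (\<delta> v) \<le> D" if "e \<in> E" "f \<in> E" "v \<in> {fst e, snd e, fst f, snd f}" for e f v
    using D[OF that(1)] D[OF that(2)] that(3) by (auto simp: \<delta>_def)
  have \<delta>_lip: "norm (edge_pt \<delta> e s - edge_pt \<delta> f t) \<le> K * D * norm (edge_pt p e s - edge_pt p f t)"
    if "e \<in> E" "f \<in> E" "s \<in> {0..1}" "t \<in> {0..1}" for e f s t
  proof -
    have "norm (edge_pt \<delta> e s - edge_pt \<delta> f t) \<le> D * bary_dist e s f t"
      using del that by (intro norm_edge_pt_diff_le) blast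
    also have "\<dots> \<le> D * (K * norm (edge_pt p e s - edge_pt p f t))"
      using K(2)[OF that] D0 by (rule mult_left_mono)
    finally show ?thesis by (simp add: algebra_simps)
  qed
  have y_lip: "norm (y e x - y e z) \<le> norm (x - z)" if "e \<in> E" for e x z
  proof -
    have "\<bar>\<sigma> e x - \<sigma> e z\<bar> \<le> \<bar>((x - p (fst e)) \<bullet> d e) / (norm (d e))\<^sup>2 - ((z - p (fst e)) \<bullet> d e) / (norm (d e))\<^sup>2\<bar>"
      unfolding \<sigma>_def by linarith
    also have "\<dots> = \<bar>(x - z) \<bullet> d e\<bar> / (norm (d e))\<^sup>2"
      by (simp add: diff_divide_distrib[symmetric] inner_diff_left[symmetric])
    also have "\<dots> \<le> (norm (x - z) * norm (d e)) / (norm (d e))\<^sup>2"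
      by (intro divide_right_mono Cauchy_Schwarz_ineq2) auto
    also have "\<dots> = norm (x - z) / norm (d e)"
      using d0[OF that] by (simp add: power2_eq_square)
    finally have *: "\<bar>\<sigma> e x - \<sigma> e z\<bar> * norm (d e) \<le> norm (x - z)"
      using d0[OF that] by (simp add: field_simps)
    have "y e x - y e z = (\<sigma> e x - \<sigma> e z) *\<^sub>R d e"
      by (simp add: y_def edge_pt_def d_def algebra_simps)
    then show ?thesis using * by simp
  qed
  \<comment> \<open>Up to the factor \<open>K * D\<close>, the interpolated displacement contributes
    1, and each of the \<open>N\<close> coordinates of \<open>x - y e x\<close> contributes 2, since
    \<open>x\<close> and \<open>y e x\<close> are both 1-Lipschitz in \<open>x\<close>.\<close>
  have T_lip: "\<bar>T i e x - T i e z\<bar> \<le> (1 + 2 * N) * (K * D) * norm (x - z)"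
    if "e \<in> E" "i \<in> Basis" for i e x z
  proof -
    have "\<bar>edge_pt \<delta> e (\<sigma> e x) \<bullet> i - edge_pt \<delta> e (\<sigma> e z) \<bullet> i\<bar>
        \<le> norm (edge_pt \<delta> e (\<sigma> e x) - edge_pt \<delta> e (\<sigma> e z))"
      using Basis_le_norm[OF that(2)] by (simp add: inner_diff_left[symmetric])
    also have "\<dots> \<le> K * D * norm (y e x - y e z)"
      unfolding y_def by (rule \<delta>_lip) (use that \<sigma>01 in auto)
    also have "\<dots> \<le> K * D * norm (x - z)"
      using y_lip[OF that(1)] K(1) D0 by (intro mult_left_mono) auto
    finally have 1: "\<bar>edge_pt \<delta> e (\<sigma> e x) \<bullet> i - edge_pt \<delta> e (\<sigma> e z) \<bullet> i\<bar> \<le> K * D * norm (x - z)" .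
    have "\<bar>(\<Sum>b\<in>Basis. \<bar>(x - y e x) \<bullet> b\<bar>) - (\<Sum>b\<in>Basis. \<bar>(z - y e z) \<bullet> b\<bar>)\<bar>
        \<le> (\<Sum>b\<in>Basis. \<bar>\<bar>(x - y e x) \<bullet> b\<bar> - \<bar>(z - y e z) \<bullet> b\<bar>\<bar>)"
      unfolding sum_subtractf[symmetric] by (rule sum_abs)
    also have "\<dots> \<le> (\<Sum>b\<in>(Basis::'a set). 2 * norm (x - z))"
    proof (rule sum_mono)
      fix b :: 'a assume "b \<in> Basis"
      have "\<bar>\<bar>(x - y e x) \<bullet> b\<bar> - \<bar>(z - y e z) \<bullet> b\<bar>\<bar> \<le> \<bar>((x - y e x) - (z - y e z)) \<bullet> b\<bar>"
        by (simp add: inner_diff_left)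
      also have "\<dots> \<le> norm ((x - y e x) - (z - y e z))" using \<open>b \<in> Basis\<close> by (rule Basis_le_norm)
      also have "(x - y e x) - (z - y e z) = (x - z) - (y e x - y e z)" by simp
      also have "norm \<dots> \<le> norm (x - z) + norm (y e x - y e z)" by (rule norm_triangle_ineq4)
      also have "\<dots> \<le> 2 * norm (x - z)" using y_lip[OF that(1), of x z] by simp
      finally show "\<bar>\<bar>(x - y e x) \<bullet> b\<bar> - \<bar>(z - y e z) \<bullet> b\<bar>\<bar> \<le> 2 * norm (x - z)" .
    qed
    finally have 2: "\<bar>(\<Sum>b\<in>Basis. \<bar>(x - y e x) \<bullet> b\<bar>) - (\<Sum>b\<in>Basis. \<bar>(z - y e z) \<bullet> b\<bar>)\<bar> \<le> 2 * N * norm (x - z)"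
      by (simp add: N_def)
    have "T i e x - T i e z = (edge_pt \<delta> e (\<sigma> e x) \<bullet> i - edge_pt \<delta> e (\<sigma> e z) \<bullet> i) +
       K * D * ((\<Sum>b\<in>Basis. \<bar>(x - y e x) \<bullet> b\<bar>) - (\<Sum>b\<in>Basis. \<bar>(z - y e z) \<bullet> b\<bar>))"
      by (simp add: T_def algebra_simps)
    also have "\<bar>\<dots>\<bar> \<le> K * D * norm (x - z) + K * D * (2 * N * norm (x - z))"
      using 1 mult_left_mono[OF 2, of "K * D"] K(1) D0
      by (intro order_trans[OF abs_triangle_ineq] add_mono) (auto simp: abs_mult)
    finally show ?thesis by (simp add: algebra_simps)
  qed
  have Min_lip: "\<bar>Min ((\<lambda>e. u e) ` E) - Min ((\<lambda>e. v e) ` E)\<bar> \<le> L"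
    if uv: "\<And>e. e \<in> E \<Longrightarrow> \<bar>u e - v e\<bar> \<le> L" for u v :: "'v \<times> 'v \<Rightarrow> real" and L
  proof -
    have "Min (u ` E) \<in> u ` E" "Min (v ` E) \<in> v ` E" using E by (auto intro!: Min_in)
    then obtain e f where e: "e \<in> E" "Min (u ` E) = u e" and f: "f \<in> E" "Min (v ` E) = v f" by blast
    have "u e \<le> u f" "v f \<le> v e" using e f E(1) by (metis Min_le finite_imageI imageI)+
    then show ?thesis using uv[OF e(1)] uv[OF f(1)] e(2) f(2) by linarith
  qed
  have h_lip: "\<bar>h i x - h i z\<bar> \<le> (1 + 2 * N) * (K * D) * norm (x - z)" if "i \<in> Basis" for i x z
  proof -
    have "\<bar>h i x - h i z\<bar> \<le> \<bar>Min ((\<lambda>e. T i e x) ` E) - Min ((\<lambda>e. T i e z) ` E)\<bar>"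
      unfolding h_def by linarith
    also have "\<dots> \<le> (1 + 2 * N) * (K * D) * norm (x - z)"
      using that by (intro Min_lip T_lip)
    finally show ?thesis .
  qed
  have g_lip: "norm (g x - g z) \<le> (N * (1 + 2 * N) * (D * K)) * norm (x - z)" for x z
  proof -
    have "g x - g z = (\<Sum>i\<in>Basis. (h i x - h i z) *\<^sub>R i)"
      by (simp add: g_def sum_subtractf scaleR_diff_left)
    also have "norm \<dots> \<le> (\<Sum>i\<in>(Basis::'a set). (1 + 2 * N) * (K * D) * norm (x - z))"
      by (intro sum_norm_le) (simp add: h_lip)
    finally show ?thesis by (simp add: N_def algebra_simps)
  qed
  have g_bd: "norm (g x) \<le> N * D" for x
  proof -
    have "norm (g x) \<le> (\<Sum>i\<in>(Basis::'a set). D)"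
      unfolding g_def using D0 by (intro sum_norm_le) (auto simp: h_def)
    then show ?thesis by (simp add: N_def)
  qed
  have \<sigma>_pa: "pw_affine (\<sigma> e)" for e
  proof -
    have "pw_affine (\<lambda>x. (x \<bullet> d e) / (norm (d e))\<^sup>2 + (- (p (fst e) \<bullet> d e) / (norm (d e))\<^sup>2))"
      by (intro pw_affine_affine) (auto simp: linear_iff inner_add_left add_divide_distrib)
    moreover have "(\<lambda>x. (x \<bullet> d e) / (norm (d e))\<^sup>2 + (- (p (fst e) \<bullet> d e) / (norm (d e))\<^sup>2))
        = (\<lambda>x. ((x - p (fst e)) \<bullet> d e) / (norm (d e))\<^sup>2)"
      by (auto simp: inner_diff_left diff_divide_distrib)
    ultimately show ?thesis
      unfolding \<sigma>_def by (intro pw_affine_max pw_affine_min pw_affine_const) auto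
  qed
  have edge_pa: "pw_affine (\<lambda>x. edge_pt r e (\<sigma> e x))" for r :: "'v \<Rightarrow> 'a" and e
    unfolding edge_pt_def
    by (intro pw_affine_add pw_affine_scaleR_const pw_affine_diff pw_affine_const \<sigma>_pa)
  have inner_lin: "linear (\<lambda>x. x \<bullet> b)" for b :: 'a
    by (auto simp: linear_iff inner_add_left)
  have "pw_affine (\<lambda>x. T i e x)" for i e
    unfolding T_def y_def
    by (intro pw_affine_add pw_affine_cmult pw_affine_sum pw_affine_abs
        pw_affine_linear_compose[OF inner_lin] pw_affine_diff edge_pa pw_affine_linear linear_id[unfolded id_def])
  then have "pw_affine (h i)" for i
    unfolding h_def using E by (intro pw_affine_max pw_affine_min pw_affine_const pw_affine_Min) auto
  then have "pw_affine g" unfolding g_def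
    by (intro pw_affine_sum pw_affine_scaleR_const) auto
  then have shift: "pl_shift (\<lambda>x. x + g x)"
  proof (rule pl_shift_add_contraction[OF _ _ g_lip g_bd])
    show "N * (1 + 2 * N) * (D * K) < 1"
      using small by (simp only: N_def of_nat_mult of_nat_add of_nat_1 of_nat_numeral)
  qed
  have "g (edge_pt p e s) = edge_pt \<delta> e s" if "e \<in> E" "s \<in> {0..1}" for e s
  proof -
    let ?x = "edge_pt p e s"
    have "((?x - p (fst e)) \<bullet> d e) = s * (norm (d e))\<^sup>2"
      by (simp add: edge_pt_def d_def dot_square_norm[symmetric] algebra_simps inner_commute)
    then have s: "\<sigma> e ?x = s"
      using d0[OF that(1)] that(2) by (auto simp: \<sigma>_def)
    have "h i ?x = edge_pt \<delta> e s \<bullet> i" if i: "i \<in> Basis" for i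
    proof -
      have e_val: "T i e ?x = edge_pt \<delta> e s \<bullet> i"
        by (simp add: T_def y_def s)
      \<comment> \<open>The term of \<open>e\<close> itself attains the desired value; the Lipschitz
        bound for the displacement along the graph keeps the terms of all other edges above
        it.\<close>
      have "edge_pt \<delta> e s \<bullet> i \<le> T i f ?x" if "f \<in> E" for f
      proof -
        have "edge_pt \<delta> e s \<bullet> i - edge_pt \<delta> f (\<sigma> f ?x) \<bullet> i \<le> norm (edge_pt \<delta> e s - edge_pt \<delta> f (\<sigma> f ?x))"
          using Basis_le_norm[OF i] by (metis abs_le_D1 inner_diff_left)
        also have "\<dots> \<le> K * D * norm (?x - y f ?x)"
          unfolding y_def by (rule \<delta>_lip) (use that \<sigma>01 \<open>e \<in> E\<close> \<open>s \<in> _\<close> in auto)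
        also have "\<dots> \<le> K * D * (\<Sum>b\<in>Basis. \<bar>(?x - y f ?x) \<bullet> b\<bar>)"
          using K(1) D0 by (intro mult_left_mono norm_le_l1) auto
        finally show ?thesis by (simp add: T_def)
      qed
      then have "Min ((\<lambda>e. T i e ?x) ` E) = edge_pt \<delta> e s \<bullet> i"
        using e_val E(1) \<open>e \<in> E\<close> by (intro Min_eqI) (auto intro: rev_image_eqI)
      moreover have "norm (edge_pt \<delta> e s) \<le> D"
      proof -
        have "norm (edge_pt \<delta> e s) \<le> (1 - s) * norm (\<delta> (fst e)) + s * norm (\<delta> (snd e))"
          using \<open>s \<in> _\<close> unfolding edge_pt_def by (intro order_trans[OF norm_triangle_ineq]) auto
        also have "\<dots> \<le> (1 - s) * D + s * D"
          using \<open>s \<in> _\<close> D[OF \<open>e \<in> E\<close>] by (intro add_mono mult_left_mono) (auto simp: \<delta>_def)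
        finally show ?thesis by (simp add: algebra_simps)
      qed
      then have "\<bar>edge_pt \<delta> e s \<bullet> i\<bar> \<le> D" using Basis_le_norm[OF i] order_trans by blast
      ultimately show ?thesis by (simp add: h_def)
    qed
    then show ?thesis unfolding g_def by (simp add: euclidean_representation)
  qed
  moreover have "edge_pt p e s + edge_pt \<delta> e s = edge_pt q e s" for e s
    by (simp add: edge_pt_def \<delta>_def algebra_simps)
  ultimately show ?thesis using shift by (intro exI[of _ "\<lambda>x. x + g x"]) auto
qed

lemma uniform_lower_bound:
  fixes F :: "real \<Rightarrow> real \<Rightarrow> real \<Rightarrow> 'a::real_normed_vector"
  assumes "continuous_on ({0..1} \<times> {0..1} \<times> {0..1}) (\<lambda>(t, s, s'). F t s s')"
    and "\<And>t s s'. t \<in> {0..1} \<Longrightarrow> s \<in> {0..1} \<Longrightarrow> s' \<in> {0..1} \<Longrightarrow> F t s s' \<noteq> 0"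
  shows "\<exists>\<kappa>>0. \<forall>t\<in>{0..1}. \<forall>s\<in>{0..1}. \<forall>s'\<in>{0..1}. \<kappa> \<le> norm (F t s s')"
proof -
  let ?C = "{0..1::real} \<times> {0..1::real} \<times> {0..1::real}"
  let ?F = "\<lambda>z. norm (case z of (t, s, s') \<Rightarrow> F t s s')"
  have "continuous_on ?C ?F" by (intro continuous_intros assms(1))
  moreover have "compact ?C" by (intro compact_Times) auto
  moreover have "?C \<noteq> {}" by auto
  ultimately obtain z where z: "z \<in> ?C" "\<forall>z'\<in>?C. ?F z \<le> ?F z'"
    using continuous_attains_inf[of ?C ?F] by metis
  obtain a b c where abc: "z = (a, b, c)" by (metis prod_cases3)
  have "norm (F a b c) > 0" using z(1) assms(2)[of a b c] abc by auto
  moreover have "norm (F a b c) \<le> norm (F t s s')" if "t \<in> {0..1}" "s \<in> {0..1}" "s' \<in> {0..1}" for t s s'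
    using z(2)[rule_format, of "(t, s, s')"] that abc by simp
  ultimately show ?thesis by blast
qed

lemma bary_dist_le: "s \<in> {0..1} \<Longrightarrow> t \<in> {0..1} \<Longrightarrow> bary_dist e s f t \<le> 4"
proof -
  assume st: "s \<in> {0..1}" "t \<in> {0..1}"
  let ?W = "{fst e, snd e, fst f, snd f}"
  have b: "0 \<le> barycentric e s v \<and> barycentric e s v \<le> 1" if "s \<in> {0..1}" for e :: "'a \<times> 'a" and s v
    using that by (auto simp: barycentric_def)
  have "\<bar>barycentric e s v - barycentric f t v\<bar> \<le> 1" for v
    using b[OF st(1), of e v] b[OF st(2), of f v] by linarith
  then have "bary_dist e s f t \<le> (\<Sum>v\<in>?W. 1)"
    unfolding bary_dist_def by (intro sum_mono)
  also have "\<dots> = real (card ?W)" by simp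
  also have "\<dots> \<le> real (length [fst e, snd e, fst f, snd f])"
    using card_length[of "[fst e, snd e, fst f, snd f]"] by (simp only: of_nat_le_iff list.set)
  finally show ?thesis by simp
qed

text \<open>Along a linear motion through embeddings, two edges with a common vertex make an angle bounded
  away from 0, and two disjoint edges keep a positive distance.\<close>

lemma uniform_bary_dist_le:
  fixes P :: "real \<Rightarrow> 'v \<Rightarrow> 'a::euclidean_space"
  assumes cont: "\<And>v. continuous_on {0..1} (\<lambda>t. P t v)"
    and emb: "\<And>t. t \<in> {0..1} \<Longrightarrow> straight_embedding (P t) E"
    and neq: "\<And>e. e \<in> E \<Longrightarrow> fst e \<noteq> snd e"
    and sym: "\<And>e. e \<in> E \<Longrightarrow> prod.swap e \<in> E"
    and e: "e \<in> E" and f: "f \<in> E"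
  shows "\<exists>K\<ge>0. \<forall>t\<in>{0..1}. \<forall>s\<in>{0..1}. \<forall>s'\<in>{0..1}.
           bary_dist e s f s' \<le> K * norm (edge_pt (P t) e s - edge_pt (P t) f s')"
    (is "?Q e f")
proof -
  have cont': "continuous_on ({0..1} \<times> {0..1} \<times> {0..1}) (\<lambda>z. P (fst z) v)" for v
    by (rule continuous_on_compose2[OF cont continuous_on_fst]) auto
  have embD: "barycentric e s = barycentric f s'"
    if "t \<in> {0..1}" "e \<in> E" "f \<in> E" "s \<in> {0..1}" "s' \<in> {0..1}" "edge_pt (P t) e s = edge_pt (P t) f s'"
    for e f s s' t
    using emb[OF that(1)] that unfolding straight_embedding_def by blast
  have same: "?Q e e" if e: "e \<in> E" for e
  proof -
    have "P t (snd e) - P t (fst e) \<noteq> 0" if "t \<in> {0..1}" for t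
    proof
      assume "P t (snd e) - P t (fst e) = 0"
      then have "barycentric e 0 = barycentric e 1"
        by (intro embD[OF that e e]) (auto simp: edge_pt_def)
      then have "barycentric e 0 (snd e) = barycentric e 1 (snd e)" by simp
      then show False using neq[OF e] by (simp add: barycentric_def)
    qed
    then have "\<exists>\<kappa>>0. \<forall>t\<in>{0..1}. \<forall>s\<in>{0..1::real}. \<forall>s'\<in>{0..1::real}. \<kappa> \<le> norm (P t (snd e) - P t (fst e))"
      by (intro uniform_lower_bound) (auto simp: case_prod_beta intro!: continuous_intros cont')
    then obtain \<kappa> where k: "\<kappa> > 0" "\<And>t. t \<in> {0..1} \<Longrightarrow> \<kappa> \<le> norm (P t (snd e) - P t (fst e))"
      by fastforce
    have "bary_dist e s e s' \<le> (2 / \<kappa>) * norm (edge_pt (P t) e s - edge_pt (P t) e s')"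
      if "t \<in> {0..1}" for t s s'
    proof -
      have "edge_pt (P t) e s - edge_pt (P t) e s' = (s - s') *\<^sub>R (P t (snd e) - P t (fst e))"
        by (simp add: edge_pt_def algebra_simps)
      then have A: "(2 / \<kappa>) * norm (edge_pt (P t) e s - edge_pt (P t) e s')
          = 2 * \<bar>s - s'\<bar> * (norm (P t (snd e) - P t (fst e)) / \<kappa>)" by simp
      have B: "2 * \<bar>s - s'\<bar> * 1 \<le> 2 * \<bar>s - s'\<bar> * (norm (P t (snd e) - P t (fst e)) / \<kappa>)"
        using k(1) k(2)[OF that] by (intro mult_left_mono) (auto simp: field_simps)
      have "bary_dist e s e s' = 2 * \<bar>s - s'\<bar>"
      proof -
        have "{fst e, snd e, fst e, snd e} = {fst e, snd e}" by auto
        then show ?thesis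
          using neq[OF e] by (simp add: bary_dist_def barycentric_def algebra_simps)
      qed
      then show ?thesis using A B by linarith
    qed
    then show ?thesis using k(1) by (intro exI[of _ "2 / \<kappa>"]) auto
  qed
  have adjacent: "?Q (a, b) (a, c)" if e: "(a, b) \<in> E" and f: "(a, c) \<in> E" and bc: "b \<noteq> c" for a b c
  proof -
    have ab: "a \<noteq> b" "a \<noteq> c" using neq[OF e] neq[OF f] by auto
    \<comment> \<open>Measured from the common vertex \<open>a\<close>, the difference of the two
      points is homogeneous in the parameters. A lower bound for parameters with sum 1 therefore
      suffices; it is rescaled by \<open>s + s'\<close> below.\<close>
    have "(1 - s) *\<^sub>R (P t b - P t a) - s *\<^sub>R (P t c - P t a) \<noteq> 0" if t: "t \<in> {0..1}" and s: "s \<in> {0..1}" for t s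
    proof
      assume "(1 - s) *\<^sub>R (P t b - P t a) - s *\<^sub>R (P t c - P t a) = 0"
      then have "barycentric (a, b) (1 - s) = barycentric (a, c) s"
        using s by (intro embD[OF t e f]) (auto simp: edge_pt_def algebra_simps)
      then have "barycentric (a, b) (1 - s) b = barycentric (a, c) s b"
        "barycentric (a, b) (1 - s) c = barycentric (a, c) s c" by simp_all
      then show False using ab bc by (auto simp: barycentric_def)
    qed
    then have "\<exists>\<kappa>>0. \<forall>t\<in>{0..1}. \<forall>s'\<in>{0..1::real}. \<forall>s\<in>{0..1}.
        \<kappa> \<le> norm ((1 - s) *\<^sub>R (P t b - P t a) - s *\<^sub>R (P t c - P t a))"
      by (intro uniform_lower_bound) (auto simp: case_prod_beta intro!: continuous_intros cont')
    then obtain \<kappa> where k: "\<kappa> > 0"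
        "\<And>t s. t \<in> {0..1} \<Longrightarrow> s \<in> {0..1} \<Longrightarrow> \<kappa> \<le> norm ((1 - s) *\<^sub>R (P t b - P t a) - s *\<^sub>R (P t c - P t a))"
      by fastforce
    have "bary_dist (a, b) s (a, c) s' \<le> (2 / \<kappa>) * norm (edge_pt (P t) (a, b) s - edge_pt (P t) (a, c) s')"
      if t: "t \<in> {0..1}" and s: "s \<in> {0..1}" "s' \<in> {0..1}" for t s s'
    proof -
      have "{fst (a, b), snd (a, b), fst (a, c), snd (a, c)} = {a, b, c}" by auto
      then have "bary_dist (a, b) s (a, c) s' = \<bar>s' - s\<bar> + (\<bar>s\<bar> + \<bar>s'\<bar>)"
        using ab bc by (simp add: bary_dist_def barycentric_def)
      also have "\<dots> \<le> 2 * (s + s')" using s by auto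
      finally have 1: "bary_dist (a, b) s (a, c) s' \<le> 2 * (s + s')" .
      have eq: "edge_pt (P t) (a, b) s - edge_pt (P t) (a, c) s' = s *\<^sub>R (P t b - P t a) - s' *\<^sub>R (P t c - P t a)"
        by (simp add: edge_pt_def algebra_simps)
      show ?thesis
      proof (cases "s + s' = 0")
        case True
        then have "2 * (s + s') \<le> (2 / \<kappa>) * norm (edge_pt (P t) (a, b) s - edge_pt (P t) (a, c) s')"
          using k(1) by simp
        then show ?thesis using 1 by linarith
      next
        case False
        then have pos: "s + s' > 0" using s by auto
        let ?u = "s' / (s + s')"
        have u: "?u \<in> {0..1}" "1 - ?u = s / (s + s')" using s pos by (auto simp: field_simps)
        have "s *\<^sub>R (P t b - P t a) - s' *\<^sub>R (P t c - P t a) =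
           (s + s') *\<^sub>R ((1 - ?u) *\<^sub>R (P t b - P t a) - ?u *\<^sub>R (P t c - P t a))"
          unfolding u(2) using pos by (simp add: scaleR_diff_right)
        then have "norm (s *\<^sub>R (P t b - P t a) - s' *\<^sub>R (P t c - P t a)) \<ge> (s + s') * \<kappa>"
          using k(2)[OF t u(1)] pos by (simp add: mult_left_mono)
        then have "2 * (s + s') \<le> (2 / \<kappa>) * norm (s *\<^sub>R (P t b - P t a) - s' *\<^sub>R (P t c - P t a))"
          using k(1) by (simp add: field_simps)
        then show ?thesis using 1 eq by simp
      qed
    qed
    then show ?thesis using k(1) by (intro exI[of _ "2 / \<kappa>"]) auto
  qed
  have disjoint: "?Q e f" if e: "e \<in> E" and f: "f \<in> E" and dis: "fst e \<notin> {fst f, snd f}" "snd e \<notin> {fst f, snd f}" for e f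
  proof -
    have "edge_pt (P t) e s - edge_pt (P t) f s' \<noteq> 0"
      if t: "t \<in> {0..1}" and s: "s \<in> {0..1}" "s' \<in> {0..1}" for t s s'
    proof
      assume "edge_pt (P t) e s - edge_pt (P t) f s' = 0"
      then have eq: "barycentric e s = barycentric f s'" by (intro embD[OF t e f s]) simp
      have "barycentric e s (fst e) = 0" "barycentric e s (snd e) = 0"
        unfolding eq using dis by (auto simp: barycentric_def)
      then show False using neq[OF e] by (auto simp: barycentric_def)
    qed
    then have "\<exists>\<kappa>>0. \<forall>t\<in>{0..1}. \<forall>s\<in>{0..1}. \<forall>s'\<in>{0..1}. \<kappa> \<le> norm (edge_pt (P t) e s - edge_pt (P t) f s')"
      by (intro uniform_lower_bound)
        (auto simp: case_prod_beta edge_pt_def intro!: continuous_intros cont')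
    then obtain \<kappa> where k: "\<kappa> > 0"
        "\<And>t s s'. t \<in> {0..1} \<Longrightarrow> s \<in> {0..1} \<Longrightarrow> s' \<in> {0..1} \<Longrightarrow> \<kappa> \<le> norm (edge_pt (P t) e s - edge_pt (P t) f s')"
      by blast
    have "bary_dist e s f s' \<le> (4 / \<kappa>) * norm (edge_pt (P t) e s - edge_pt (P t) f s')"
      if t: "t \<in> {0..1}" and s: "s \<in> {0..1}" "s' \<in> {0..1}" for t s s'
    proof -
      have "4 \<le> (4 / \<kappa>) * norm (edge_pt (P t) e s - edge_pt (P t) f s')"
        using k(1) k(2)[OF t s] by (simp add: field_simps)
      then show ?thesis using bary_dist_le[OF s, of e f] by linarith
    qed
    then show ?thesis using k(1) by (intro exI[of _ "4 / \<kappa>"]) auto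
  qed
  have swap_left: "?Q (prod.swap e) f \<Longrightarrow> ?Q e f" for e f
  proof -
    assume "?Q (prod.swap e) f"
    then obtain K where K: "K \<ge> 0" "\<And>t s s'. t \<in> {0..1} \<Longrightarrow> s \<in> {0..1} \<Longrightarrow> s' \<in> {0..1} \<Longrightarrow>
       bary_dist e (1 - s) f s' \<le> K * norm (edge_pt (P t) e (1 - s) - edge_pt (P t) f s')"
      unfolding bary_dist_swap_left edge_pt_swap by blast
    have "bary_dist e s f s' \<le> K * norm (edge_pt (P t) e s - edge_pt (P t) f s')"
      if "t \<in> {0..1}" "s \<in> {0..1}" "s' \<in> {0..1}" for t s s'
      using K(2)[of t "1 - s" s'] that by simp
    then show "?Q e f" using K(1) by blast
  qed
  have swap_right: "?Q e (prod.swap f) \<Longrightarrow> ?Q e f" for e f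
  proof -
    assume "?Q e (prod.swap f)"
    then obtain K where K: "K \<ge> 0" "\<And>t s s'. t \<in> {0..1} \<Longrightarrow> s \<in> {0..1} \<Longrightarrow> s' \<in> {0..1} \<Longrightarrow>
       bary_dist e s f (1 - s') \<le> K * norm (edge_pt (P t) e s - edge_pt (P t) f (1 - s'))"
      unfolding bary_dist_swap_right edge_pt_swap by blast
    have "bary_dist e s f s' \<le> K * norm (edge_pt (P t) e s - edge_pt (P t) f s')"
      if "t \<in> {0..1}" "s \<in> {0..1}" "s' \<in> {0..1}" for t s s'
      using K(2)[of t s "1 - s'"] that by simp
    then show "?Q e f" using K(1) by blast
  qed
  have start: "?Q (a, b) (a, c)" if "(a, b) \<in> E" "(a, c) \<in> E" for a b c
    using that same adjacent by (cases "b = c") blast+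
  obtain a b c d where ef: "e = (a, b)" "f = (c, d)" by (metis surj_pair)
  have E: "(a, b) \<in> E" "(b, a) \<in> E" "(c, d) \<in> E" "(d, c) \<in> E"
    using e f sym[OF e] sym[OF f] ef by auto
  \<comment> \<open>Reversing one or both edges turns every position of a common vertex into the
    first.\<close>
  consider "a = c" | "a = d" | "b = c" | "b = d" | "a \<notin> {c, d}" "b \<notin> {c, d}" by blast
  then show ?thesis
  proof cases
    case 1
    then show ?thesis using start E ef by blast
  next
    case 2
    then show ?thesis using start[of a b c] E ef swap_right[of e f] by simp
  next
    case 3
    then show ?thesis using start[of b a d] E ef swap_left[of e f] by simp
  next
    case 4
    then show ?thesis using start[of b a c] E ef swap_left[of e f] swap_right[of "prod.swap e" f] by simp
  next
    case 5
    then show ?thesis using disjoint[OF e f] ef by simp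
  qed
qed

lemma uniform_bary_dist_le_all:
  fixes P :: "real \<Rightarrow> 'v \<Rightarrow> 'a::euclidean_space"
  assumes "finite E" and cont: "\<And>v. continuous_on {0..1} (\<lambda>t. P t v)"
    and emb: "\<And>t. t \<in> {0..1} \<Longrightarrow> straight_embedding (P t) E"
    and neq: "\<And>e. e \<in> E \<Longrightarrow> fst e \<noteq> snd e"
  shows "\<exists>K\<ge>0. \<forall>e\<in>E. \<forall>f\<in>E. \<forall>t\<in>{0..1}. \<forall>s\<in>{0..1}. \<forall>s'\<in>{0..1}.
           bary_dist e s f s' \<le> K * norm (edge_pt (P t) e s - edge_pt (P t) f s')"
proof -
  let ?E = "E \<union> prod.swap ` E"
  have "\<exists>K\<ge>0. \<forall>t\<in>{0..1}. \<forall>s\<in>{0..1}. \<forall>s'\<in>{0..1}.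
           bary_dist (fst z) s (snd z) s' \<le> K * norm (edge_pt (P t) (fst z) s - edge_pt (P t) (snd z) s')"
    if "z \<in> E \<times> E" for z
    using that neq straight_embedding_swap[OF emb]
    by (intro uniform_bary_dist_le[where E = ?E] cont) fastforce+
  then obtain K where K: "\<And>z. z \<in> E \<times> E \<Longrightarrow> K z \<ge> 0 \<and> (\<forall>t\<in>{0..1}. \<forall>s\<in>{0..1}. \<forall>s'\<in>{0..1}.
           bary_dist (fst z) s (snd z) s' \<le> K z * norm (edge_pt (P t) (fst z) s - edge_pt (P t) (snd z) s'))"
    by metis
  have "bary_dist e s f s' \<le> sum K (E \<times> E) * norm (edge_pt (P t) e s - edge_pt (P t) f s')"
    if "e \<in> E" "f \<in> E" "t \<in> {0..1}" "s \<in> {0..1}" "s' \<in> {0..1}" for e f t s s'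
  proof -
    have "K (e, f) \<le> sum K (E \<times> E)"
      using that K \<open>finite E\<close> by (intro member_le_sum) auto
    then have "K (e, f) * norm (edge_pt (P t) e s - edge_pt (P t) f s')
        \<le> sum K (E \<times> E) * norm (edge_pt (P t) e s - edge_pt (P t) f s')"
      by (rule mult_right_mono) simp
    then show ?thesis using K[of "(e, f)"] that by fastforce
  qed
  moreover have "sum K (E \<times> E) \<ge> 0" using K by (intro sum_nonneg) auto
  ultimately show ?thesis by blast
qed

text \<open>The extension is injective on space, so it carries the embedding along: that
  \<open>q\<close> is again an embedding is a conclusion here.\<close>

lemma pl_equiv_small_displacement:
  fixes p q :: "'v \<Rightarrow> 'a::euclidean_space"
  assumes "finite E" "E \<noteq> {}" "\<And>e. e \<in> E \<Longrightarrow> norm (q (fst e) - p (fst e)) \<le> D \<and> norm (q (snd e) - p (snd e)) \<le> D"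
    and "K \<ge> 0" "\<And>e f s t. e \<in> E \<Longrightarrow> f \<in> E \<Longrightarrow> s \<in> {0..1} \<Longrightarrow> t \<in> {0..1} \<Longrightarrow>
       bary_dist e s f t \<le> K * norm (edge_pt p e s - edge_pt p f t)"
    and emb: "straight_embedding p E" and neq: "\<And>e. e \<in> E \<Longrightarrow> fst e \<noteq> snd e"
    and "real (DIM('a) * (1 + 2 * DIM('a))) * (D * K) < 1"
  shows "pl_equiv (realization p E) (realization q E) \<and> straight_embedding q E"
proof -
  have "p (fst e) \<noteq> p (snd e)" if e: "e \<in> E" for e
  proof
    assume "p (fst e) = p (snd e)"
    then have "edge_pt p e 0 = edge_pt p e 1" by (simp add: edge_pt_def)
    then have "barycentric e 0 (snd e) = barycentric e 1 (snd e)"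
      using emb e unfolding straight_embedding_def by (metis atLeastAtMost_iff order_refl zero_le_one)
    then show False using neq[OF e] by (simp add: barycentric_def)
  qed
  then obtain \<Phi> where P: "pl_shift \<Phi>" "\<And>e s. e \<in> E \<Longrightarrow> s \<in> {0..1} \<Longrightarrow> \<Phi> (edge_pt p e s) = edge_pt q e s"
    using pl_shift_extending_displacement[of E q p D K] assms by blast
  have "\<Phi> ` realization p E = realization q E"
  proof -
    have "realization r E = (\<Union>e\<in>E. edge_pt r e ` {0..1})" for r :: "'v \<Rightarrow> 'a"
      unfolding set_eq_iff mem_realization by blast
    then show ?thesis using P(2) by (simp add: image_UN image_image)
  qed
  moreover have "inj \<Phi>"
    using P(1) unfolding pl_shift_def homeomorphism_def by (metis UNIV_I inj_onI)
  then have "straight_embedding q E"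
    using emb P(2) unfolding straight_embedding_def by (metis injD)
  ultimately show ?thesis using P(1) unfolding pl_equiv_def by blast
qed

text \<open>The uniform estimate, applied to a motion at rest, supplies \<open>K\<close>; then
  \<open>\<epsilon>\<close> is chosen to bring the contraction constant below 1.\<close>

lemma pl_equiv_perturbation:
  fixes p :: "'v \<Rightarrow> 'a::euclidean_space"
  assumes "finite E" "E \<noteq> {}" "straight_embedding p E" "\<And>e. e \<in> E \<Longrightarrow> fst e \<noteq> snd e"
  shows "\<exists>\<epsilon>>0. \<forall>q. (\<forall>e\<in>E. norm (q (fst e) - p (fst e)) \<le> \<epsilon> \<and> norm (q (snd e) - p (snd e)) \<le> \<epsilon>) \<longrightarrow>
           pl_equiv (realization p E) (realization q E) \<and> straight_embedding q E"
proof -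
  obtain K where K: "K \<ge> 0" "\<forall>e\<in>E. \<forall>f\<in>E. \<forall>t\<in>{0..1::real}. \<forall>s\<in>{0..1}. \<forall>s'\<in>{0..1}.
           bary_dist e s f s' \<le> K * norm (edge_pt p e s - edge_pt p f s')"
    using uniform_bary_dist_le_all[of E "\<lambda>t. p"] assms by auto
  have K': "bary_dist e s f s' \<le> K * norm (edge_pt p e s - edge_pt p f s')"
    if "e \<in> E" "f \<in> E" "s \<in> {0..1}" "s' \<in> {0..1}" for e f s s'
    using K(2)[rule_format, OF that(1,2), of 0] that(3,4) by simp
  define N where "N = real (DIM('a) * (1 + 2 * DIM('a)))"
  have "N > 0" unfolding N_def of_nat_0_less_iff using DIM_positive[where 'a = 'a] by simp
  define \<epsilon> where "\<epsilon> = 1 / (N * (K + 1) * 2)"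
  have "N * (\<epsilon> * K) = K / ((K + 1) * 2)" using \<open>N > 0\<close> by (simp add: \<epsilon>_def)
  also have "\<dots> < 1" using K(1) by (simp add: field_simps)
  finally have small: "N * (\<epsilon> * K) < 1" .
  have "\<epsilon> > 0" using \<open>N > 0\<close> K(1) by (simp add: \<epsilon>_def)
  moreover have "pl_equiv (realization p E) (realization q E) \<and> straight_embedding q E"
    if "\<forall>e\<in>E. norm (q (fst e) - p (fst e)) \<le> \<epsilon> \<and> norm (q (snd e) - p (snd e)) \<le> \<epsilon>" for q
    by (rule pl_equiv_small_displacement[of E q p \<epsilon> K])
      (use assms that K(1) K' small in \<open>auto simp: N_def\<close>)
  ultimately show ?thesis by blast
qed

text \<open>One \<open>K\<close> serves all times. Dividing the motion into \<open>m\<close> equal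
  steps reduces each displacement to \<open>C / m\<close> without affecting \<open>K\<close>, so for
  large \<open>m\<close> every step extends to space.\<close>

lemma pl_equiv_linear_motion:
  fixes p q :: "'v \<Rightarrow> 'a::euclidean_space"
  assumes E: "finite E" "E \<noteq> {}" and neq: "\<And>e. e \<in> E \<Longrightarrow> fst e \<noteq> snd e"
    and emb: "\<And>t. t \<in> {0..1} \<Longrightarrow> straight_embedding (\<lambda>v. (1 - t) *\<^sub>R p v + t *\<^sub>R q v) E"
  shows "pl_equiv (realization p E) (realization q E)"
proof -
  define P where "P = (\<lambda>t v. (1 - t) *\<^sub>R p v + t *\<^sub>R q v)"
  have "\<exists>K\<ge>0. \<forall>e\<in>E. \<forall>f\<in>E. \<forall>t\<in>{0..1}. \<forall>s\<in>{0..1}. \<forall>s'\<in>{0..1}.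
           bary_dist e s f s' \<le> K * norm (edge_pt (P t) e s - edge_pt (P t) f s')"
    using emb by (intro uniform_bary_dist_le_all E(1) neq) (auto simp: P_def intro!: continuous_intros)
  then obtain K where K: "K \<ge> 0" "\<And>e f s t s'. e \<in> E \<Longrightarrow> f \<in> E \<Longrightarrow> t \<in> {0..1} \<Longrightarrow> s \<in> {0..1} \<Longrightarrow> s' \<in> {0..1} \<Longrightarrow>
           bary_dist e s f s' \<le> K * norm (edge_pt (P t) e s - edge_pt (P t) f s')"
    by blast
  define C where "C = (\<Sum>e\<in>E. norm (q (fst e) - p (fst e)) + norm (q (snd e) - p (snd e)))"
  have C: "norm (q (fst e) - p (fst e)) \<le> C" "norm (q (snd e) - p (snd e)) \<le> C" if "e \<in> E" for e
  proof -
    have "norm (q (fst e) - p (fst e)) + norm (q (snd e) - p (snd e)) \<le> C"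
      unfolding C_def using that E(1) by (intro member_le_sum[of e E "\<lambda>e. norm (q (fst e) - p (fst e)) + norm (q (snd e) - p (snd e))"]) auto
    then show "norm (q (fst e) - p (fst e)) \<le> C" "norm (q (snd e) - p (snd e)) \<le> C"
      using norm_ge_zero[of "q (fst e) - p (fst e)"] norm_ge_zero[of "q (snd e) - p (snd e)"] by linarith+
  qed
  define N where "N = real (DIM('a) * (1 + 2 * DIM('a)))"
  obtain m :: nat where m: "N * (C * K) < real m" "m > 0"
  proof -
    obtain m :: nat where "N * (C * K) < real m" using reals_Archimedean2 by blast
    then show ?thesis using that[of "Suc m"] by simp
  qed
  have step: "pl_equiv (realization (P (real k / m)) E) (realization (P (real (Suc k) / m)) E)" if "k < m" for k
  proof -
    have t: "real k / m \<in> {0..1}" using that by simp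
    have "P (real (Suc k) / m) v - P (real k / m) v = (1 / m) *\<^sub>R (q v - p v)" for v
    proof -
      have "real (Suc k) / m = real k / m + 1 / m" by (simp add: add_divide_distrib)
      then show ?thesis by (simp add: P_def algebra_simps)
    qed
    then have "norm (P (real (Suc k) / m) v - P (real k / m) v) = norm (q v - p v) / m" for v by simp
    then have d: "norm (P (real (Suc k) / m) (fst e) - P (real k / m) (fst e)) \<le> C / m \<and>
        norm (P (real (Suc k) / m) (snd e) - P (real k / m) (snd e)) \<le> C / m" if "e \<in> E" for e
      using C[OF that] by (simp only: divide_right_mono of_nat_0_le_iff)
    have "N * (C / m * K) < 1" using m by (simp add: field_simps)
    then show ?thesis
      using pl_equiv_small_displacement[of E "P (real (Suc k) / m)" "P (real k / m)" "C / m" K]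
        E K(1) K(2)[OF _ _ t] neq emb[OF t] d unfolding P_def N_def by blast
  qed
  have "k \<le> m \<Longrightarrow> pl_equiv (realization (P 0) E) (realization (P (real k / m)) E)" for k
  proof (induction k)
    case 0
    then show ?case by (simp add: pl_equiv_refl)
  next
    case (Suc k)
    then show ?case using step[of k] pl_equiv_trans by (metis Suc_leD Suc_le_lessD)
  qed
  from this[of m] show ?thesis using m(2) by (simp add: P_def)
qed

section \<open>Subdividing segments at finitely many points\<close>

abbreviation support :: "('a::real_vector \<times> 'a) set \<Rightarrow> 'a set" where
  "support E \<equiv> realization (\<lambda>x. x) E"

text \<open>The pieces between consecutive points of \<open>V\<close>. Each occurs in both
  directions, and overlapping segments of \<open>S\<close> share their pieces.\<close>

definition cut :: "('a::real_vector \<times> 'a) set \<Rightarrow> 'a set \<Rightarrow> ('a \<times> 'a) set" where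
  "cut S V = {(a, b). a \<in> V \<and> b \<in> V \<and> a \<noteq> b \<and> open_segment a b \<inter> V = {} \<and>
     (\<exists>c d. (c, d) \<in> S \<and> closed_segment a b \<subseteq> closed_segment c d)}"

text \<open>Among the pairs of points of \<open>V\<close> that span a subsegment of
  \<open>A B\<close> around \<open>z\<close>, take a closest one. A further point of
  \<open>V\<close> between them would give a closer pair.\<close>

lemma cut_covers:
  fixes A B :: "'a::euclidean_space"
  assumes V: "finite V" "A \<in> V" "B \<in> V" and AB: "A \<noteq> B" "(A, B) \<in> S" and z: "z \<in> closed_segment A B"
  shows "\<exists>a b. (a, b) \<in> cut S V \<and> z \<in> closed_segment a b"
proof -
  let ?Q = "{(a, b). a \<in> V \<and> b \<in> V \<and> a \<noteq> b \<and> z \<in> closed_segment a b \<and> closed_segment a b \<subseteq> closed_segment A B}"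
  have "?Q \<subseteq> V \<times> V" by auto
  then have fin: "finite ?Q" using V(1) finite_subset by blast
  have ne: "?Q \<noteq> {}" using V AB z by blast
  define ab where "ab = arg_min_on (\<lambda>e. dist (fst e) (snd e)) ?Q"
  have ab: "ab \<in> ?Q" unfolding ab_def by (rule arg_min_if_finite(1)[OF fin ne])
  have ab_min: "dist (fst ab) (snd ab) \<le> dist (fst cd) (snd cd)" if "cd \<in> ?Q" for cd
    unfolding ab_def using arg_min_least[OF fin ne that] .
  obtain a b where eq: "ab = (a, b)" by (cases ab)
  have Q: "a \<in> V" "b \<in> V" "a \<noteq> b" "z \<in> closed_segment a b" "closed_segment a b \<subseteq> closed_segment A B"
    using ab eq by auto
  have False if c: "c \<in> open_segment a b" "c \<in> V" for c
  proof -
    have cc: "c \<in> closed_segment a b" "c \<noteq> a" "c \<noteq> b" using c(1) by (auto simp: open_segment_def)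
    have sub: "closed_segment a c \<subseteq> closed_segment a b" "closed_segment c b \<subseteq> closed_segment a b"
      using cc(1) by (simp_all add: subset_closed_segment)
    have "closed_segment a b = closed_segment a c \<union> closed_segment c b"
      using Un_closed_segment[OF cc(1)] by simp
    then consider "z \<in> closed_segment a c" | "z \<in> closed_segment c b" using Q(4) by blast
    then show False
    proof cases
      case 1
      then have "(a, c) \<in> ?Q" using Q c(2) cc sub by auto
      then have "dist a b \<le> dist a c" using ab_min[of "(_, _)"] eq by fastforce
      then show False using dist_in_open_segment[OF c(1)] by (simp add: dist_commute)
    next
      case 2
      then have "(c, b) \<in> ?Q" using Q c(2) cc sub by auto
      then have "dist a b \<le> dist c b" using ab_min[of "(_, _)"] eq by fastforce
      then show False using dist_in_open_segment[OF c(1)] by (simp add: dist_commute)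
    qed
  qed
  then have "(a, b) \<in> cut S V" using Q AB(2) unfolding cut_def by blast
  then show ?thesis using Q(4) by blast
qed

lemma realization_cut:
  fixes S :: "('a::euclidean_space \<times> 'a) set"
  assumes "finite V" "\<And>a b. (a, b) \<in> S \<Longrightarrow> a \<in> V \<and> b \<in> V \<and> a \<noteq> b"
  shows "support (cut S V) = support S"
proof
  show "support (cut S V) \<subseteq> support S"
    unfolding realization_def cut_def by fastforce
  show "support S \<subseteq> support (cut S V)"
  proof
    fix z assume "z \<in> support S"
    then obtain A B where "(A, B) \<in> S" "z \<in> closed_segment A B" by (auto simp: realization_def)
    then obtain a b where "(a, b) \<in> cut S V" "z \<in> closed_segment a b"
      using cut_covers[of V A B S z] assms by blast
    then show "z \<in> support (cut S V)" unfolding realization_def by force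
  qed
qed

lemma finite_cut: "finite V \<Longrightarrow> finite (cut S V)"
  by (rule finite_subset[of _ "V \<times> V"]) (auto simp: cut_def)

text \<open>A coordinate on the line of the segment, with origin \<open>z\<close> and unit
  \<open>w - z\<close>.\<close>

lemma segment_coordinate:
  fixes A :: "'a::real_vector"
  assumes "a \<in> closed_segment A B" "z \<in> closed_segment A B" "w \<in> closed_segment A B" "w \<noteq> z"
  shows "\<exists>\<alpha>. a = z + \<alpha> *\<^sub>R (w - z)"
proof -
  obtain i j k where *: "a = A + i *\<^sub>R (B - A)" "z = A + j *\<^sub>R (B - A)" "w = A + k *\<^sub>R (B - A)"
    using assms(1-3) by (auto simp: closed_segment_def algebra_simps)
  have "k \<noteq> j" using assms(4) * by auto
  have "a - z = (i - j) *\<^sub>R (B - A)" "w - z = (k - j) *\<^sub>R (B - A)" by (simp_all add: * algebra_simps)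
  then have "a - z = ((i - j) / (k - j)) *\<^sub>R (w - z)" using \<open>k \<noteq> j\<close> by simp
  then show ?thesis by (intro exI[of _ "(i - j) / (k - j)"]) (simp add: algebra_simps)
qed

text \<open>If \<open>z\<close> is not in \<open>V\<close>, it is interior to both pieces, and the
  second common point \<open>w\<close> puts the pieces on one line. With \<open>z\<close> as origin,
  the ends of each piece have coordinates of opposite sign. On either side the nearer of two
  different ends would be a point of \<open>V\<close> inside the other piece, so the ends
  agree.\<close>

lemma cut_pieces_meet:
  fixes S :: "('a::euclidean_space \<times> 'a) set"
  assumes ab: "(a, b) \<in> cut S V" and cd: "(c, d) \<in> cut S V"
    and z: "z \<in> closed_segment a b" "z \<in> closed_segment c d"
    and meet: "\<And>A B C D. (A, B) \<in> S \<Longrightarrow> (C, D) \<in> S \<Longrightarrow> z \<in> closed_segment A B \<Longrightarrow> z \<in> closed_segment C D \<Longrightarrow>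
        z \<in> V \<or> (\<exists>w. w \<noteq> z \<and> w \<in> closed_segment A B \<and> w \<in> closed_segment C D)"
  shows "z \<in> {a, b} \<and> z \<in> {c, d} \<or> {a, b} = {c, d}"
proof (cases "z \<in> V")
  case True
  then show ?thesis using ab cd z by (auto simp: cut_def open_segment_def)
next
  case False
  obtain A B C D where AB: "(A, B) \<in> S" "closed_segment a b \<subseteq> closed_segment A B"
      and CD: "(C, D) \<in> S" "closed_segment c d \<subseteq> closed_segment C D"
    using ab cd unfolding cut_def by blast
  have zo: "z \<in> open_segment a b" "z \<in> open_segment c d"
    using False ab cd z by (auto simp: cut_def open_segment_def)
  have V: "a \<in> V" "b \<in> V" "c \<in> V" "d \<in> V" "open_segment a b \<inter> V = {}" "open_segment c d \<inter> V = {}" "a \<noteq> b" "c \<noteq> d"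
    using ab cd by (auto simp: cut_def)
  obtain w where w: "w \<noteq> z" "w \<in> closed_segment A B" "w \<in> closed_segment C D"
    using meet[OF AB(1) CD(1)] AB(2) CD(2) z False by blast
  define u where "u = w - z"
  have u: "u \<noteq> 0" using w by (simp add: u_def)
  have inAB: "a \<in> closed_segment A B" "b \<in> closed_segment A B" "z \<in> closed_segment A B"
    and inCD: "c \<in> closed_segment C D" "d \<in> closed_segment C D" "z \<in> closed_segment C D"
    using AB(2) CD(2) z by auto
  obtain \<alpha> \<beta> \<gamma> \<delta> where *: "a = z + \<alpha> *\<^sub>R u" "b = z + \<beta> *\<^sub>R u" "c = z + \<gamma> *\<^sub>R u" "d = z + \<delta> *\<^sub>R u"
    using segment_coordinate[OF inAB(1,3) w(2,1)] segment_coordinate[OF inAB(2,3) w(2,1)]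
      segment_coordinate[OF inCD(1,3) w(3,1)] segment_coordinate[OF inCD(2,3) w(3,1)]
    unfolding u_def by blast
  have opp: "\<alpha> * \<beta> < 0" if zo: "z \<in> open_segment (z + \<alpha> *\<^sub>R u) (z + \<beta> *\<^sub>R u)" for \<alpha> \<beta>
  proof -
    obtain s where s: "0 < s" "s < 1" "z = (1 - s) *\<^sub>R (z + \<alpha> *\<^sub>R u) + s *\<^sub>R (z + \<beta> *\<^sub>R u)" "\<alpha> \<noteq> \<beta>"
      using zo by (auto simp: in_segment)
    then have "((1 - s) * \<alpha> + s * \<beta>) *\<^sub>R u = 0" by (simp add: algebra_simps)
    then have eq: "(1 - s) * \<alpha> = - (s * \<beta>)" using u by auto
    have "\<alpha> \<noteq> 0" "\<beta> \<noteq> 0" using eq s by auto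
    have "(1 - s) * (\<alpha> * \<beta>) = - (s * (\<beta> * \<beta>))" using eq by (metis minus_mult_left mult.assoc)
    also have "\<dots> < 0" using s \<open>\<beta> \<noteq> 0\<close> by (auto simp: zero_less_mult_iff)
    finally show ?thesis using s by (simp add: mult_less_0_iff)
  qed
  have shorter: "z + \<gamma> *\<^sub>R u \<in> open_segment (z + \<alpha> *\<^sub>R u) (z + \<beta> *\<^sub>R u)"
    if "\<alpha> * \<beta> < 0" "\<alpha> * \<gamma> > 0" "\<bar>\<gamma>\<bar> < \<bar>\<alpha>\<bar>" for \<alpha> \<beta> \<gamma>
  proof -
    have "\<alpha> \<noteq> \<beta>" using that by (metis not_less zero_le_square)
    define s where "s = (\<gamma> - \<alpha>) / (\<beta> - \<alpha>)"
    have s: "0 < s" "s < 1"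
      using that unfolding s_def by (auto simp: divide_simps mult_less_0_iff zero_less_mult_iff)
    have "s * (\<beta> - \<alpha>) = \<gamma> - \<alpha>" using \<open>\<alpha> \<noteq> \<beta>\<close> by (simp add: s_def)
    then have "(1 - s) * \<alpha> + s * \<beta> = \<gamma>" by (simp add: algebra_simps)
    moreover have "(1 - s) *\<^sub>R (z + \<alpha> *\<^sub>R u) + s *\<^sub>R (z + \<beta> *\<^sub>R u) = z + ((1 - s) * \<alpha> + s * \<beta>) *\<^sub>R u"
      by (simp add: algebra_simps)
    ultimately have "z + \<gamma> *\<^sub>R u = (1 - s) *\<^sub>R (z + \<alpha> *\<^sub>R u) + s *\<^sub>R (z + \<beta> *\<^sub>R u)" by simp
    then show ?thesis using \<open>\<alpha> \<noteq> \<beta>\<close> u s unfolding in_segment by auto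
  qed
  have ab0: "\<alpha> * \<beta> < 0" and cd0: "\<gamma> * \<delta> < 0" using opp zo * by auto
  have same: "\<alpha> = \<gamma>" if "\<alpha> * \<gamma> > 0" "\<alpha> * \<beta> < 0" "\<gamma> * \<delta> < 0"
      "z + \<gamma> *\<^sub>R u \<notin> open_segment (z + \<alpha> *\<^sub>R u) (z + \<beta> *\<^sub>R u)"
      "z + \<alpha> *\<^sub>R u \<notin> open_segment (z + \<gamma> *\<^sub>R u) (z + \<delta> *\<^sub>R u)" for \<alpha> \<beta> \<gamma> \<delta>
  proof -
    have "\<not> \<bar>\<gamma>\<bar> < \<bar>\<alpha>\<bar>" "\<not> \<bar>\<alpha>\<bar> < \<bar>\<gamma>\<bar>"
      using shorter[of \<alpha> \<beta> \<gamma>] shorter[of \<gamma> \<delta> \<alpha>] that by (auto simp: mult.commute)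
    then show ?thesis using that(1) by (auto simp: abs_if zero_less_mult_iff split: if_splits)
  qed
  have no: "c \<notin> open_segment a b" "d \<notin> open_segment a b" "a \<notin> open_segment c d" "b \<notin> open_segment c d"
    using V by auto
  have no': "c \<notin> open_segment b a" "d \<notin> open_segment b a" "a \<notin> open_segment d c" "b \<notin> open_segment d c"
    using no by (simp_all add: open_segment_commute)
  note nos = no[unfolded *] no'[unfolded *]
  have "{a, b} = {c, d}"
  proof (cases "\<alpha> * \<gamma> > 0")
    case True
    then have "\<beta> * \<delta> > 0" using ab0 cd0 by (auto simp: zero_less_mult_iff mult_less_0_iff)
    then have "\<alpha> = \<gamma>" "\<beta> = \<delta>"
      using same[of \<alpha> \<gamma> \<beta> \<delta>] same[of \<beta> \<delta> \<alpha> \<gamma>] True ab0 cd0 nos by (auto simp: mult.commute)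
    then show ?thesis using * by simp
  next
    case False
    then have "\<alpha> * \<delta> > 0" "\<beta> * \<gamma> > 0" using ab0 cd0
      by (auto simp: zero_less_mult_iff mult_less_0_iff not_less)
    then have "\<alpha> = \<delta>" "\<beta> = \<gamma>"
      using same[of \<alpha> \<delta> \<beta> \<gamma>] same[of \<beta> \<gamma> \<alpha> \<delta>] ab0 cd0 nos by (auto simp: mult.commute)
    then show ?thesis using * by auto
  qed
  then show ?thesis by blast
qed

lemma straight_embedding_id:
  fixes E :: "('a::euclidean_space \<times> 'a) set"
  assumes neq: "\<And>a b. (a, b) \<in> E \<Longrightarrow> a \<noteq> b"
    and meet: "\<And>a b c d z. (a, b) \<in> E \<Longrightarrow> (c, d) \<in> E \<Longrightarrow> z \<in> closed_segment a b \<Longrightarrow> z \<in> closed_segment c d \<Longrightarrow>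
       z \<in> {a, b} \<and> z \<in> {c, d} \<or> {a, b} = {c, d}"
  shows "straight_embedding (\<lambda>x. x) E"
  unfolding straight_embedding_def
proof (intro ballI impI)
  fix e f s t assume e: "e \<in> E" and f: "f \<in> E" and s: "s \<in> {0..1::real}" and t: "t \<in> {0..1::real}"
    and eq: "edge_pt (\<lambda>x. x) e s = edge_pt (\<lambda>x. x) f t"
  obtain a b c d where ef: "e = (a, b)" "f = (c, d)" by (metis surj_pair)
  have ne: "a \<noteq> b" "c \<noteq> d" using e f ef neq by auto
  define z where "z = edge_pt (\<lambda>x. x) e s"
  have z: "z = a + s *\<^sub>R (b - a)" "z = c + t *\<^sub>R (d - c)"
    using eq by (auto simp: z_def ef edge_pt_def algebra_simps)
  have "z \<in> closed_segment a b" "z \<in> closed_segment c d"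
  proof -
    have "z = (1 - s) *\<^sub>R a + s *\<^sub>R b" "z = (1 - t) *\<^sub>R c + t *\<^sub>R d"
      using eq by (simp_all add: z_def ef edge_pt_def)
    then show "z \<in> closed_segment a b" "z \<in> closed_segment c d"
      using s t unfolding closed_segment_def mem_Collect_eq atLeastAtMost_iff by blast+
  qed
  then consider "z \<in> {a, b} \<and> z \<in> {c, d}" | "{a, b} = {c, d}" using meet e f ef by blast
  then show "barycentric e s = barycentric f t"
  proof cases
    case 1
    have *: "barycentric (a, b) s = (\<lambda>v. of_bool (v = z))"
      if "z \<in> {a, b}" "z = a + s *\<^sub>R (b - a)" "a \<noteq> b" for a b s
    proof -
      have "z = a \<or> z = b" using that(1) by blast
      then show ?thesis
      proof (elim disjE)
        assume 1: "z = a"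
        then have "s = 0" using that by simp
        then show ?thesis using 1 by (auto simp: barycentric_def)
      next
        assume 2: "z = b"
        then have "b - a = s *\<^sub>R (b - a)" using that(2) by (metis add_diff_cancel_left')
        then have "(1 - s) *\<^sub>R (b - a) = 0" by (metis diff_self scaleR_diff_left scaleR_one)
        then have "s = 1" using that(3) by (metis right_minus_eq scaleR_eq_0_iff)
        then show ?thesis using 2 by (auto simp: barycentric_def)
      qed
    qed
    have "barycentric e s = (\<lambda>v. of_bool (v = z))" "barycentric f t = (\<lambda>v. of_bool (v = z))"
      unfolding ef using *[OF _ z(1) ne(1)] *[OF _ z(2) ne(2)] 1 by blast+
    then show ?thesis by simp
  next
    case 2
    then consider "c = a" "d = b" | "c = b" "d = a" by (auto simp: doubleton_eq_iff)
    then show ?thesis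
    proof cases
      case 1
      then have "s *\<^sub>R (b - a) = t *\<^sub>R (b - a)" using z by (metis add_left_cancel)
      then have "s = t" using ne by (metis right_minus_eq scaleR_cancel_right)
      then show ?thesis unfolding ef 1 by simp
    next
      case 2
      then have "a + s *\<^sub>R (b - a) = b + t *\<^sub>R (a - b)" using z by (metis (no_types))
      then have "(s - (1 - t)) *\<^sub>R (b - a) = 0" by (simp add: algebra_simps)
      then have "s = 1 - t" using ne by (metis right_minus_eq scaleR_eq_0_iff)
      then show ?thesis unfolding ef 2 by (auto simp: barycentric_def fun_eq_iff)
    qed
  qed
qed

lemma straight_structure_of_segments:
  fixes S :: "('a::euclidean_space \<times> 'a) set"
  assumes S: "finite S" "S \<noteq> {}" "\<And>a b. (a, b) \<in> S \<Longrightarrow> a \<noteq> b"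
  shows "\<exists>E. finite E \<and> E \<noteq> {} \<and> (\<forall>e\<in>E. fst e \<noteq> snd e) \<and> straight_embedding (\<lambda>x. x) E \<and>
            support E = support S"
proof -
  let ?seg = "\<lambda>e. closed_segment (fst e) (snd e)"
  \<comment> \<open>Only intersections in a single point require new vertices. Segments with more
    than one common point satisfy the second alternative of the hypothesis of
    \<open>cut_pieces_meet\<close>.\<close>
  define V where "V = fst ` S \<union> snd ` S \<union> (\<Union>e\<in>S. \<Union>f\<in>S. {z. ?seg e \<inter> ?seg f = {z}})"
  have fin: "finite {z. X = {z}}" for X :: "'a set"
  proof (cases "\<exists>z. X = {z}")
    case True
    then obtain z where "X = {z}" by blast
    then have "{z. X = {z}} = {z}" by auto
    then show ?thesis by simp
  qed simp
  have V: "finite V" unfolding V_def by (intro finite_UnI finite_UN_I finite_imageI S(1) fin)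
  have ends: "a \<in> V \<and> b \<in> V \<and> a \<noteq> b" if "(a, b) \<in> S" for a b
    using that S(3)[OF that] image_eqI[of a fst "(a, b)" S] image_eqI[of b snd "(a, b)" S]
    unfolding V_def by simp
  have meet: "z \<in> V \<or> (\<exists>w. w \<noteq> z \<and> w \<in> closed_segment A B \<and> w \<in> closed_segment C D)"
    if "(A, B) \<in> S" "(C, D) \<in> S" "z \<in> closed_segment A B" "z \<in> closed_segment C D" for A B C D z
  proof (cases "closed_segment A B \<inter> closed_segment C D = {z}")
    case True
    then have "z \<in> (\<Union>e\<in>S. \<Union>f\<in>S. {z. ?seg e \<inter> ?seg f = {z}})"
      using that by (intro UN_I[of "(A, B)"] UN_I[of "(C, D)"]) simp_all
    then have "z \<in> V" unfolding V_def by blast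
    then show ?thesis by simp
  next
    case False
    then show ?thesis using that by blast
  qed
  have "straight_embedding (\<lambda>x. x) (cut S V)"
  proof (rule straight_embedding_id)
    show "a \<noteq> b" if "(a, b) \<in> cut S V" for a b using that by (auto simp: cut_def)
    show "z \<in> {a, b} \<and> z \<in> {c, d} \<or> {a, b} = {c, d}"
      if "(a, b) \<in> cut S V" "(c, d) \<in> cut S V" "z \<in> closed_segment a b" "z \<in> closed_segment c d" for a b c d z
      using cut_pieces_meet[OF that meet] by blast
  qed
  moreover have "support (cut S V) = support S"
    using realization_cut[OF V ends] by simp
  moreover have "cut S V \<noteq> {}"
  proof -
    obtain a b where ab: "(a, b) \<in> S" using S(2) by auto
    then show ?thesis using cut_covers[of V a b S a] V ends by blast
  qed
  moreover have "fst e \<noteq> snd e" if "e \<in> cut S V" for e using that by (auto simp: cut_def)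
  ultimately show ?thesis using finite_cut[OF V] by blast
qed

section \<open>General position of the diagram\<close>

text \<open>Twice the signed area of the triangle that \<open>p\<close>, \<open>q\<close>,
  \<open>r\<close> form in the plane of coordinates 1 and 3.\<close>

definition planar_det :: "real^3 \<Rightarrow> real^3 \<Rightarrow> real^3 \<Rightarrow> real" where
  "planar_det p q r = (q$1 - p$1) * (r$3 - p$3) - (r$1 - p$1) * (q$3 - p$3)"

definition same_proj :: "real^3 \<Rightarrow> real^3 \<Rightarrow> bool" where
  "same_proj x y \<longleftrightarrow> x$1 = y$1 \<and> x$3 = y$3"

definition concurrent :: "real^3 \<Rightarrow> real^3 \<Rightarrow> real^3 \<Rightarrow> real^3 \<Rightarrow> real^3 \<Rightarrow> real^3 \<Rightarrow> bool" where
  "concurrent a b c d e f \<longleftrightarrow> (\<exists>x\<in>closed_segment a b. \<exists>y\<in>closed_segment c d. \<exists>z\<in>closed_segment e f.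
     same_proj x y \<and> same_proj y z)"

text \<open>The conditions range over all tuples of points, whether or not they span edges. They
  depend on the vertex set alone and can thus be achieved by adding one vertex at a time.\<close>

definition generic :: "(real^3) set \<Rightarrow> bool" where
  "generic W \<longleftrightarrow>
     (\<forall>a\<in>W. \<forall>b\<in>W. a \<noteq> b \<longrightarrow> \<not> same_proj a b) \<and>
     (\<forall>a\<in>W. \<forall>b\<in>W. \<forall>c\<in>W. distinct [a, b, c] \<longrightarrow> planar_det a b c \<noteq> 0) \<and>
     (\<forall>a\<in>W. \<forall>b\<in>W. \<forall>c\<in>W. \<forall>d\<in>W. \<forall>e\<in>W. \<forall>f\<in>W.
        distinct [a, b, c, d, e, f] \<longrightarrow> \<not> concurrent a b c d e f)"

section \<open>Incidence of lines in the plane of projection\<close>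

lemma planar_det_swap: "planar_det p r q = - planar_det p q r" and planar_det_rotate: "planar_det q r p = planar_det p q r"
  by (simp_all add: planar_det_def algebra_simps)

lemma planar_det_refl [simp]: "planar_det p q p = 0" "planar_det p q q = 0" "planar_det p p q = 0"
  by (simp_all add: planar_det_def)

lemma same_proj_sym: "same_proj x y \<Longrightarrow> same_proj y x"
  and same_proj_trans: "same_proj x y \<Longrightarrow> same_proj y z \<Longrightarrow> same_proj x z"
  and same_proj_refl [simp]: "same_proj x x"
  by (auto simp: same_proj_def)

lemma same_proj_eq: "same_proj x y \<Longrightarrow> x$2 = y$2 \<Longrightarrow> x = y"
  by (auto simp: same_proj_def vec_eq_iff forall_3)

lemma planar_det_same_proj: "same_proj x y \<Longrightarrow> planar_det a b x = planar_det a b y"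
  by (simp add: same_proj_def planar_det_def)

lemma in_segmentE:
  fixes a b :: "'a::real_vector"
  assumes "x \<in> closed_segment a b"
  obtains s where "0 \<le> s" "s \<le> 1" "x = a + s *\<^sub>R (b - a)"
proof -
  obtain s where s: "0 \<le> s" "s \<le> 1" "x = (1 - s) *\<^sub>R a + s *\<^sub>R b"
    using assms by (auto simp: closed_segment_def)
  then have "x = a + s *\<^sub>R (b - a)" by (simp add: algebra_simps)
  then show thesis using that s by blast
qed

lemma planar_det_segment: "x \<in> closed_segment a b \<Longrightarrow> planar_det a b x = 0"
  by (elim in_segmentE, hypsubst, simp add: planar_det_def algebra_simps)

lemma parallel_multiple:
  fixes a1 a2 b1 b2 :: real
  assumes "a1 * b2 = a2 * b1" "b1 \<noteq> 0 \<or> b2 \<noteq> 0"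
  shows "\<exists>k. a1 = k * b1 \<and> a2 = k * b2"
proof (cases "b1 = 0")
  case True
  then show ?thesis using assms by (intro exI[of _ "a2 / b2"]) auto
next
  case False
  then show ?thesis using assms by (intro exI[of _ "a1 / b1"]) (auto simp: field_simps)
qed

text \<open>Two lines with two different common points coincide. In general position this leaves at
  most one crossing for two edges.\<close>

lemma collinear_through_two_points:
  assumes "planar_det c d x = 0" "planar_det c d x' = 0" "planar_det e f x = 0" "planar_det e f x' = 0"
    and ne: "\<not> same_proj x x'" "\<not> same_proj e f"
  shows "planar_det c d e = 0"
proof -
  define u1 where "u1 = x'$1 - x$1"
  define u3 where "u3 = x'$3 - x$3"
  have u: "u1 \<noteq> 0 \<or> u3 \<noteq> 0" using ne(1) by (auto simp: same_proj_def u1_def u3_def)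
  have "(d$1 - c$1) * u3 = (d$3 - c$3) * u1" "(f$1 - e$1) * u3 = (f$3 - e$3) * u1"
    using assms(1-4) by (simp_all add: planar_det_def u1_def u3_def algebra_simps)
  then obtain m k where m: "d$1 - c$1 = m * u1" "d$3 - c$3 = m * u3"
      and k: "f$1 - e$1 = k * u1" "f$3 - e$3 = k * u3"
    using parallel_multiple u by meson
  have "k \<noteq> 0" using k ne(2) by (auto simp: same_proj_def)
  have "k * (u1 * (x$3 - e$3) - (x$1 - e$1) * u3) = planar_det e f x"
    unfolding planar_det_def k by (simp add: algebra_simps)
  then have *: "u1 * (x$3 - e$3) = (x$1 - e$1) * u3" using \<open>k \<noteq> 0\<close> assms(3) by simp
  have "planar_det c d e = planar_det c d x - m * (u1 * (x$3 - e$3) - (x$1 - e$1) * u3)"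
    unfolding planar_det_def m by (simp add: algebra_simps)
  then show ?thesis using * assms(1) by simp
qed

lemma concurrent_perms:
  "concurrent a b c d e f \<Longrightarrow> concurrent b a c d e f"
  "concurrent a b c d e f \<Longrightarrow> concurrent c d a b e f"
  "concurrent a b c d e f \<Longrightarrow> concurrent e f a b c d"
  unfolding concurrent_def closed_segment_commute[of b a]
  by (meson same_proj_sym same_proj_trans)+

text \<open>Vertices are moved along parabolas because a parabola meets every line in at most two points.\<close>

definition parabola :: "real^3 \<Rightarrow> real \<Rightarrow> real^3" where
  "parabola v s = (\<chi> i. if i = 1 then v$1 + s else if i = 3 then v$3 + s\<^sup>2 else v$i)"

lemma parabola_nth [simp]: "parabola v s $ 1 = v$1 + s" "parabola v s $ 3 = v$3 + s\<^sup>2" "parabola v s $ 2 = v$2"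
  by (simp_all add: parabola_def)

lemma finite_parabola_line:
  assumes "\<not> same_proj p q" shows "finite {s. planar_det p q (parabola v s) = 0}"
proof -
  let ?P = "[:(q$1 - p$1) * (v$3 - p$3) - (v$1 - p$1) * (q$3 - p$3), - (q$3 - p$3), q$1 - p$1:]"
  have "?P \<noteq> 0" using assms by (auto simp: same_proj_def)
  then have "finite {s. poly ?P s = 0}" by (rule poly_roots_finite)
  moreover have "poly ?P s = planar_det p q (parabola v s)" for s
    by (simp add: planar_det_def algebra_simps power2_eq_square)
  ultimately show ?thesis by simp
qed

text \<open>The segments \<open>c d\<close> and \<open>e f\<close> span different lines in the
  projection, which meet in at most one point. A concurrency forces the moving vertex onto the line
  through that point and \<open>w\<close>, and the parabola meets this line finitely often.\<close>

lemma finite_parabola_concurrent: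
  assumes W: "generic W" "w \<in> W" "c \<in> W" "d \<in> W" "e \<in> W" "f \<in> W" "distinct [w, c, d, e, f]"
  shows "finite {s. concurrent (parabola v s) w c d e f}"
proof (cases "\<exists>s. concurrent (parabola v s) w c d e f")
  case True
  then obtain y z where y: "y \<in> closed_segment c d" "z \<in> closed_segment e f" "same_proj y z"
    unfolding concurrent_def by blast
  have ndet: "planar_det c d w \<noteq> 0" "planar_det c d e \<noteq> 0" and nef: "\<not> same_proj e f"
    using W unfolding generic_def by force+
  have "\<not> same_proj w y"
    using ndet(1) planar_det_segment[OF y(1)] planar_det_same_proj[of w y c d] by metis
  moreover have "planar_det w y (parabola v s) = 0" if "concurrent (parabola v s) w c d e f" for s
  proof -
    obtain x y' z' where *: "x \<in> closed_segment (parabola v s) w" "y' \<in> closed_segment c d" "z' \<in> closed_segment e f"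
        "same_proj x y'" "same_proj y' z'" using \<open>concurrent _ _ _ _ _ _\<close> unfolding concurrent_def by blast
    have "same_proj y y'"
    proof (rule ccontr)
      assume "\<not> same_proj y y'"
      moreover have "planar_det e f y = 0" "planar_det e f y' = 0"
        using planar_det_segment[OF y(2)] planar_det_segment[OF *(3)] y(3) *(5) planar_det_same_proj by metis+
      ultimately have "planar_det c d e = 0"
        using collinear_through_two_points[OF planar_det_segment[OF y(1)] planar_det_segment[OF *(2)]] nef by blast
      then show False using ndet by simp
    qed
    then have "same_proj x y" using *(4) same_proj_sym same_proj_trans by blast
    moreover have "planar_det w (parabola v s) x = 0"
      using planar_det_segment[OF *(1)[unfolded closed_segment_commute[of _ w]]] by simp
    ultimately have "planar_det w (parabola v s) y = 0" using planar_det_same_proj by metis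
    then show ?thesis using planar_det_swap[of w y "parabola v s"] by simp
  qed
  then have "{s. concurrent (parabola v s) w c d e f} \<subseteq> {s. planar_det w y (parabola v s) = 0}" by blast
  ultimately show ?thesis
    using finite_parabola_line[of w y v] finite_subset by blast
qed auto

lemma generic_insert_parabola:
  assumes W: "finite W" "generic W"
  shows "finite {s. \<exists>w\<in>W. same_proj w (parabola v s)}" (is ?A)
    and "finite {s. \<not> generic (insert (parabola v s) W)}" (is ?B)
proof -
  have "finite {s. same_proj w (parabola v s)}" for w
    by (rule finite_subset[of _ "{w$1 - v$1}"]) (auto simp: same_proj_def)
  then have "finite (\<Union>w\<in>W. {s. same_proj w (parabola v s)})" using W(1) by blast
  moreover have "{s. \<exists>w\<in>W. same_proj w (parabola v s)} = (\<Union>w\<in>W. {s. same_proj w (parabola v s)})" by auto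
  ultimately show A: ?A by simp
  \<comment> \<open>The forbidden parameters: \<open>B2\<close> for collinear triples and
    \<open>B3\<close> for concurrent triples that contain the new point. By symmetry of the
    conditions the new point can be assumed to stand last in the former and first in the
    latter.\<close>
  define B2 where "B2 = (\<Union>(p, q)\<in>{(p, q). p \<in> W \<and> q \<in> W \<and> p \<noteq> q}. {s. planar_det p q (parabola v s) = 0})"
  define T where "T = {(w, c, d, e, f). w \<in> W \<and> c \<in> W \<and> d \<in> W \<and> e \<in> W \<and> f \<in> W \<and> distinct [w, c, d, e, f]}"
  define B3 where "B3 = (\<Union>(w, c, d, e, f)\<in>T. {s. concurrent (parabola v s) w c d e f})"
  have "finite {(p, q). p \<in> W \<and> q \<in> W \<and> p \<noteq> q}"
    by (rule finite_subset[of _ "W \<times> W"]) (use W(1) in auto)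
  moreover have "finite {s. planar_det p q (parabola v s) = 0}" if "p \<in> W" "q \<in> W" "p \<noteq> q" for p q
    using W(2) that unfolding generic_def by (intro finite_parabola_line) blast
  ultimately have B2: "finite B2" unfolding B2_def
    by (intro finite_UN_I) (simp_all add: case_prod_beta)
  have "finite T"
    by (rule finite_subset[of _ "W \<times> W \<times> W \<times> W \<times> W"]) (use W(1) in \<open>auto simp: T_def\<close>)
  moreover have "finite {s. concurrent (parabola v s) w c d e f}" if "(w, c, d, e, f) \<in> T" for w c d e f
    using that W(2) unfolding T_def by (intro finite_parabola_concurrent) auto
  ultimately have B3: "finite B3" unfolding B3_def
    by (intro finite_UN_I) (auto simp only: split: prod.splits)
  have gen: "generic (insert (parabola v s) W)"
    if "\<not> (\<exists>w\<in>W. same_proj w (parabola v s))" and b2: "s \<notin> B2" and b3: "s \<notin> B3" for s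
  proof -
    let ?x = "parabola v s"
    have n1: "\<not> same_proj w ?x" "\<not> same_proj ?x w" if "w \<in> W" for w
      using \<open>\<not> (\<exists>w\<in>W. _ w)\<close> that same_proj_sym by blast+
    have n2: "planar_det p q ?x \<noteq> 0" if "p \<in> W" "q \<in> W" "p \<noteq> q" for p q
      using b2 that unfolding B2_def by blast
    have n3: "\<not> concurrent ?x w c d e f" if "w \<in> W" "c \<in> W" "d \<in> W" "e \<in> W" "f \<in> W" "distinct [w, c, d, e, f]" for w c d e f
      using b3 that unfolding B3_def T_def by blast
    have "\<not> same_proj a b" if "a \<in> insert ?x W" "b \<in> insert ?x W" "a \<noteq> b" for a b
      using that n1 W(2) unfolding generic_def by blast
    moreover have "planar_det a b c \<noteq> 0" if abc: "a \<in> insert ?x W" "b \<in> insert ?x W" "c \<in> insert ?x W" "distinct [a, b, c]" for a b c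
    proof -
      consider "a \<in> W" "b \<in> W" "c \<in> W" | "c = ?x" "a \<in> W" "b \<in> W" | "b = ?x" "a \<in> W" "c \<in> W" | "a = ?x" "b \<in> W" "c \<in> W"
        using abc by auto
      then show ?thesis
      proof cases
        case 1
        then show ?thesis using W(2) abc(4) unfolding generic_def by blast
      next
        case 2
        then show ?thesis using n2 abc(4) by auto
      next
        case 3
        then show ?thesis using n2[of a c] abc(4) planar_det_swap[of a b c] by auto
      next
        case 4
        then show ?thesis using n2[of b c] abc(4) planar_det_rotate[of b c a] by auto
      qed
    qed
    moreover have "\<not> concurrent a b c d e f"
      if W': "a \<in> insert ?x W" "b \<in> insert ?x W" "c \<in> insert ?x W" "d \<in> insert ?x W" "e \<in> insert ?x W" "f \<in> insert ?x W"
        and dist: "distinct [a, b, c, d, e, f]" for a b c d e f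
    proof
      assume con: "concurrent a b c d e f"
      consider "{a, b, c, d, e, f} \<subseteq> W" | "a = ?x" "{b, c, d, e, f} \<subseteq> W" | "b = ?x" "{a, c, d, e, f} \<subseteq> W"
        | "c = ?x" "{a, b, d, e, f} \<subseteq> W" | "d = ?x" "{a, b, c, e, f} \<subseteq> W"
        | "e = ?x" "{a, b, c, d, f} \<subseteq> W" | "f = ?x" "{a, b, c, d, e} \<subseteq> W"
        using W' dist by auto
      then show False
      proof cases
        case 1
        then show ?thesis using W(2) con dist unfolding generic_def by auto
      next
        case 2
        then show ?thesis using n3[of b c d e f] con dist by auto
      next
        case 3
        then show ?thesis using n3[of a c d e f] concurrent_perms(1)[OF con] dist by auto
      next
        case 4
        then show ?thesis using n3[of d a b e f] concurrent_perms(2)[OF con] dist by auto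
      next
        case 5
        then show ?thesis using n3[of c a b e f] concurrent_perms(1)[OF concurrent_perms(2)[OF con]] dist by auto
      next
        case 6
        then show ?thesis using n3[of f a b c d] concurrent_perms(3)[OF con] dist by auto
      next
        case 7
        then show ?thesis using n3[of e a b c d] concurrent_perms(1)[OF concurrent_perms(3)[OF con]] dist by auto
      qed
    qed
    ultimately show ?thesis unfolding generic_def by (intro conjI ballI impI)
  qed
  have "{s. \<not> generic (insert (parabola v s) W)} \<subseteq> {s. \<exists>w\<in>W. same_proj w (parabola v s)} \<union> (B2 \<union> B3)"
  proof (intro subsetI, rule ccontr)
    fix s assume s: "s \<in> {s. \<not> generic (insert (parabola v s) W)}"
      "s \<notin> {s. \<exists>w\<in>W. same_proj w (parabola v s)} \<union> (B2 \<union> B3)"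
    have "generic (insert (parabola v s) W)" using s(2) by (intro gen) auto
    then show False using s(1) by simp
  qed
  then show ?B by (rule finite_subset) (intro finite_UnI A B2 B3)
qed

lemma generic_perturbation:
  fixes V :: "(real^3) set"
  assumes "finite V" "\<epsilon> > 0"
  shows "\<exists>q. (\<forall>v\<in>V. norm (q v - v) \<le> \<epsilon>) \<and> inj_on q V \<and> generic (q ` V)"
  using assms(1)
proof (induction V rule: finite_induct)
  case empty
  show ?case by (auto simp: generic_def)
next
  case (insert v V)
  then obtain q where q: "\<And>u. u \<in> V \<Longrightarrow> norm (q u - u) \<le> \<epsilon>" "inj_on q V" "generic (q ` V)" by blast
  let ?bad = "{s. \<exists>w\<in>q ` V. same_proj w (parabola v s)} \<union> {s. \<not> generic (insert (parabola v s) (q ` V))}"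
  have "finite ?bad" using generic_insert_parabola[OF _ q(3), of v] insert.hyps by simp
  \<comment> \<open>For \<open>s < 1\<close> the square of \<open>s\<close> is at most
    \<open>s\<close>, so the vertex moves by at most \<open>2 * s\<close>.\<close>
  moreover have "infinite {0<..<min 1 (\<epsilon> / 2)}" using assms(2) by (intro infinite_Ioo) auto
  ultimately obtain s where s: "s \<in> {0<..<min 1 (\<epsilon> / 2)}" "s \<notin> ?bad"
    by (meson finite_subset subsetI)
  define q' where "q' = q(v := parabola v s)"
  have q': "q' v = parabola v s" "\<And>u. u \<in> V \<Longrightarrow> q' u = q u" using insert.hyps by (auto simp: q'_def)
  have im: "q' ` V = q ` V" using q'(2) by force
  have "norm (parabola v s - v) \<le> \<bar>s\<bar> + \<bar>s\<^sup>2\<bar>"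
    using norm_le_l1_cart[of "parabola v s - v"] by (simp add: sum_3)
  also have "\<dots> \<le> s + s" using s(1) by (simp add: power2_eq_square mult_left_le)
  also have "\<dots> \<le> \<epsilon>" using s(1) by simp
  finally have "norm (q' v - v) \<le> \<epsilon>" using q' by simp
  moreover have "generic (q' ` insert v V)" using s(2) im q'(1) by simp
  moreover have "inj_on q' (insert v V)"
  proof -
    have "inj_on q' V" using q(2) q'(2) by (simp add: inj_on_def)
    moreover have "q' v \<notin> q' ` V" using s(2) im q'(1) same_proj_refl[of "parabola v s"] by (metis (mono_tags, lifting) UnI1 mem_Collect_eq)
    ultimately show ?thesis using insert.hyps by (simp add: inj_on_insert)
  qed
  ultimately show ?case using q(1) q'(2) by (intro exI[of _ q']) auto
qed

text \<open>Coordinate 3 is the height and coordinate 2 the depth, a larger value being nearer to the viewer.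
  Where two arcs cross in the projection, the farther one must end.\<close>

definition arc_diagram :: "(real^3) set \<Rightarrow> ((real^3) \<times> (real^3)) set \<Rightarrow> bool" where
  "arc_diagram X A \<longleftrightarrow> finite A \<and> A \<noteq> {} \<and> inj_on (\<lambda>x. x$3) X \<and>
     (\<forall>e\<in>A. fst e \<in> X \<and> snd e \<in> X \<and> fst e $ 3 < snd e $ 3) \<and>
     (\<forall>e\<in>A. \<forall>f\<in>A. \<forall>p\<in>closed_segment (fst e) (snd e). \<forall>q\<in>closed_segment (fst f) (snd f).
        same_proj p q \<longrightarrow> p \<noteq> q \<longrightarrow>
          p \<in> {fst e, snd e} \<and> p$2 < q$2 \<or> q \<in> {fst f, snd f} \<and> q$2 < p$2) \<and>
     (\<forall>e\<in>A. \<forall>f\<in>A. \<forall>p. e \<noteq> f \<longrightarrow> p \<in> closed_segment (fst e) (snd e) \<longrightarrow> p \<in> closed_segment (fst f) (snd f) \<longrightarrow>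
        p \<in> {fst e, snd e} \<and> p \<in> {fst f, snd f})"

definition undercrossings :: "((real^3) \<times> (real^3)) set \<Rightarrow> (real^3) set" where
  "undercrossings E = {y. \<exists>e\<in>E. \<exists>f\<in>E. \<exists>x\<in>closed_segment (fst e) (snd e). y \<in> closed_segment (fst f) (snd f) \<and>
      same_proj x y \<and> y$2 < x$2}"

text \<open>A shear parallel to the plane of projection: it preserves depth and the relation
  \<open>same_proj\<close>, and all but finitely many \<open>s\<close> separate the heights of
  finitely many points with different projections.\<close>

definition shear :: "real \<Rightarrow> real^3 \<Rightarrow> real^3" where
  "shear s x = x + (s * x$1) *\<^sub>R axis 3 1"

lemma shear_nth [simp]: "shear s x $ 1 = x$1" "shear s x $ 2 = x$2" "shear s x $ 3 = x$3 + s * x$1"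
  by (simp_all add: shear_def axis_def)

lemma linear_shear: "linear (shear s)"
  by (auto simp: linear_iff vec_eq_iff forall_3 algebra_simps)

lemma inj_shear: "inj (shear s)"
  by (auto simp: inj_on_def vec_eq_iff forall_3)

lemma same_proj_shear [simp]: "same_proj (shear s x) (shear s y) \<longleftrightarrow> same_proj x y"
  by (auto simp: same_proj_def)

text \<open>Clamping coordinate 1 to a range that contains its values on \<open>G\<close> makes the
  displacement bounded, and its Lipschitz constant is \<open>s\<close>.\<close>

lemma pl_equiv_shear:
  assumes "bounded G" "0 \<le> s" "s < 1" shows "pl_equiv G (shear s ` G)"
proof -
  obtain R where R: "R > 0" "\<And>x. x \<in> G \<Longrightarrow> norm x \<le> R"
    using assms(1) by (auto simp: bounded_pos)
  define g where "g = (\<lambda>x::real^3. (s * max (- R) (min R (x$1))) *\<^sub>R (axis 3 1 :: real^3))"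
  have "linear (\<lambda>x::real^3. x$1)" by (auto simp: linear_iff)
  then have "pw_affine g" unfolding g_def
    by (intro pw_affine_scaleR_const pw_affine_cmult pw_affine_max pw_affine_min pw_affine_const pw_affine_linear)
  moreover have "norm (g x - g y) \<le> s * norm (x - y)" for x y
  proof -
    have "g x - g y = (s * (max (- R) (min R (x$1)) - max (- R) (min R (y$1)))) *\<^sub>R axis 3 1"
      by (simp add: g_def algebra_simps)
    then have "norm (g x - g y) = s * \<bar>max (- R) (min R (x$1)) - max (- R) (min R (y$1))\<bar>"
      using assms(2) by (simp add: norm_axis_1 abs_mult)
    also have "\<dots> \<le> s * \<bar>(x - y)$1\<bar>" using assms(2) by (intro mult_left_mono) auto
    also have "\<dots> \<le> s * norm (x - y)" using assms(2) by (intro mult_left_mono component_le_norm_cart)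
    finally show ?thesis .
  qed
  moreover have "norm (g x) \<le> s * R" for x
    using assms(2) R(1) by (auto simp: g_def norm_axis_1 abs_mult intro!: mult_left_mono)
  ultimately have "pl_shift (\<lambda>x. x + g x)" using assms(3) by (intro pl_shift_add_contraction)
  moreover have "x + g x = shear s x" if "x \<in> G" for x
    using component_le_norm_cart[of x 1] R(2)[OF that] by (auto simp: g_def shear_def abs_le_iff)
  then have "(\<lambda>x. x + g x) ` G = shear s ` G" by simp
  ultimately show ?thesis unfolding pl_equiv_def by blast
qed

lemma arc_diagram_exists:
  fixes E :: "((real^3) \<times> (real^3)) set"
  assumes E: "finite E" "E \<noteq> {}" and neq: "\<And>e. e \<in> E \<Longrightarrow> fst e \<noteq> snd e"
    and emb: "straight_embedding (\<lambda>x. x) E" and gen: "generic (fst ` E \<union> snd ` E)"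
  shows "\<exists>X A. arc_diagram X A \<and> pl_equiv (support E) (support A)"
proof -
  define W where "W = fst ` E \<union> snd ` E"
  let ?seg = "\<lambda>e. closed_segment (fst e) (snd e) :: (real^3) set"
  have W: "fst e \<in> W" "snd e \<in> W" if "e \<in> E" for e using that by (auto simp: W_def)
  have g1: "\<not> same_proj a b" if "a \<in> W" "b \<in> W" "a \<noteq> b" for a b
    using gen that unfolding generic_def W_def by blast
  have g2: "planar_det a b c \<noteq> 0" if "a \<in> W" "b \<in> W" "c \<in> W" "distinct [a, b, c]" for a b c
    using gen that unfolding generic_def W_def by blast
  have g3: "\<not> concurrent a b c d e f"
    if "a \<in> W" "b \<in> W" "c \<in> W" "d \<in> W" "e \<in> W" "f \<in> W" "distinct [a, b, c, d, e, f]" for a b c d e f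
    using gen that unfolding generic_def W_def by blast
  have edge_inj: "x = y" if e: "e \<in> E" and x: "x \<in> ?seg e" and y: "y \<in> ?seg e" and xy: "same_proj x y" for e x y
  proof -
    obtain s where s: "x = fst e + s *\<^sub>R (snd e - fst e)" using x by (rule in_segmentE)
    obtain t where t: "y = fst e + t *\<^sub>R (snd e - fst e)" using y by (rule in_segmentE)
    have "\<not> same_proj (fst e) (snd e)" using g1 W e neq by blast
    moreover have "(s - t) * (snd e $ 1 - fst e $ 1) = 0" "(s - t) * (snd e $ 3 - fst e $ 3) = 0"
      using xy by (simp_all add: s t same_proj_def algebra_simps)
    ultimately have "s = t" by (auto simp: same_proj_def)
    then show ?thesis using s t by simp
  qed
  have vertex_on_edge: "w = x" if w: "w \<in> W" and e: "e \<in> E" and x: "x \<in> ?seg e" and wx: "same_proj w x" for w e x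
  proof -
    have "planar_det (fst e) (snd e) w = 0" using planar_det_segment[OF x] planar_det_same_proj[OF wx] by simp
    then have "w = fst e \<or> w = snd e" using g2[of "fst e" "snd e" w] W[OF e] w neq[OF e] by auto
    then have "w \<in> ?seg e" by auto
    then show ?thesis using edge_inj[OF e _ x wx] by simp
  qed
  have crossing: "distinct [fst e, snd e, fst f, snd f]"
    if e: "e \<in> E" and f: "f \<in> E" and x: "x \<in> ?seg e" and y: "y \<in> ?seg f" and xy: "same_proj x y" "x \<noteq> y" for e f x y
  proof -
    \<comment> \<open>Suppose that the edges have a common end \<open>p\<close>. If their other ends
      agree too, they are one segment, which projects injectively. Otherwise their projections lie
      on different lines through \<open>p\<close>, so \<open>x\<close> and \<open>y\<close> both lie
      over \<open>p\<close> and are equal to it.\<close>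
    have no: "False" if p: "p \<in> {fst e, snd e}" "p \<in> {fst f, snd f}" for p
    proof -
      obtain b where b: "?seg e = closed_segment p b" "b \<in> W" "b \<noteq> p"
        using p(1) neq[OF e] W[OF e] closed_segment_commute by (metis empty_iff insert_iff)
      obtain d where d: "?seg f = closed_segment p d" "d \<in> W" "d \<noteq> p"
        using p(2) neq[OF f] W[OF f] closed_segment_commute by (metis empty_iff insert_iff)
      have pW: "p \<in> W" using p W[OF e] by auto
      show False
      proof (cases "b = d")
        case True
        then show ?thesis using edge_inj[OF e x _ xy(1)] y b d xy(2) by simp
      next
        case False
        have "same_proj x p"
        proof (rule ccontr)
          assume n: "\<not> same_proj x p"
          have "planar_det p b x = 0" using x b planar_det_segment by blast
          moreover have "planar_det d p x = 0"
            using y d planar_det_segment[of y d p] planar_det_same_proj[OF xy(1)] by (simp add: closed_segment_commute)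
          ultimately have "planar_det p b d = 0"
            using collinear_through_two_points[of p b x p d p] n g1[OF d(2) pW d(3)] by simp
          then show False using g2[of p b d] pW b d False by auto
        qed
        moreover have "p \<in> ?seg e" "p \<in> ?seg f" unfolding b(1) d(1) by simp_all
        ultimately have "x = p" "y = p"
          using edge_inj[OF e x] edge_inj[OF f y] xy(1) same_proj_sym same_proj_trans by blast+
        then show False using xy(2) by simp
      qed
    qed
    show ?thesis using no neq[OF e] neq[OF f] by auto
  qed
  have no_triple: False
    if "e \<in> E" "f \<in> E" "g \<in> E" "x \<in> ?seg e" "y \<in> ?seg f" "z \<in> ?seg g" "same_proj x y" "same_proj y z"
      "x \<noteq> y" "y \<noteq> z" "x \<noteq> z" for e f g x y z
  proof -
    have "same_proj x z" using that same_proj_trans by blast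
    then have "distinct [fst e, snd e, fst f, snd f]" "distinct [fst f, snd f, fst g, snd g]"
        "distinct [fst e, snd e, fst g, snd g]"
      using crossing[OF that(1,2,4,5,7,9)] crossing[OF that(2,3,5,6,8,10)] crossing[OF that(1,3,4,6) _ that(11)]
      by simp_all
    then have "distinct [fst e, snd e, fst f, snd f, fst g, snd g]" by simp
    moreover have "concurrent (fst e) (snd e) (fst f) (snd f) (fst g) (snd g)"
      unfolding concurrent_def using that by blast
    ultimately show False
      using g3[OF W(1)[OF that(1)] W(2)[OF that(1)] W(1)[OF that(2)] W(2)[OF that(2)] W(1)[OF that(3)] W(2)[OF that(3)]]
      by simp
  qed
  define U where "U = undercrossings E"
  have finU: "finite U"
  proof -
    let ?U = "\<lambda>e f. {y \<in> ?seg f. \<exists>x\<in>?seg e. same_proj x y \<and> x \<noteq> y}"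
    have "finite (?U e f)" if e: "e \<in> E" and f: "f \<in> E" for e f
    proof -
      \<comment> \<open>Two crossings of the same pair of edges would place both edges on one line
        of the projection, against general position.\<close>
      have eq: "y = y'" if y: "y \<in> ?U e f" and y': "y' \<in> ?U e f" for y y'
      proof (rule ccontr)
        assume "y \<noteq> y'"
        obtain x x' where x: "x \<in> ?seg e" "same_proj x y" "x \<noteq> y" and x': "x' \<in> ?seg e" "same_proj x' y'"
          using y y' by blast
        have d: "distinct [fst e, snd e, fst f, snd f]" using crossing[OF e f] x y by blast
        have "\<not> same_proj y y'" using edge_inj[OF f] y y' \<open>y \<noteq> y'\<close> by blast
        moreover have "planar_det (fst e) (snd e) y = 0" "planar_det (fst e) (snd e) y' = 0"
          using planar_det_segment x x' planar_det_same_proj by metis+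
        moreover have "planar_det (fst f) (snd f) y = 0" "planar_det (fst f) (snd f) y' = 0"
          using planar_det_segment y y' by blast+
        moreover have "\<not> same_proj (fst f) (snd f)" using g1 W f neq by blast
        ultimately have "planar_det (fst e) (snd e) (fst f) = 0"
          using collinear_through_two_points[of "fst e" "snd e" y y' "fst f" "snd f"] by simp
        then show False using g2[OF W(1)[OF e] W(2)[OF e] W(1)[OF f]] d by simp
      qed
      show ?thesis
      proof (cases "?U e f = {}")
        case False
        then obtain y where y: "y \<in> ?U e f" by auto
        have "?U e f \<subseteq> {y}" using eq[OF _ y] by auto
        then show ?thesis using finite_subset by blast
      qed (simp only: finite.emptyI)
    qed
    then have "finite (\<Union>e\<in>E. \<Union>f\<in>E. ?U e f)" using E(1) by (intro finite_UN_I)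
    moreover have "U \<subseteq> (\<Union>e\<in>E. \<Union>f\<in>E. ?U e f)" unfolding U_def undercrossings_def by fastforce
    ultimately show ?thesis by (rule finite_subset[rotated])
  qed
  define X where "X = W \<union> U"
  have finX: "finite X" unfolding X_def W_def using E(1) finU by simp
  have X_proj: "\<not> same_proj x y" if x: "x \<in> X" and y: "y \<in> X" and xy: "x \<noteq> y" for x y
  proof
    assume sp: "same_proj x y"
    have U: "\<exists>f\<in>E. u \<in> ?seg f" if "u \<in> U" for u using that unfolding U_def undercrossings_def by blast
    \<comment> \<open>The nearer one of two undercrossings over one another has a further strand in
      front of it. This gives three points over one another, which general position
      excludes.\<close>
    have wlog: False if uv: "u \<in> U" "v \<in> U" "same_proj u v" "u \<noteq> v" "u$2 \<le> v$2" for u v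
    proof -
      obtain e f z where v: "e \<in> E" "f \<in> E" "z \<in> ?seg e" "v \<in> ?seg f" "same_proj z v" "v$2 < z$2"
        using uv(2) unfolding U_def undercrossings_def by blast
      obtain g where g: "g \<in> E" "u \<in> ?seg g" using U uv(1) by blast
      have "z \<noteq> v" "u \<noteq> z" using v(6) uv(5) by auto
      then show False
        using no_triple[OF g(1) v(2,1) g(2) v(4,3) uv(3) same_proj_sym[OF v(5)] uv(4)] by blast
    qed
    consider "x \<in> W" "y \<in> W" | "x \<in> W" "y \<in> U" | "x \<in> U" "y \<in> W" | "x \<in> U" "y \<in> U"
      using x y X_def by blast
    then show False
    proof cases
      case 1
      then show ?thesis using g1 xy sp by blast
    next
      case 2
      then show ?thesis using U vertex_on_edge sp xy by metis
    next
      case 3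
      then show ?thesis using U vertex_on_edge same_proj_sym[OF sp] xy by metis
    next
      case 4
      then show ?thesis using wlog[of x y] wlog[of y x] sp same_proj_sym[OF sp] xy by fastforce
    qed
  qed
  obtain s where s: "0 < s" "s < 1" and s_inj: "inj_on (\<lambda>x. x$3 + s * x$1) X"
  proof -
    let ?bad = "\<Union>x\<in>X. \<Union>y\<in>X - {x}. {s. x$3 + s * x$1 = y$3 + s * y$1}"
    have "finite {s. x$3 + s * x$1 = y$3 + s * y$1}" if "x \<in> X" "y \<in> X - {x}" for x y
    proof (cases "x$1 = y$1")
      case True
      then have "{s. x$3 + s * x$1 = y$3 + s * y$1} = {}"
        using X_proj[of x y] that by (auto simp: same_proj_def)
      then show ?thesis by simp
    next
      case False
      then have "s = (y$3 - x$3) / (x$1 - y$1)" if "x$3 + s * x$1 = y$3 + s * y$1" for s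
        using that by (simp add: field_simps)
      then have "{s. x$3 + s * x$1 = y$3 + s * y$1} \<subseteq> {(y$3 - x$3) / (x$1 - y$1)}" by blast
      then show ?thesis using finite_subset by blast
    qed
    then have "finite ?bad" using finX by (intro finite_UN_I) auto
    moreover have "infinite {0<..<1::real}" by (intro infinite_Ioo) auto
    ultimately obtain s where "s \<in> {0<..<1}" "s \<notin> ?bad" by (meson finite_subset subsetI)
    then show thesis using that[of s] by (auto simp: inj_on_def)
  qed
  have ends: "a \<in> X \<and> b \<in> X \<and> a \<noteq> b" if "(a, b) \<in> E" for a b
    using W[OF that] neq[OF that] by (simp add: X_def)
  define C where "C = cut E X"
  \<comment> \<open>\<open>cut\<close> lists every piece in both directions; the upward one is
    kept.\<close>
  define A where "A = (\<lambda>e. (shear s (fst e), shear s (snd e))) ` {e \<in> C. shear s (fst e) $ 3 < shear s (snd e) $ 3}"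
  have C: "fst e \<in> X" "snd e \<in> X" "fst e \<noteq> snd e" "open_segment (fst e) (snd e) \<inter> X = {}"
      "\<exists>f\<in>E. ?seg e \<subseteq> ?seg f" if eC: "e \<in> C" for e
  proof -
    obtain a b c d where "e = (a, b)" "a \<in> X" "b \<in> X" "a \<noteq> b" "open_segment a b \<inter> X = {}"
        and f: "(c, d) \<in> E" "closed_segment a b \<subseteq> closed_segment c d"
      using eC unfolding C_def cut_def by blast
    then show "fst e \<in> X" "snd e \<in> X" "fst e \<noteq> snd e" "open_segment (fst e) (snd e) \<inter> X = {}"
        "\<exists>f\<in>E. ?seg e \<subseteq> ?seg f" using bexI[OF _ f(1)] by simp_all
  qed
  have seg_shear: "closed_segment (shear s a) (shear s b) = shear s ` closed_segment a b" for a b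
    by (simp add: closed_segment_linear_image linear_shear)
  have swapC: "(b, a) \<in> C" if "(a, b) \<in> C" for a b
    using that unfolding C_def cut_def by (auto simp: open_segment_commute closed_segment_commute)
  have realA: "support A = shear s ` support C"
  proof
    show "support A \<subseteq> shear s ` support C"
      by (auto simp: realization_def A_def seg_shear)
    show "shear s ` support C \<subseteq> support A"
    proof
      fix y assume "y \<in> shear s ` support C"
      then obtain x a b where ab: "(a, b) \<in> C" "x \<in> closed_segment a b" "y = shear s x"
        by (auto simp: realization_def)
      have inA: "(shear s c, shear s d) \<in> A" if "(c, d) \<in> C" "shear s c $ 3 < shear s d $ 3" for c d
        unfolding A_def using that by (intro image_eqI[of _ _ "(c, d)"]) simp_all
      have y: "y \<in> closed_segment (shear s a) (shear s b)" unfolding seg_shear using ab by simp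
      have "shear s a $ 3 \<noteq> shear s b $ 3" using s_inj C(1-3)[OF ab(1)] by (auto simp: inj_on_def)
      then consider "shear s a $ 3 < shear s b $ 3" | "shear s b $ 3 < shear s a $ 3" by linarith
      then show "y \<in> support A"
      proof cases
        case 1
        then show ?thesis
          unfolding realization_def using inA[OF ab(1)] y by (intro UN_I[of "(shear s a, shear s b)"]) simp_all
      next
        case 2
        then show ?thesis
          unfolding realization_def using inA[OF swapC[OF ab(1)]] y
          by (intro UN_I[of "(shear s b, shear s a)"]) (simp_all add: closed_segment_commute)
      qed
    qed
  qed
  have realC: "support C = support E"
    unfolding C_def by (rule realization_cut[OF finX ends])
  have "arc_diagram (shear s ` X) A"
    unfolding arc_diagram_def
  proof (intro conjI ballI allI impI)
    show "finite A" unfolding A_def C_def using finite_cut[OF finX] by simp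
    have "support E \<noteq> {}" using E(2) by (force simp: realization_def)
    then show "A \<noteq> {}" using realA realC by (auto simp: realization_def)
    show "inj_on (\<lambda>x. x $ 3) (shear s ` X)"
      using s_inj by (auto simp: inj_on_def)
  next
    fix e assume "e \<in> A"
    then show "fst e \<in> shear s ` X" "snd e \<in> shear s ` X" "fst e $ 3 < snd e $ 3"
      unfolding A_def using C by auto
  next
    fix e f p q
    assume "e \<in> A" "f \<in> A" and p: "p \<in> ?seg e" and q: "q \<in> ?seg f" and pq: "same_proj p q" "p \<noteq> q"
    then obtain e' f' where e': "e' \<in> C" "e = (shear s (fst e'), shear s (snd e'))"
        and f': "f' \<in> C" "f = (shear s (fst f'), shear s (snd f'))" unfolding A_def by blast
    obtain p' where p': "p' \<in> ?seg e'" "p = shear s p'" using p e'(2) seg_shear by auto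
    obtain q' where q': "q' \<in> ?seg f'" "q = shear s q'" using q f'(2) seg_shear by auto
    have sp: "same_proj p' q'" "p' \<noteq> q'" using pq p' q' by auto
    obtain e0 f0 where e0: "e0 \<in> E" "?seg e' \<subseteq> ?seg e0" and f0: "f0 \<in> E" "?seg f' \<subseteq> ?seg f0"
      using C(5) e'(1) f'(1) by meson
    have endpt: "r \<in> {fst h, snd h}" if "r \<in> X" "r \<in> ?seg h" "h \<in> C" for r h
      using C(4)[OF that(3)] that by (auto simp: open_segment_def)
    have "p'$2 \<noteq> q'$2" using sp same_proj_eq by blast
    then consider "p'$2 < q'$2" | "q'$2 < p'$2" by linarith
    then show "p \<in> {fst e, snd e} \<and> p $ 2 < q $ 2 \<or> q \<in> {fst f, snd f} \<and> q $ 2 < p $ 2"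
    proof cases
      case 1
      then have "p' \<in> U" unfolding U_def undercrossings_def
        using e0 f0 p' q' same_proj_sym[OF sp(1)] by blast
      then have "p' \<in> {fst e', snd e'}" using endpt p' e' X_def by blast
      then show ?thesis using 1 p' q' e' by auto
    next
      case 2
      then have "q' \<in> U" unfolding U_def undercrossings_def
        using e0 f0 p' q' sp(1) by blast
      then have "q' \<in> {fst f', snd f'}" using endpt q' f' X_def by blast
      then show ?thesis using 2 p' q' f' by auto
    qed
  next
    fix e f p
    assume "e \<in> A" "f \<in> A" and ef: "e \<noteq> f" and p: "p \<in> ?seg e" "p \<in> ?seg f"
    then obtain e' f' where e': "e' \<in> C" "e = (shear s (fst e'), shear s (snd e'))" "fst e $ 3 < snd e $ 3"
        and f': "f' \<in> C" "f = (shear s (fst f'), shear s (snd f'))" "fst f $ 3 < snd f $ 3" unfolding A_def by auto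
    obtain p' where p': "p' \<in> ?seg e'" "p = shear s p'" using p e'(2) seg_shear by auto
    obtain q' where "q' \<in> ?seg f'" "p = shear s q'" using p(2) f'(2) seg_shear by auto
    then have q': "p' \<in> ?seg f'" using p'(2) injD[OF inj_shear] by metis
    have "p' \<in> X \<or> (\<exists>w. w \<noteq> p' \<and> w \<in> closed_segment a b \<and> w \<in> closed_segment c d)"
      if ab: "(a, b) \<in> E" and cd: "(c, d) \<in> E" and pp: "p' \<in> closed_segment a b" "p' \<in> closed_segment c d" for a b c d
    proof -
      obtain i where i: "i \<in> {0..1}" "p' = edge_pt (\<lambda>x. x) (a, b) i"
        using pp(1) unfolding closed_segment_def edge_pt_def by auto
      obtain j where j: "j \<in> {0..1}" "p' = edge_pt (\<lambda>x. x) (c, d) j"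
        using pp(2) unfolding closed_segment_def edge_pt_def by auto
      have eq: "barycentric (a, b) i = barycentric (c, d) j"
        using emb ab cd i j unfolding straight_embedding_def by metis
      have ne: "a \<noteq> b" "c \<noteq> d" using neq[OF ab] neq[OF cd] by simp_all
      show ?thesis
      proof (cases "i = 0 \<or> i = 1")
        case True
        then have "p' = a \<or> p' = b" using i by (auto simp: edge_pt_def)
        then show ?thesis using ends ab by blast
      next
        case False
        \<comment> \<open>A point inside an edge has nonzero coordinates at both of its ends. Hence
          the second edge has the same ends, and one of these is the second common point.\<close>
        then have "barycentric (a, b) i a \<noteq> 0" "barycentric (a, b) i b \<noteq> 0"
          using ne by (auto simp: barycentric_def)
        then have "a \<in> {c, d}" "b \<in> {c, d}" unfolding eq by (auto simp: barycentric_def split: if_splits)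
        then have "{a, b} = {c, d}" using ne by auto
        then have "closed_segment a b = closed_segment c d"
          by (metis doubleton_eq_iff closed_segment_commute)
        then show ?thesis using ends_in_segment ne by metis
      qed
    qed
    then have "p' \<in> {fst e', snd e'} \<and> p' \<in> {fst f', snd f'} \<or> {fst e', snd e'} = {fst f', snd f'}"
      using cut_pieces_meet[of "fst e'" "snd e'" E X "fst f'" "snd f'" p'] e'(1) f'(1) p'(1) q'
      unfolding C_def by simp
    \<comment> \<open>Both arcs point upward, so equal sets of ends would make them equal.\<close>
    moreover have "{fst e', snd e'} \<noteq> {fst f', snd f'}"
    proof
      assume "{fst e', snd e'} = {fst f', snd f'}"
      then consider "fst e' = fst f'" "snd e' = snd f'" | "fst e' = snd f'" "snd e' = fst f'"
        by (auto simp: doubleton_eq_iff)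
      then show False using e' f' ef by cases auto
    qed
    ultimately show "p \<in> {fst e, snd e}" "p \<in> {fst f, snd f}" using e' f' p' by auto
  qed
  moreover have "bounded (support E)"
    unfolding realization_def using E(1) by (intro bounded_UN) (auto simp: bounded_closed_segment)
  then have "pl_equiv (support E) (support A)"
    unfolding realA realC using s by (intro pl_equiv_shear) auto
  ultimately show ?thesis by blast
qed

lemma arc_diagram_of_segments:
  fixes S :: "((real^3) \<times> (real^3)) set"
  assumes S: "finite S" "S \<noteq> {}" "\<And>a b. (a, b) \<in> S \<Longrightarrow> a \<noteq> b"
  shows "\<exists>X A. arc_diagram X A \<and> pl_equiv (support S) (support A)"
proof -
  obtain E where E: "finite E" "E \<noteq> {}" "\<And>e. e \<in> E \<Longrightarrow> fst e \<noteq> snd e" "straight_embedding (\<lambda>x. x) E"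
      "support E = support S"
    using straight_structure_of_segments[OF S] by blast
  let ?V = "fst ` E \<union> snd ` E"
  obtain \<epsilon> where \<epsilon>: "\<epsilon> > 0" "\<And>q. (\<forall>e\<in>E. norm (q (fst e) - fst e) \<le> \<epsilon> \<and> norm (q (snd e) - snd e) \<le> \<epsilon>) \<Longrightarrow>
           pl_equiv (support E) (realization q E) \<and> straight_embedding q E"
    using pl_equiv_perturbation[OF E(1,2,4,3)] by blast
  obtain q where q: "\<forall>v\<in>?V. norm (q v - v) \<le> \<epsilon>" "inj_on q ?V" "generic (q ` ?V)"
    using generic_perturbation[of ?V \<epsilon>] E(1) \<epsilon>(1) by blast
  have eq: "pl_equiv (support E) (realization q E)" "straight_embedding q E"
    using \<epsilon>(2)[of q] q(1) by auto
  \<comment> \<open>The perturbation \<open>q\<close> moves an abstract graph. Since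
    \<open>q\<close> is injective on the vertices, they can be renamed to their new positions, so
    that the graph is again placed by the identity.\<close>
  define F where "F = map_prod q q ` E"
  have "support F = realization q E"
    by (simp add: realization_def F_def)
  moreover have "fst e \<noteq> snd e" if eF: "e \<in> F" for e
  proof -
    obtain e' where e': "e = map_prod q q e'" "e' \<in> E" using eF unfolding F_def by (rule imageE)
    then have "fst e' \<in> ?V" "snd e' \<in> ?V" by auto
    then have "q (fst e') \<noteq> q (snd e')" using E(3)[OF e'(2)] q(2) by (metis inj_on_contraD)
    then show ?thesis using e'(1) by simp
  qed
  moreover have "generic (fst ` F \<union> snd ` F)"
    using q(3) unfolding F_def image_Un image_image by simp
  moreover have "straight_embedding (\<lambda>x. x) F"
    unfolding straight_embedding_def
  proof (intro ballI impI)
    fix e f s t assume "e \<in> F" "f \<in> F" and s: "s \<in> {0..1::real}" and t: "t \<in> {0..1::real}"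
      and eq': "edge_pt (\<lambda>x. x) e s = edge_pt (\<lambda>x. x) f t"
    obtain e' where e': "e = map_prod q q e'" "e' \<in> E" using \<open>e \<in> F\<close> unfolding F_def by (rule imageE)
    obtain f' where f': "f = map_prod q q f'" "f' \<in> E" using \<open>f \<in> F\<close> unfolding F_def by (rule imageE)
    have "edge_pt q e' s = edge_pt q f' t" using eq' e' f' by (simp add: edge_pt_def)
    then have b: "barycentric e' s = barycentric f' t"
      using eq(2)[unfolded straight_embedding_def, rule_format, OF e'(2) f'(2) s t] by simp
    have inV: "fst e' \<in> ?V" "snd e' \<in> ?V" "fst f' \<in> ?V" "snd f' \<in> ?V" using e'(2) f'(2) by simp_all
    \<comment> \<open>The coordinates of a renamed edge are the old ones read at the preimage of the
      vertex; off the image of \<open>q\<close> they vanish.\<close>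
    have *: "barycentric (map_prod q q h) r v = (if v \<in> q ` ?V then barycentric h r (the_inv_into ?V q v) else 0)"
      if "fst h \<in> ?V" "snd h \<in> ?V" for h r v
    proof (cases "v \<in> q ` ?V")
      case True
      then obtain w where w: "w \<in> ?V" "v = q w" by blast
      have "the_inv_into ?V q v = w" using the_inv_into_f_f[OF q(2) w(1)] w(2) by simp
      moreover have "q w = q (fst h) \<longleftrightarrow> w = fst h" "q w = q (snd h) \<longleftrightarrow> w = snd h"
        using inj_on_eq_iff[OF q(2) w(1)] that by blast+
      ultimately show ?thesis using True w(2) by (simp add: barycentric_def)
    next
      case False
      then have "v \<noteq> q (fst h)" "v \<noteq> q (snd h)" using imageI[OF that(1), of q] imageI[OF that(2), of q] by metis+
      then show ?thesis using False by (simp add: barycentric_def)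
    qed
    show "barycentric e s = barycentric f t"
    proof
      fix v show "barycentric e s v = barycentric f t v"
        unfolding e'(1) f'(1) *[OF inV(1,2)] *[OF inV(3,4)] b ..
    qed
  qed
  moreover have "finite F" "F \<noteq> {}" using E(1,2) by (auto simp: F_def)
  ultimately obtain X A where "arc_diagram X A" "pl_equiv (realization q E) (support A)"
    using arc_diagram_exists[of F] by auto
  then show ?thesis using eq(1) E(5) pl_equiv_trans by metis
qed

section \<open>Opening the arcs into petals\<close>

text \<open>Provides the position of a newly inserted arc between its left and right neighbours;
  \<open>F\<close> consists of positions already taken.\<close>

lemma separating_real:
  fixes L R F :: "real set"
  assumes "finite L" "finite R" "finite F" "\<And>l r. l \<in> L \<Longrightarrow> r \<in> R \<Longrightarrow> l < r"
  shows "\<exists>x. x \<notin> F \<and> (\<forall>l\<in>L. l < x) \<and> (\<forall>r\<in>R. x < r)"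
proof -
  obtain lo hi where lh: "lo < hi" "\<forall>l\<in>L. l \<le> lo" "\<forall>r\<in>R. hi \<le> r"
  proof (cases "L = {}")
    case True
    show thesis
    proof (cases "R = {}")
      case True
      show thesis by (rule that[of 0 1]) (use True \<open>L = {}\<close> in auto)
    next
      case False
      show thesis by (rule that[of "Min R - 1" "Min R"]) (use \<open>L = {}\<close> assms(2) in auto)
    qed
  next
    case False
    show thesis
    proof (cases "R = {}")
      case True
      show thesis by (rule that[of "Max L" "Max L + 1"]) (use True assms(1) in auto)
    next
      case False
      have "Max L < Min R" using False assms \<open>L \<noteq> {}\<close> by simp
      show thesis by (rule that[of "Max L" "Min R"]) (use \<open>Max L < Min R\<close> assms(1,2) in auto)
    qed
  qed
  have "infinite {lo<..<hi}" using lh(1) by (rule infinite_Ioo)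
  then obtain x where "x \<in> {lo<..<hi}" "x \<notin> F" using assms(3) by (meson finite_subset subsetI)
  then show ?thesis using lh by (intro exI[of _ x]) auto
qed

text \<open>Arcs are inserted in the order of their lower ends. All arcs present at the level of the new
  lower end are comparable with one another just above it, so the new arc fits in a gap.\<close>

lemma left_to_right_order:
  fixes a b :: "'i \<Rightarrow> real" and u :: "'i \<Rightarrow> real \<Rightarrow> real"
  assumes "finite A" and ab: "\<And>e. e \<in> A \<Longrightarrow> a e < b e"
    and const: "\<And>e f h h'. e \<in> A \<Longrightarrow> f \<in> A \<Longrightarrow> e \<noteq> f \<Longrightarrow> a e < h \<Longrightarrow> a f < h \<Longrightarrow> h < b e \<Longrightarrow> h < b f \<Longrightarrow>
       a e < h' \<Longrightarrow> a f < h' \<Longrightarrow> h' < b e \<Longrightarrow> h' < b f \<Longrightarrow> u e h < u f h \<Longrightarrow> u e h' < u f h'"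
  shows "\<exists>n :: 'i \<Rightarrow> real. inj_on n A \<and> (\<forall>e\<in>A. \<forall>f\<in>A. \<forall>h. a e < h \<longrightarrow> a f < h \<longrightarrow> h < b e \<longrightarrow> h < b f \<longrightarrow>
           u e h < u f h \<longrightarrow> n e < n f)"
  using assms
proof (induction "card A" arbitrary: A)
  case 0
  then show ?case by simp
next
  case (Suc k A)
  note finA = Suc.prems(1) and ab = Suc.prems(2) and const = Suc.prems(3)
  have "A \<noteq> {}" using Suc.hyps(2) by auto
  then have "Max (a ` A) \<in> a ` A" using finA by (intro Max_in) auto
  then obtain e where e: "e \<in> A" "a e = Max (a ` A)" by auto
  have emax: "a f \<le> a e" if "f \<in> A" for f using that finA unfolding e(2) by (intro Max_ge) auto
  let ?A = "A - {e}"
  have "k = card ?A" using Suc.hyps(2) e(1) finA by simp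
  then have "\<exists>n :: 'i \<Rightarrow> real. inj_on n ?A \<and> (\<forall>e\<in>?A. \<forall>f\<in>?A. \<forall>h. a e < h \<longrightarrow> a f < h \<longrightarrow> h < b e \<longrightarrow> h < b f \<longrightarrow>
           u e h < u f h \<longrightarrow> n e < n f)"
  proof (rule Suc.hyps(1))
    show "finite ?A" using finA by simp
    show "a f < b f" if "f \<in> ?A" for f using ab that by simp
    show "u f h' < u g h'"
      if "f \<in> ?A" "g \<in> ?A" "f \<noteq> g" "a f < h" "a g < h" "h < b f" "h < b g" "a f < h'" "a g < h'" "h' < b f" "h' < b g" "u f h < u g h"
      for f g h h' using const[of f g h h'] that by simp
  qed
  then obtain n :: "'i \<Rightarrow> real" where n: "inj_on n ?A" "\<And>f g h. f \<in> ?A \<Longrightarrow> g \<in> ?A \<Longrightarrow> a f < h \<Longrightarrow> a g < h \<Longrightarrow> h < b f \<Longrightarrow> h < b g \<Longrightarrow>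
           u f h < u g h \<Longrightarrow> n f < n g"
    by blast
  \<comment> \<open>Every other arc starts no higher than \<open>e\<close>, so these are the arcs
    that have a height in common with the interior of \<open>e\<close>.\<close>
  define Act where "Act = {f \<in> ?A. a e < b f}"
  have finAct: "finite Act" using finA by (simp add: Act_def)
  \<comment> \<open>A level just above the lower end of \<open>e\<close> that all arcs in
    \<open>Act\<close> still cross. By \<open>const\<close>, a comparison with \<open>e\<close> at
    this level is valid at all common levels.\<close>
  define h1 where "h1 = (a e + Min (b ` insert e Act)) / 2"
  have "Min (b ` insert e Act) \<in> b ` insert e Act" using finAct by (intro Min_in) auto
  then have "a e < Min (b ` insert e Act)" using ab[OF e(1)] by (auto simp: Act_def)
  then have h1: "a e < h1" "h1 < Min (b ` insert e Act)" unfolding h1_def by (simp_all add: field_simps)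
  have h1b: "h1 < b f" if "f \<in> insert e Act" for f
  proof -
    have "Min (b ` insert e Act) \<le> b f" using that finAct by (intro Min_le) auto
    then show ?thesis using h1(2) by simp
  qed
  have h1a: "a f < h1" if "f \<in> A" for f using emax[OF that] h1(1) by simp
  let ?L = "{f \<in> Act. u f h1 < u e h1}" and ?R = "{f \<in> Act. u e h1 < u f h1}"
  have LR: "n f < n g" if "f \<in> ?L" "g \<in> ?R" for f g
  proof (rule n(2)[of f g h1])
    have "f \<in> Act" "g \<in> Act" "u f h1 < u e h1" "u e h1 < u g h1" using that by simp_all
    then show "f \<in> ?A" "g \<in> ?A" "u f h1 < u g h1" "a f < h1" "a g < h1" "h1 < b f" "h1 < b g"
      using h1a h1b by (simp_all add: Act_def)
  qed
  have "\<exists>x. x \<notin> n ` ?A \<and> (\<forall>l\<in>n ` ?L. l < x) \<and> (\<forall>r\<in>n ` ?R. x < r)"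
  proof (rule separating_real)
    show "finite (n ` ?L)" "finite (n ` ?R)" "finite (n ` ?A)" using finAct finA by simp_all
    show "l < r" if "l \<in> n ` ?L" "r \<in> n ` ?R" for l r using that LR by blast
  qed
  then obtain x where x0: "x \<notin> n ` ?A" "\<forall>l\<in>n ` ?L. l < x" "\<forall>r\<in>n ` ?R. x < r" by (elim exE conjE)
  have x: "n f < x" if "f \<in> Act" "u f h1 < u e h1" for f using x0(2) that by simp
  have x': "x < n f" if "f \<in> Act" "u e h1 < u f h1" for f using x0(3) that by simp
  define n' where "n' = n(e := x)"
  have n': "n' e = x" "\<And>f. f \<noteq> e \<Longrightarrow> n' f = n f" by (auto simp: n'_def)
  have "inj_on n' A"
  proof -
    have "inj_on n' ?A" using n(1) n'(2) by (simp add: inj_on_def)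
    moreover have "n' ` ?A = n ` ?A" using n'(2) by simp
    ultimately have "inj_on n' (insert e ?A)" using x0(1) n'(1) by (subst inj_on_insert) simp
    then show ?thesis using e(1) by (simp add: insert_absorb)
  qed
  moreover have "n' f < n' g"
    if fg: "f \<in> A" "g \<in> A" and h: "a f < h" "a g < h" "h < b f" "h < b g" and less: "u f h < u g h" for f g h
  proof -
    have "f \<noteq> g" using less by auto
    consider "f \<noteq> e" "g \<noteq> e" | "f = e" | "g = e" by blast
    then show ?thesis
    proof cases
      case 1
      then show ?thesis using n(2)[of f g h] fg h less n'(2) by simp
    next
      case 2
      then have g: "g \<in> Act" using fg h \<open>f \<noteq> g\<close> by (auto simp: Act_def)
      then have "u e h1 < u g h1"
        using const[of e g h h1] e(1) fg \<open>f \<noteq> g\<close> 2 h less h1a[of e] h1a[of g] h1b[of e] h1b[of g] by simp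
      then show ?thesis using x'[of g] g 2 n' \<open>f \<noteq> g\<close> by simp
    next
      case 3
      then have f: "f \<in> Act" using fg h \<open>f \<noteq> g\<close> by (auto simp: Act_def)
      then have "u f h1 < u e h1"
        using const[of f e h h1] e(1) fg \<open>f \<noteq> g\<close> 3 h less h1a[of e] h1a[of f] h1b[of e] h1b[of f] by simp
      then show ?thesis using x[of f] f 3 n' \<open>f \<noteq> g\<close> by simp
    qed
  qed
  ultimately show ?case by blast
qed

section \<open>Arcs subdivided into thirds and their parametrization\<close>

datatype ('x, 'i) node = Axis 'x | Low 'i | High 'i

text \<open>A cut point can belong to several arcs, so its vertex is labelled by the point; the two
  inner vertices are private to their arc and labelled by it. Arcs thus meet at most in
  \<open>Axis\<close> vertices.\<close>

definition petal_edges :: "('x \<times> 'x) set \<Rightarrow> (('x, 'x \<times> 'x) node \<times> ('x, 'x \<times> 'x) node) set" where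
  "petal_edges A = (\<Union>e\<in>A. {(Axis (fst e), Low e), (Low e, High e), (High e, Axis (snd e))})"

definition petal :: "(('x, 'x \<times> 'x) node \<Rightarrow> 'a::real_vector) \<Rightarrow> 'x \<times> 'x \<Rightarrow> real \<Rightarrow> 'a" where
  "petal p e \<tau> =
     (if \<tau> \<le> 1/3 then edge_pt p (Axis (fst e), Low e) (3 * \<tau>)
      else if \<tau> \<le> 2/3 then edge_pt p (Low e, High e) (3 * \<tau> - 1)
      else edge_pt p (High e, Axis (snd e)) (3 * \<tau> - 2))"

definition petal_bary :: "'x \<times> 'x \<Rightarrow> real \<Rightarrow> ('x, 'x \<times> 'x) node \<Rightarrow> real" where
  "petal_bary e \<tau> =
     (if \<tau> \<le> 1/3 then barycentric (Axis (fst e), Low e) (3 * \<tau>)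
      else if \<tau> \<le> 2/3 then barycentric (Low e, High e) (3 * \<tau> - 1)
      else barycentric (High e, Axis (snd e)) (3 * \<tau> - 2))"

lemma petal_edges_param:
  assumes "\<epsilon> \<in> petal_edges A" "s \<in> {0..1}"
  shows "\<exists>e\<in>A. \<exists>\<tau>\<in>{0..1}. (\<forall>p :: _ \<Rightarrow> 'a::real_vector. edge_pt p \<epsilon> s = petal p e \<tau>) \<and> barycentric \<epsilon> s = petal_bary e \<tau>"
proof -
  obtain e where e: "e \<in> A" "\<epsilon> \<in> {(Axis (fst e), Low e), (Low e, High e), (High e, Axis (snd e))}"
    using assms(1) unfolding petal_edges_def by blast
  have s: "0 \<le> s" "s \<le> 1" using assms(2) by auto
  from e(2) consider "\<epsilon> = (Axis (fst e), Low e)" | "\<epsilon> = (Low e, High e)" | "\<epsilon> = (High e, Axis (snd e))" by blast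
  then show ?thesis
  proof cases
    case 1
    then show ?thesis using s
      by (intro bexI[OF _ e(1)] bexI[of _ "s / 3"]) (auto simp: petal_def petal_bary_def)
  next
    case 2
    show ?thesis
    proof (intro bexI[OF _ e(1)] bexI[of _ "(1 + s) / 3"] conjI allI)
      show "edge_pt p \<epsilon> s = petal p e ((1 + s) / 3)" for p :: "_ \<Rightarrow> 'a"
      \<comment> \<open>For \<open>s = 0\<close> the point is a breakpoint, which the definition of
        \<open>petal\<close> assigns to the preceding third.\<close>
      proof (cases "s = 0")
        case False
        have "3 * ((1 + s) / 3) - 1 = s" "\<not> (1 + s) / 3 \<le> 1/3" using s False by (simp_all add: field_simps)
        then show ?thesis using s unfolding petal_def 2 by simp
      qed (auto simp: petal_def edge_pt_def 2)
      show "barycentric \<epsilon> s = petal_bary e ((1 + s) / 3)"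
      proof (cases "s = 0")
        case False
        have "3 * ((1 + s) / 3) - 1 = s" "\<not> (1 + s) / 3 \<le> 1/3" using s False by (simp_all add: field_simps)
        then show ?thesis using s unfolding petal_bary_def 2 by simp
      qed (auto simp: petal_bary_def barycentric_def 2)
    qed (use s in auto)
  next
    case 3
    show ?thesis
    proof (intro bexI[OF _ e(1)] bexI[of _ "(2 + s) / 3"] conjI allI)
      show "edge_pt p \<epsilon> s = petal p e ((2 + s) / 3)" for p :: "_ \<Rightarrow> 'a"
      proof (cases "s = 0")
        case False
        have "3 * ((2 + s) / 3) - 2 = s" "\<not> (2 + s) / 3 \<le> 2/3" using s False by (simp_all add: field_simps)
        then show ?thesis using s unfolding petal_def 3 by simp
      qed (auto simp: petal_def edge_pt_def 3)
      show "barycentric \<epsilon> s = petal_bary e ((2 + s) / 3)"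
      proof (cases "s = 0")
        case False
        have "3 * ((2 + s) / 3) - 2 = s" "\<not> (2 + s) / 3 \<le> 2/3" using s False by (simp_all add: field_simps)
        then show ?thesis using s unfolding petal_bary_def 3 by simp
      qed (auto simp: petal_bary_def barycentric_def 3)
    qed (use s in auto)
  qed
qed

lemma realization_petal_edges:
  fixes p :: "('x, 'x \<times> 'x) node \<Rightarrow> 'b::real_vector"
  shows "realization p (petal_edges A) = (\<Union>e\<in>A. petal p e ` {0..1})"
proof
  show "realization p (petal_edges A) \<subseteq> (\<Union>e\<in>A. petal p e ` {0..1})"
  proof
    fix x assume "x \<in> realization p (petal_edges A)"
    then obtain \<epsilon> s where x: "\<epsilon> \<in> petal_edges A" "s \<in> {0..1}" "x = edge_pt p \<epsilon> s"
      unfolding mem_realization by blast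
    then show "x \<in> (\<Union>e\<in>A. petal p e ` {0..1})"
      using petal_edges_param[OF x(1,2), where 'a = 'b] by auto
  qed
  show "(\<Union>e\<in>A. petal p e ` {0..1}) \<subseteq> realization p (petal_edges A)"
  proof
    fix x assume "x \<in> (\<Union>e\<in>A. petal p e ` {0..1})"
    then obtain e \<tau> where e: "e \<in> A" "\<tau> \<in> {0..1}" "x = petal p e \<tau>" by blast
    have E: "(Axis (fst e), Low e) \<in> petal_edges A" "(Low e, High e) \<in> petal_edges A"
        "(High e, Axis (snd e)) \<in> petal_edges A"
      using e(1) unfolding petal_edges_def by auto
    have *: "edge_pt p \<epsilon> s \<in> realization p (petal_edges A)" if "\<epsilon> \<in> petal_edges A" "0 \<le> s" "s \<le> 1" for \<epsilon> s
      unfolding mem_realization using that by (intro bexI[of _ \<epsilon>] bexI[of _ s]) simp_all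
    show "x \<in> realization p (petal_edges A)"
      unfolding e(3) petal_def using e(2) by (auto intro!: * E)
  qed
qed

text \<open>This removes barycentric coordinates from the argument: for the motions below it remains
  to compare parameters on whole petals, where only equal cut points at their ends may
  collide.\<close>

lemma straight_embedding_petal_edges:
  fixes p :: "_ \<Rightarrow> 'a::real_vector"
  assumes "\<And>e f \<tau> \<sigma>. e \<in> A \<Longrightarrow> f \<in> A \<Longrightarrow> \<tau> \<in> {0..1} \<Longrightarrow> \<sigma> \<in> {0..1} \<Longrightarrow> petal p e \<tau> = petal p f \<sigma> \<Longrightarrow>
     e = f \<and> \<tau> = \<sigma> \<or> \<tau> \<in> {0, 1} \<and> \<sigma> \<in> {0, 1} \<and> (if \<tau> = 0 then fst e else snd e) = (if \<sigma> = 0 then fst f else snd f)"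
  shows "straight_embedding p (petal_edges A)"
  unfolding straight_embedding_def
proof (intro ballI impI)
  fix \<epsilon> \<phi> s t assume "\<epsilon> \<in> petal_edges A" "\<phi> \<in> petal_edges A" "s \<in> {0..1::real}" "t \<in> {0..1::real}"
    and eq: "edge_pt p \<epsilon> s = edge_pt p \<phi> t"
  then obtain e f \<tau> \<sigma> where e: "e \<in> A" "\<tau> \<in> {0..1}" "edge_pt p \<epsilon> s = petal p e \<tau>" "barycentric \<epsilon> s = petal_bary e \<tau>"
      and f: "f \<in> A" "\<sigma> \<in> {0..1}" "edge_pt p \<phi> t = petal p f \<sigma>" "barycentric \<phi> t = petal_bary f \<sigma>"
    using petal_edges_param[where 'a = 'a] by (metis (no_types, lifting))
  have ends: "petal_bary e \<tau> = (\<lambda>v. of_bool (v = Axis (if \<tau> = 0 then fst e else snd e)))" if "\<tau> \<in> {0, 1}" for e :: "'b \<times> 'b" and \<tau>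
    using that by (auto simp: petal_bary_def barycentric_def)
  from assms[OF e(1) f(1) e(2) f(2)] eq e f
  have "e = f \<and> \<tau> = \<sigma> \<or> \<tau> \<in> {0, 1} \<and> \<sigma> \<in> {0, 1} \<and> (if \<tau> = 0 then fst e else snd e) = (if \<sigma> = 0 then fst f else snd f)"
    by simp
  then show "barycentric \<epsilon> s = barycentric \<phi> t"
    unfolding e(4) f(4) using ends[of \<tau> e] ends[of \<sigma> f] by auto
qed

lemma petal_linear_motion:
  "petal (\<lambda>v. (1 - t) *\<^sub>R p v + t *\<^sub>R q v) e \<tau> = (1 - t) *\<^sub>R petal p e \<tau> + t *\<^sub>R petal q e \<tau>"
  by (simp add: petal_def edge_pt_def algebra_simps)

text \<open>The depth along a petal: from 0 up to 1 in the first third, constant in the middle, back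
  to 0 in the last.\<close>

definition bump :: "real \<Rightarrow> real" where
  "bump \<tau> = min 1 (min (3 * \<tau>) (3 * (1 - \<tau>)))"

text \<open>The quotient of coordinates 1 and 2 along a petal, relative to \<open>n e\<close>: 0 in
  the first third, rising to 1/2 in the middle, constant in the last. A range of length 1/2 fits
  between sectors whose numbers differ by at least 1.\<close>

definition ramp :: "real \<Rightarrow> real" where
  "ramp \<tau> = max 0 (min (1/2) ((3 * \<tau> - 1) / 2))"

lemma bump_pos: "0 < \<tau> \<Longrightarrow> \<tau> < 1 \<Longrightarrow> 0 < bump \<tau>" and bump_nonneg: "\<tau> \<in> {0..1} \<Longrightarrow> 0 \<le> bump \<tau>"
  and bump_ends [simp]: "bump 0 = 0" "bump 1 = 0"
  by (auto simp: bump_def)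

lemma bump_eq_0: "\<tau> \<in> {0..1} \<Longrightarrow> bump \<tau> = 0 \<longleftrightarrow> \<tau> \<in> {0, 1}"
  using bump_pos[of \<tau>] by (cases "\<tau> = 0"; cases "\<tau> = 1") auto

lemma ramp_bounds: "0 \<le> ramp \<tau>" "ramp \<tau> \<le> 1/2"
  by (auto simp: ramp_def)

text \<open>\<open>bump\<close> is injective on each outer third and \<open>ramp\<close> on the
  middle third; \<open>ramp\<close> also tells the two outer thirds apart.\<close>

lemma bump_ramp_inj:
  assumes "bump \<tau> = bump \<sigma>" "ramp \<tau> = ramp \<sigma>" "0 < bump \<tau>"
  shows "\<tau> = \<sigma>"
  using assms unfolding bump_def ramp_def by (auto simp: min_def max_def split: if_splits)

text \<open>The stages of the motion, with \<open>Low e\<close> and \<open>High e\<close> subdividing the arc \<open>e\<close> into thirds: the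
  original graph, cut points pushed to depth 0 and the rest brought to the front, heights kept while
  the cut points go to the axis and \<open>e\<close> to the sector \<open>n e\<close>, ends of the petals made horizontal. The
  last stage makes the graph locally planar at the axis.\<close>

definition pos0 :: "(real^3, (real^3) \<times> (real^3)) node \<Rightarrow> real^3" where
  "pos0 v = (case v of Axis x \<Rightarrow> x | Low e \<Rightarrow> edge_pt (\<lambda>x. x) e (1/3) | High e \<Rightarrow> edge_pt (\<lambda>x. x) e (2/3))"

definition pos1 :: "(real^3, (real^3) \<times> (real^3)) node \<Rightarrow> real^3" where
  "pos1 v = vector [pos0 v $ 1, case v of Axis x \<Rightarrow> 0 | _ \<Rightarrow> 1, pos0 v $ 3]"

definition pos2 :: "((real^3) \<times> (real^3) \<Rightarrow> real) \<Rightarrow> (real^3, (real^3) \<times> (real^3)) node \<Rightarrow> real^3" where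
  "pos2 n v = (case v of Axis x \<Rightarrow> vector [0, 0, x$3] | Low e \<Rightarrow> vector [n e, 1, pos0 v $ 3]
     | High e \<Rightarrow> vector [n e + 1/2, 1, pos0 v $ 3])"

definition pos3 :: "((real^3) \<times> (real^3) \<Rightarrow> real) \<Rightarrow> (real^3, (real^3) \<times> (real^3)) node \<Rightarrow> real^3" where
  "pos3 n v = (case v of Axis x \<Rightarrow> vector [0, 0, x$3] | Low e \<Rightarrow> vector [n e, 1, fst e $ 3]
     | High e \<Rightarrow> vector [n e + 1/2, 1, snd e $ 3])"

lemma petal_pos0: "petal pos0 e \<tau> = edge_pt (\<lambda>x. x) e \<tau>"
proof -
  have "petal pos0 e \<tau> $ i = edge_pt (\<lambda>x. x) e \<tau> $ i" for i
    by (simp add: petal_def pos0_def edge_pt_def) (auto simp: field_simps)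
  then show ?thesis by (simp add: vec_eq_iff)
qed

lemma petal_pos1:
  "petal pos1 e \<tau> $ 1 = edge_pt (\<lambda>x. x) e \<tau> $ 1" "petal pos1 e \<tau> $ 3 = edge_pt (\<lambda>x. x) e \<tau> $ 3"
  "\<tau> \<in> {0..1} \<Longrightarrow> petal pos1 e \<tau> $ 2 = bump \<tau>"
proof -
  show "petal pos1 e \<tau> $ 1 = edge_pt (\<lambda>x. x) e \<tau> $ 1" "petal pos1 e \<tau> $ 3 = edge_pt (\<lambda>x. x) e \<tau> $ 3"
    unfolding petal_pos0[symmetric] by (simp_all add: petal_def edge_pt_def pos1_def vector_3)
  show "\<tau> \<in> {0..1} \<Longrightarrow> petal pos1 e \<tau> $ 2 = bump \<tau>"
    by (auto simp: petal_def edge_pt_def pos1_def vector_3 bump_def min_def)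
qed

lemma petal_pos2:
  assumes "\<tau> \<in> {0..1}"
  shows "petal (pos2 n) e \<tau> $ 1 = bump \<tau> * (n e + ramp \<tau>)" "petal (pos2 n) e \<tau> $ 2 = bump \<tau>"
    "petal (pos2 n) e \<tau> $ 3 = edge_pt (\<lambda>x. x) e \<tau> $ 3"
proof -
  show "petal (pos2 n) e \<tau> $ 3 = edge_pt (\<lambda>x. x) e \<tau> $ 3"
    unfolding petal_pos0[symmetric] by (simp add: petal_def edge_pt_def pos2_def pos0_def vector_3)
  show "petal (pos2 n) e \<tau> $ 1 = bump \<tau> * (n e + ramp \<tau>)" "petal (pos2 n) e \<tau> $ 2 = bump \<tau>"
    using assms by (auto simp: petal_def edge_pt_def pos2_def vector_3 bump_def ramp_def min_def max_def field_simps)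
qed

lemma petal_pos3:
  assumes "\<tau> \<in> {0..1}"
  shows "petal (pos3 n) e \<tau> $ 1 = bump \<tau> * (n e + ramp \<tau>)" "petal (pos3 n) e \<tau> $ 2 = bump \<tau>"
    "\<tau> \<le> 1/3 \<Longrightarrow> petal (pos3 n) e \<tau> $ 3 = fst e $ 3" "2/3 \<le> \<tau> \<Longrightarrow> petal (pos3 n) e \<tau> $ 3 = snd e $ 3"
  using assms by (auto simp: petal_def edge_pt_def pos3_def vector_3 bump_def ramp_def min_def max_def field_simps)

text \<open>Where \<open>bump\<close> is positive, dividing coordinate 1 by it gives a slope in
  \<open>{n e..n e + 1/2}\<close>. These intervals are disjoint for different petals, and within one
  petal slope and depth determine the parameter.\<close>

lemma petal_projection_inj:
  assumes "e \<in> A" "f \<in> A" and \<tau>: "\<tau> \<in> {0..1}" and \<sigma>: "\<sigma> \<in> {0..1}"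
    and n: "\<And>e f. e \<in> A \<Longrightarrow> f \<in> A \<Longrightarrow> e \<noteq> f \<Longrightarrow> n e + 1 \<le> n f \<or> n f + 1 \<le> n e"
    and w: "bump \<tau> = bump \<sigma>" and u: "bump \<tau> * (n e + ramp \<tau>) = bump \<sigma> * (n f + ramp \<sigma>)"
  shows "\<tau> \<in> {0, 1} \<and> \<sigma> \<in> {0, 1} \<or> e = f \<and> \<tau> = \<sigma>"
proof (cases "bump \<tau> = 0")
  case True
  then show ?thesis using bump_eq_0 \<tau> \<sigma> w by simp
next
  case False
  then have pos: "bump \<tau> > 0" using bump_nonneg[OF \<tau>] by simp
  then have s: "n e + ramp \<tau> = n f + ramp \<sigma>" using u w by simp
  have "e = f"
  proof (rule ccontr)
    assume "e \<noteq> f"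
    then show False using n[OF assms(1,2)] s ramp_bounds[of \<tau>] ramp_bounds[of \<sigma>] by linarith
  qed
  then show ?thesis using bump_ramp_inj[OF w _ pos] s by simp
qed

text \<open>Inner points of two arcs never have the same projection, since one of them would have to
  be an end. By continuity the arcs therefore stand in the same order at all common heights, and
  \<open>left_to_right_order\<close> applies. Passing to ranks creates the spacing.\<close>

lemma spaced_left_to_right_order:
  assumes D: "arc_diagram X A"
  shows "\<exists>n :: (real^3) \<times> (real^3) \<Rightarrow> real.
    (\<forall>e\<in>A. \<forall>f\<in>A. e \<noteq> f \<longrightarrow> n e + 1 \<le> n f \<or> n f + 1 \<le> n e) \<and>
    (\<forall>e\<in>A. \<forall>f\<in>A. \<forall>\<tau> \<sigma>. 0 < \<tau> \<longrightarrow> \<tau> < 1 \<longrightarrow> 0 < \<sigma> \<longrightarrow> \<sigma> < 1 \<longrightarrow> e \<noteq> f \<longrightarrow>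
       edge_pt (\<lambda>x. x) e \<tau> $ 3 = edge_pt (\<lambda>x. x) f \<sigma> $ 3 \<longrightarrow>
       edge_pt (\<lambda>x. x) e \<tau> $ 1 \<noteq> edge_pt (\<lambda>x. x) f \<sigma> $ 1 \<and>
       (edge_pt (\<lambda>x. x) e \<tau> $ 1 < edge_pt (\<lambda>x. x) f \<sigma> $ 1 \<longrightarrow> n e + 1 \<le> n f))"
proof -
  let ?pt = "edge_pt (\<lambda>x::real^3. x)"
  have finA: "finite A" using D by (simp add: arc_diagram_def)
  have up: "fst e $ 3 < snd e $ 3" if "e \<in> A" for e using D that by (simp add: arc_diagram_def)
  have seg: "?pt e \<tau> \<in> closed_segment (fst e) (snd e)" if "0 < \<tau>" "\<tau> < 1" for e \<tau>
    using that unfolding edge_pt_def closed_segment_def by force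
  have no_end: "?pt e \<tau> \<notin> {fst e, snd e}" if "e \<in> A" "0 < \<tau>" "\<tau> < 1" for e \<tau>
  proof
    assume "?pt e \<tau> \<in> {fst e, snd e}"
    then have "?pt e \<tau> $ 3 = fst e $ 3 \<or> ?pt e \<tau> $ 3 = snd e $ 3" by auto
    moreover have "?pt e \<tau> $ 3 - fst e $ 3 = \<tau> * (snd e $ 3 - fst e $ 3)"
      "snd e $ 3 - ?pt e \<tau> $ 3 = (1 - \<tau>) * (snd e $ 3 - fst e $ 3)"
      by (simp_all add: edge_pt_def algebra_simps)
    ultimately show False using that up[OF that(1)] by auto
  qed
  have ne: "?pt e \<tau> $ 1 \<noteq> ?pt f \<sigma> $ 1"
    if e: "e \<in> A" "0 < \<tau>" "\<tau> < 1" and f: "f \<in> A" "0 < \<sigma>" "\<sigma> < 1" and ef: "e \<noteq> f" "?pt e \<tau> $ 3 = ?pt f \<sigma> $ 3" for e f \<tau> \<sigma>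
  proof
    assume "?pt e \<tau> $ 1 = ?pt f \<sigma> $ 1"
    then have sp: "same_proj (?pt e \<tau>) (?pt f \<sigma>)" using ef(2) by (simp add: same_proj_def)
    show False
    proof (cases "?pt e \<tau> = ?pt f \<sigma>")
      case True
      then have "?pt e \<tau> \<in> {fst e, snd e}"
        using D e(1) f(1) ef(1) seg[OF e(2,3), of e] seg[OF f(2,3), of f] unfolding arc_diagram_def by metis
      then show False using no_end e by blast
    next
      case False
      then have "?pt e \<tau> \<in> {fst e, snd e} \<or> ?pt f \<sigma> \<in> {fst f, snd f}"
        using D e(1) f(1) sp seg[OF e(2,3), of e] seg[OF f(2,3), of f] unfolding arc_diagram_def by metis
      then show False using no_end e f by blast
    qed
  qed
  define a where "a = (\<lambda>e::(real^3) \<times> (real^3). fst e $ 3)"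
  define b where "b = (\<lambda>e::(real^3) \<times> (real^3). snd e $ 3)"
  \<comment> \<open>Coordinate 1 of the arc \<open>e\<close> at height \<open>h\<close>: being
    monotone, the arc is a graph over its range of heights.\<close>
  define u where "u = (\<lambda>e h. fst e $ 1 + (h - a e) / (b e - a e) * (snd e $ 1 - fst e $ 1))"
  have pt: "?pt e ((h - a e) / (b e - a e)) $ 1 = u e h" "?pt e ((h - a e) / (b e - a e)) $ 3 = h"
    if "e \<in> A" for e h
  proof -
    define \<tau> where "\<tau> = (h - a e) / (b e - a e)"
    have "\<tau> * (b e - a e) = h - a e" using up[OF that] by (simp add: \<tau>_def a_def b_def)
    then show "?pt e ((h - a e) / (b e - a e)) $ 1 = u e h" "?pt e ((h - a e) / (b e - a e)) $ 3 = h"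
      unfolding u_def \<tau>_def[symmetric] by (simp_all add: edge_pt_def a_def b_def algebra_simps)
  qed
  have u_ne: "u e h \<noteq> u f h"
    if e: "e \<in> A" "f \<in> A" "e \<noteq> f" and h: "a e < h" "a f < h" "h < b e" "h < b f" for e f h
    using ne[of e "(h - a e) / (b e - a e)" f "(h - a f) / (b f - a f)"] e h
    by (simp add: pt divide_simps)
  have "\<exists>n :: (real^3) \<times> (real^3) \<Rightarrow> real. inj_on n A \<and>
    (\<forall>e\<in>A. \<forall>f\<in>A. \<forall>h. a e < h \<longrightarrow> a f < h \<longrightarrow> h < b e \<longrightarrow> h < b f \<longrightarrow> u e h < u f h \<longrightarrow> n e < n f)"
  proof (rule left_to_right_order[OF finA])
    show "a e < b e" if "e \<in> A" for e using up[OF that] by (simp add: a_def b_def)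
    show "u e h' < u f h'"
      if e: "e \<in> A" "f \<in> A" "e \<noteq> f" and h: "a e < h" "a f < h" "h < b e" "h < b f"
        and h': "a e < h'" "a f < h'" "h' < b e" "h' < b f" and less: "u e h < u f h" for e f h h'
    proof (rule ccontr)
      assume notless: "\<not> u e h' < u f h'"
      \<comment> \<open>A change of order between \<open>h\<close> and \<open>h'\<close> would give
        a meeting of the projections at an intermediate height, which lies inside both
        ranges.\<close>
      define g where "g = (\<lambda>x. u f x - u e x)"
      have g: "g h' \<le> 0" "0 \<le> g h" using notless less by (simp_all add: g_def)
      have cont: "continuous_on I g" for I
        unfolding g_def u_def by (intro continuous_intros)
          (use up[OF e(1)] up[OF e(2)] in \<open>simp_all add: a_def b_def\<close>)
      have "\<exists>x. min h h' \<le> x \<and> x \<le> max h h' \<and> g x = 0"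
      proof (cases "h \<le> h'")
        case True
        then show ?thesis using IVT2'[of g h' 0 h, OF g True cont] by auto
      next
        case False
        then have "h' \<le> h" by simp
        then show ?thesis using IVT'[of g h' 0 h, OF g _ cont] by auto
      qed
      then obtain x where x: "min h h' \<le> x" "x \<le> max h h'" "g x = 0" by blast
      have "a e < x" "a f < x" "x < b e" "x < b f" using x(1,2) h h' by linarith+
      then have "u e x \<noteq> u f x" using u_ne e by blast
      then show False using x(3) by (simp add: g_def)
    qed
  qed
  then obtain n :: "(real^3) \<times> (real^3) \<Rightarrow> real" where n: "inj_on n A"
    "\<And>e f h. e \<in> A \<Longrightarrow> f \<in> A \<Longrightarrow> a e < h \<Longrightarrow> a f < h \<Longrightarrow> h < b e \<Longrightarrow> h < b f \<Longrightarrow> u e h < u f h \<Longrightarrow> n e < n f"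
    by blast
  \<comment> \<open>The rank of \<open>e\<close> in the order given by \<open>n\<close>; different
    ranks differ by at least 1.\<close>
  define N where "N = (\<lambda>e. real (card {g \<in> A. n g < n e}))"
  have N: "N e + 1 \<le> N f" if "e \<in> A" "n e < n f" for e f
  proof -
    have "{g \<in> A. n g < n e} \<subset> {g \<in> A. n g < n f}" using that by force
    then have "card {g \<in> A. n g < n e} < card {g \<in> A. n g < n f}" using finA by (intro psubset_card_mono) auto
    then show ?thesis unfolding N_def by linarith
  qed
  have "N e + 1 \<le> N f \<or> N f + 1 \<le> N e" if "e \<in> A" "f \<in> A" "e \<noteq> f" for e f
  proof -
    have "n e \<noteq> n f" using n(1) that by (auto simp: inj_on_def)
    then show ?thesis using N that by (meson linorder_neqE_linordered_idom)
  qed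
  moreover have "?pt e \<tau> $ 1 \<noteq> ?pt f \<sigma> $ 1 \<and> (?pt e \<tau> $ 1 < ?pt f \<sigma> $ 1 \<longrightarrow> N e + 1 \<le> N f)"
    if e: "e \<in> A" "0 < \<tau>" "\<tau> < 1" and f: "f \<in> A" "0 < \<sigma>" "\<sigma> < 1" and ef: "e \<noteq> f" "?pt e \<tau> $ 3 = ?pt f \<sigma> $ 3" for e f \<tau> \<sigma>
  proof -
    define h where "h = ?pt e \<tau> $ 3"
    have *: "a e < ?pt e \<tau> $ 3" "?pt e \<tau> $ 3 < b e" "?pt e \<tau> $ 1 = u e (?pt e \<tau> $ 3)" if "e \<in> A" "0 < \<tau>" "\<tau> < 1" for e \<tau>
    proof -
      have ba: "b e - a e > 0" using up[OF that(1)] by (simp add: a_def b_def)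
      have h: "?pt e \<tau> $ 3 - a e = \<tau> * (b e - a e)" "b e - ?pt e \<tau> $ 3 = (1 - \<tau>) * (b e - a e)"
        by (simp_all add: edge_pt_def a_def b_def algebra_simps)
      then show "a e < ?pt e \<tau> $ 3" "?pt e \<tau> $ 3 < b e"
        using mult_pos_pos[OF that(2) ba] mult_pos_pos[of "1 - \<tau>", OF _ ba] that(3) by linarith+
      have "(?pt e \<tau> $ 3 - a e) / (b e - a e) = \<tau>" using h(1) ba by simp
      then show "?pt e \<tau> $ 1 = u e (?pt e \<tau> $ 3)" using pt(1)[OF that(1), of "?pt e \<tau> $ 3"] by simp
    qed
    have "N e + 1 \<le> N f" if less: "?pt e \<tau> $ 1 < ?pt f \<sigma> $ 1"
    proof (rule N[OF e(1) n(2)[OF e(1) f(1), of h]])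
      show "a e < h" "h < b e" "a f < h" "h < b f" using *[OF e] *[OF f] ef(2) by (simp_all add: h_def)
      show "u e h < u f h" using *(3)[OF e] *(3)[OF f] less ef(2) by (simp add: h_def)
    qed
    then show ?thesis using ne[OF e f ef] by blast
  qed
  ultimately show ?thesis by (intro exI[of _ N]) blast
qed

lemma pl_equiv_petals:
  assumes D: "arc_diagram X A"
  shows "\<exists>n. (\<forall>e\<in>A. \<forall>f\<in>A. e \<noteq> f \<longrightarrow> n e + 1 \<le> n f \<or> n f + 1 \<le> n e) \<and>
    pl_equiv (support A) (realization (pos3 n) (petal_edges A))"
proof -
  let ?pt = "edge_pt (\<lambda>x::real^3. x)"
  have finA: "finite A" "A \<noteq> {}" using D by (simp_all add: arc_diagram_def)
  have X: "fst e \<in> X" "snd e \<in> X" and up: "fst e $ 3 < snd e $ 3" if "e \<in> A" for e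
    using D that by (simp_all add: arc_diagram_def)
  have Xinj: "x = y" if "x \<in> X" "y \<in> X" "x $ 3 = y $ 3" for x y
    using D that by (auto simp: arc_diagram_def inj_on_def)
  have seg: "?pt e \<tau> \<in> closed_segment (fst e) (snd e)" if "\<tau> \<in> {0..1}" for e \<tau>
    using that unfolding edge_pt_def closed_segment_def by force
  have height: "?pt e \<tau> $ 3 = fst e $ 3 + \<tau> * (snd e $ 3 - fst e $ 3)" for e \<tau>
    by (simp add: edge_pt_def algebra_simps)
  have height_inj: "\<tau> = \<sigma>" if "e \<in> A" "?pt e \<tau> $ 3 = ?pt e \<sigma> $ 3" for e \<tau> \<sigma>
    using that(2) up[OF that(1)] unfolding height by simp
  have end_pt: "?pt e 0 = fst e" "?pt e 1 = snd e" for e by (simp_all add: edge_pt_def)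
  have ends01: "\<tau> \<in> {0, 1}" if "e \<in> A" "?pt e \<tau> \<in> {fst e, snd e}" for e \<tau>
    using that height_inj[OF that(1), of \<tau> 0] height_inj[OF that(1), of \<tau> 1] end_pt by auto
  have end_val: "?pt e \<tau> = (if \<tau> = 0 then fst e else snd e)" "?pt e \<tau> \<in> X" if "e \<in> A" "\<tau> \<in> {0, 1}" for e \<tau>
    using that(2) end_pt[of e] X[OF that(1)] by auto
  let ?ok = "\<lambda>e \<tau> f \<sigma>. e = f \<and> \<tau> = \<sigma> \<or> \<tau> \<in> {0, 1} \<and> \<sigma> \<in> {0, 1} \<and> (if \<tau> = 0 then fst e else snd e) = (if \<sigma> = 0 then fst f else snd f)"
  have ok_ends: "?ok e \<tau> f \<sigma>"
    if "e \<in> A" "f \<in> A" "\<tau> \<in> {0, 1}" "\<sigma> \<in> {0, 1}" "?pt e \<tau> $ 3 = ?pt f \<sigma> $ 3" for e f \<tau> \<sigma>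
    using Xinj[OF end_val(2)[OF that(1,3)] end_val(2)[OF that(2,4)] that(5)]
      end_val(1)[OF that(1,3)] end_val(1)[OF that(2,4)] that(3,4) by simp
  obtain n :: "(real^3) \<times> (real^3) \<Rightarrow> real" where
    n: "\<And>e f. e \<in> A \<Longrightarrow> f \<in> A \<Longrightarrow> e \<noteq> f \<Longrightarrow> n e + 1 \<le> n f \<or> n f + 1 \<le> n e" and
    left: "\<And>e f \<tau> \<sigma>. e \<in> A \<Longrightarrow> f \<in> A \<Longrightarrow> 0 < \<tau> \<Longrightarrow> \<tau> < 1 \<Longrightarrow> 0 < \<sigma> \<Longrightarrow> \<sigma> < 1 \<Longrightarrow> e \<noteq> f \<Longrightarrow>
       ?pt e \<tau> $ 3 = ?pt f \<sigma> $ 3 \<Longrightarrow> ?pt e \<tau> $ 1 \<noteq> ?pt f \<sigma> $ 1 \<and> (?pt e \<tau> $ 1 < ?pt f \<sigma> $ 1 \<longrightarrow> n e + 1 \<le> n f)"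
    using spaced_left_to_right_order[OF D] by blast
  have E: "finite (petal_edges A)" "petal_edges A \<noteq> {}" "\<And>\<epsilon>. \<epsilon> \<in> petal_edges A \<Longrightarrow> fst \<epsilon> \<noteq> snd \<epsilon>"
    using finA by (auto simp: petal_edges_def)
  have motion: "pl_equiv (realization p (petal_edges A)) (realization q (petal_edges A))"
    if "\<And>t e f \<tau> \<sigma>. t \<in> {0..1} \<Longrightarrow> e \<in> A \<Longrightarrow> f \<in> A \<Longrightarrow> \<tau> \<in> {0..1} \<Longrightarrow> \<sigma> \<in> {0..1} \<Longrightarrow>
      (\<And>i. (1 - t) * petal p e \<tau> $ i + t * petal q e \<tau> $ i = (1 - t) * petal p f \<sigma> $ i + t * petal q f \<sigma> $ i) \<Longrightarrow>
      ?ok e \<tau> f \<sigma>" for p q :: "_ \<Rightarrow> real^3"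
  proof (rule pl_equiv_linear_motion[OF E])
    fix t :: real assume t: "t \<in> {0..1}"
    show "straight_embedding (\<lambda>v. (1 - t) *\<^sub>R p v + t *\<^sub>R q v) (petal_edges A)"
    proof (rule straight_embedding_petal_edges)
      fix e f \<tau> \<sigma> assume *: "e \<in> A" "f \<in> A" "\<tau> \<in> {0..1::real}" "\<sigma> \<in> {0..1::real}"
        and eq: "petal (\<lambda>v. (1 - t) *\<^sub>R p v + t *\<^sub>R q v) e \<tau> = petal (\<lambda>v. (1 - t) *\<^sub>R p v + t *\<^sub>R q v) f \<sigma>"
      have "(1 - t) * petal p e \<tau> $ i + t * petal q e \<tau> $ i = (1 - t) * petal p f \<sigma> $ i + t * petal q f \<sigma> $ i" for i
        using arg_cong[OF eq, of "\<lambda>x. x $ i"] by (simp add: petal_linear_motion)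
      then show "?ok e \<tau> f \<sigma>" using that[OF t *] by blast
    qed
  qed
  \<comment> \<open>Coordinates 1 and 3 stay fixed, so only points over one another can collide. If
    they are different, the farther one is an end and heads for depth 0, while the nearer one is an
    end as well or heads for a positive depth. In the latter case their order in depth persists; two
    ends of equal height are the same cut point.\<close>
  have m1: "pl_equiv (realization pos0 (petal_edges A)) (realization pos1 (petal_edges A))"
  proof (rule motion)
    fix t e f \<tau> \<sigma> assume t: "t \<in> {0..1::real}" and e: "e \<in> A" and f: "f \<in> A" and \<tau>: "\<tau> \<in> {0..1::real}" and \<sigma>: "\<sigma> \<in> {0..1::real}"
      and eq: "\<And>i. (1 - t) * petal pos0 e \<tau> $ i + t * petal pos1 e \<tau> $ i = (1 - t) * petal pos0 f \<sigma> $ i + t * petal pos1 f \<sigma> $ i"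
    let ?x = "?pt e \<tau>" and ?y = "?pt f \<sigma>"
    have "?x $ 1 = ?y $ 1" "?x $ 3 = ?y $ 3"
      using eq[of 1] eq[of 3] by (simp_all add: petal_pos0 petal_pos1 algebra_simps)
    then have sp: "same_proj ?x ?y" by (simp add: same_proj_def)
    have eq2: "(1 - t) * ?x $ 2 + t * bump \<tau> = (1 - t) * ?y $ 2 + t * bump \<sigma>"
      using eq[of 2] \<tau> \<sigma> by (simp add: petal_pos0 petal_pos1)
    have lower: "?ok e \<tau> f \<sigma>"
      if e: "e \<in> A" and f: "f \<in> A" and \<tau>: "\<tau> \<in> {0..1}" and \<sigma>: "\<sigma> \<in> {0..1}" and sp: "same_proj (?pt e \<tau>) (?pt f \<sigma>)"
        and end_e: "?pt e \<tau> \<in> {fst e, snd e}" and below: "?pt e \<tau> $ 2 < ?pt f \<sigma> $ 2"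
        and eq2: "(1 - t) * ?pt e \<tau> $ 2 + t * bump \<tau> = (1 - t) * ?pt f \<sigma> $ 2 + t * bump \<sigma>" for e f \<tau> \<sigma>
    proof -
      have \<tau>01: "\<tau> \<in> {0, 1}" using ends01 e end_e by blast
      then have "bump \<tau> = 0" by auto
      show ?thesis
      proof (cases "\<sigma> \<in> {0, 1}")
        case True
        then show ?thesis using ok_ends[OF e f \<tau>01] sp by (simp add: same_proj_def)
      next
        case False
        then have "bump \<sigma> > 0" using bump_pos[of \<sigma>] \<sigma> by auto
        have "(1 - t) * ?pt e \<tau> $ 2 + t * bump \<tau> < (1 - t) * ?pt f \<sigma> $ 2 + t * bump \<sigma>"
        proof (cases "t = 1")
          case True
          then show ?thesis using \<open>bump \<tau> = 0\<close> \<open>bump \<sigma> > 0\<close> by simp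
        next
          case False
          then have "(1 - t) * ?pt e \<tau> $ 2 < (1 - t) * ?pt f \<sigma> $ 2" using t below by simp
          moreover have "t * bump \<tau> \<le> t * bump \<sigma>" using \<open>bump \<tau> = 0\<close> \<open>bump \<sigma> > 0\<close> t by simp
          ultimately show ?thesis by linarith
        qed
        then show ?thesis using eq2 by simp
      qed
    qed
    show "?ok e \<tau> f \<sigma>"
    proof (cases "?x = ?y")
      case True
      show ?thesis
      proof (cases "e = f")
        case True
        then show ?thesis using height_inj[OF e, of \<tau> \<sigma>] \<open>?x = ?y\<close> by simp
      next
        case False
        then have "?x \<in> {fst e, snd e} \<and> ?x \<in> {fst f, snd f}"
          using D e f seg[OF \<tau>, of e] seg[OF \<sigma>, of f] True unfolding arc_diagram_def by metis
        then have "\<tau> \<in> {0, 1}" "\<sigma> \<in> {0, 1}" using ends01[OF e, of \<tau>] ends01[OF f, of \<sigma>] True by simp_all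
        then show ?thesis using ok_ends[OF e f] True by simp
      qed
    next
      case False
      then have "?x \<in> {fst e, snd e} \<and> ?x $ 2 < ?y $ 2 \<or> ?y \<in> {fst f, snd f} \<and> ?y $ 2 < ?x $ 2"
        using D e f seg[OF \<tau>, of e] seg[OF \<sigma>, of f] sp unfolding arc_diagram_def by meson
      then show ?thesis
      proof (elim disjE conjE)
        assume "?x \<in> {fst e, snd e}" "?x $ 2 < ?y $ 2"
        then show ?thesis using lower[OF e f \<tau> \<sigma> sp _ _ eq2] by blast
      next
        assume "?y \<in> {fst f, snd f}" "?y $ 2 < ?x $ 2"
        then have "?ok f \<sigma> e \<tau>" using lower[OF f e \<sigma> \<tau> same_proj_sym[OF sp] _ _ eq2[symmetric]] by blast
        then show ?thesis by auto
      qed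
    qed
  qed
  \<comment> \<open>Coordinates 2 and 3 stay fixed, so colliding points agree in height and depth.
    On different arcs and at positive depth, the old order in coordinate 1 is the order of the
    sectors, so it is kept by every convex combination. At depth 0 the heights separate the cut
    points.\<close>
  have m2: "pl_equiv (realization pos1 (petal_edges A)) (realization (pos2 n) (petal_edges A))"
  proof (rule motion)
    fix t e f \<tau> \<sigma> assume t: "t \<in> {0..1::real}" and e: "e \<in> A" and f: "f \<in> A" and \<tau>: "\<tau> \<in> {0..1::real}" and \<sigma>: "\<sigma> \<in> {0..1::real}"
      and eq: "\<And>i. (1 - t) * petal pos1 e \<tau> $ i + t * petal (pos2 n) e \<tau> $ i = (1 - t) * petal pos1 f \<sigma> $ i + t * petal (pos2 n) f \<sigma> $ i"
    have h: "?pt e \<tau> $ 3 = ?pt f \<sigma> $ 3" and w: "bump \<tau> = bump \<sigma>"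
      using eq[of 3] eq[of 2] \<tau> \<sigma> by (simp_all add: petal_pos1 petal_pos2 algebra_simps)
    have eq1: "(1 - t) * ?pt e \<tau> $ 1 + t * (bump \<tau> * (n e + ramp \<tau>)) = (1 - t) * ?pt f \<sigma> $ 1 + t * (bump \<tau> * (n f + ramp \<sigma>))"
      using eq[of 1] \<tau> \<sigma> w by (simp add: petal_pos1 petal_pos2)
    show "?ok e \<tau> f \<sigma>"
    proof (cases "bump \<tau> = 0")
      case True
      then have "\<tau> \<in> {0, 1}" "\<sigma> \<in> {0, 1}" using bump_eq_0 \<tau> \<sigma> w by simp_all
      then show ?thesis using ok_ends[OF e f] h by simp
    next
      case False
      then have pos: "bump \<tau> > 0" using bump_nonneg[OF \<tau>] by simp
      have "\<tau> \<noteq> 0" "\<tau> \<noteq> 1" "\<sigma> \<noteq> 0" "\<sigma> \<noteq> 1" using False w by auto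
      then have int: "0 < \<tau>" "\<tau> < 1" "0 < \<sigma>" "\<sigma> < 1" using \<tau> \<sigma> by auto
      show ?thesis
      proof (cases "e = f")
        case True
        then show ?thesis using height_inj[OF e, of \<tau> \<sigma>] h by simp
      next
        case False
        have strict: "(1 - t) * u + t * (bump \<tau> * (a + ramp \<tau>')) < (1 - t) * v + t * (bump \<tau> * (b + ramp \<sigma>'))"
          if "u < v" "a + 1 \<le> b" for u v a b \<tau>' \<sigma>'
        proof -
          have "a + ramp \<tau>' < b + ramp \<sigma>'" using that(2) ramp_bounds[of \<tau>'] ramp_bounds[of \<sigma>'] by linarith
          then have *: "bump \<tau> * (a + ramp \<tau>') < bump \<tau> * (b + ramp \<sigma>')" using pos by simp
          show ?thesis
          proof (cases "t = 1")
            case False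
            then have "(1 - t) * u < (1 - t) * v" using t that(1) by simp
            moreover have "t * (bump \<tau> * (a + ramp \<tau>')) \<le> t * (bump \<tau> * (b + ramp \<sigma>'))"
              using mult_left_mono[OF less_imp_le[OF *], of t] t by simp
            ultimately show ?thesis by linarith
          qed (use * in simp)
        qed
        have "?pt e \<tau> $ 1 < ?pt f \<sigma> $ 1 \<or> ?pt f \<sigma> $ 1 < ?pt e \<tau> $ 1"
          using left[OF e f int False h] by linarith
        then show ?thesis
        proof
          assume l: "?pt e \<tau> $ 1 < ?pt f \<sigma> $ 1"
          then have "n e + 1 \<le> n f" using left[OF e f int False h] by blast
          from strict[OF l this, of \<tau> \<sigma>] show ?thesis using eq1 by simp
        next
          assume l: "?pt f \<sigma> $ 1 < ?pt e \<tau> $ 1"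
          then have "n f + 1 \<le> n e" using left[OF f e int(3,4,1,2) not_sym[OF False] h[symmetric]] by blast
          from strict[OF l this, of \<sigma> \<tau>] show ?thesis using eq1 by simp
        qed
      qed
    qed
  qed
  \<comment> \<open>Only heights change. At positive depth the projection along coordinate 3 already
    separates all points, and the cut points on the axis keep their distinct heights.\<close>
  have m3: "pl_equiv (realization (pos2 n) (petal_edges A)) (realization (pos3 n) (petal_edges A))"
  proof (rule motion)
    fix t e f \<tau> \<sigma> assume t: "t \<in> {0..1::real}" and e: "e \<in> A" and f: "f \<in> A" and \<tau>: "\<tau> \<in> {0..1::real}" and \<sigma>: "\<sigma> \<in> {0..1::real}"
      and eq: "\<And>i. (1 - t) * petal (pos2 n) e \<tau> $ i + t * petal (pos3 n) e \<tau> $ i = (1 - t) * petal (pos2 n) f \<sigma> $ i + t * petal (pos3 n) f \<sigma> $ i"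
    have w: "bump \<tau> = bump \<sigma>" using eq[of 2] \<tau> \<sigma> by (simp add: petal_pos2 petal_pos3 algebra_simps)
    have u: "bump \<tau> * (n e + ramp \<tau>) = bump \<sigma> * (n f + ramp \<sigma>)"
      using eq[of 1] \<tau> \<sigma> by (simp add: petal_pos2 petal_pos3 algebra_simps)
    have "petal (pos3 n) e \<tau> $ 3 = ?pt e \<tau> $ 3" if "\<tau> \<in> {0, 1}" for e \<tau>
      using that petal_pos3(3)[of 0 n e] petal_pos3(4)[of 1 n e] end_pt[of e] by auto
    then have "?pt e \<tau> $ 3 = ?pt f \<sigma> $ 3" if "\<tau> \<in> {0, 1}" "\<sigma> \<in> {0, 1}"
      using eq[of 3] that \<tau> \<sigma> by (simp add: petal_pos2 algebra_simps)
    then show "?ok e \<tau> f \<sigma>"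
      using petal_projection_inj[OF e f \<tau> \<sigma> n w u] ok_ends[OF e f, of \<tau> \<sigma>] by blast
  qed
  have "realization pos0 (petal_edges A) = support A"
  proof -
    have "realization pos0 (petal_edges A) = (\<Union>e\<in>A. ?pt e ` {0..1})"
      unfolding realization_petal_edges petal_pos0 ..
    also have "\<dots> = support A" unfolding set_eq_iff mem_realization by blast
    finally show ?thesis .
  qed
  then have "pl_equiv (support A) (realization (pos3 n) (petal_edges A))"
    using pl_equiv_trans[OF m1 pl_equiv_trans[OF m2 m3]] by simp
  then show ?thesis by (intro exI[of _ n] conjI ballI impI n)
qed

section \<open>Projecting the petals\<close>

text \<open>Every edge end at \<open>x\<close> covers all points of the arc near \<open>x\<close> on one of its two sides, so three
  edge ends would overlap.\<close>

lemma degree_le_2_on_arc: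
  fixes H :: "'a::t2_space set"
  assumes G: "graph_structure H V E" and x: "x \<in> V"
    and c: "arc c" "\<tau> \<in> {0<..<1}" "c \<tau> = x"
    and N: "open N" "x \<in> N" "N \<inter> H \<subseteq> c ` {0<..<1}"
  shows "degree_at E x \<le> 2"
proof (rule ccontr)
  assume "\<not> degree_at E x \<le> 2"
  have E: "path d" "inj_on d {0<..<1}" "disjnt (d ` {0<..<1}) V" "d ` {0..1} \<subseteq> H" if "d \<in> E" for d
    using G that unfolding graph_structure_def path_image_def by auto
  have disj: "disjnt (d ` {0<..<1}) (d' ` {0<..<1})" if "d \<in> E" "d' \<in> E" "d \<noteq> d'" for d d'
    using G that unfolding graph_structure_def pairwise_def by blast
  \<comment> \<open>The edge ends at \<open>x\<close>, as edges with a flag for the final end; a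
    loop at \<open>x\<close> contributes two, in accordance with \<open>degree_at\<close>. Each
    \<open>\<gamma> k\<close> runs from \<open>x\<close> into its edge.\<close>
  define K where "K = {d \<in> E. pathstart d = x} \<times> {False} \<union> {d \<in> E. pathfinish d = x} \<times> {True}"
  define \<gamma> where "\<gamma> = (\<lambda>(k::(real \<Rightarrow> 'a) \<times> bool) s. fst k (if snd k then 1 - s else s))"
  have "finite E" using G by (simp add: graph_structure_def)
  then have finK: "finite K" by (simp add: K_def)
  have "card K = degree_at E x"
    unfolding K_def degree_at_def using \<open>finite E\<close>
    by (subst card_Un_disjoint) (auto simp: card_cartesian_product)
  then have "card K > 2" using \<open>\<not> _ \<le> 2\<close> by simp
  obtain g where g: "homeomorphism {0..1} (path_image c) c g" using homeomorphism_arc c(1) by blast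
  have gc: "g (c s) = s" if "s \<in> {0..1}" for s using g that by (simp add: homeomorphism_def)
  have cg: "c (g y) = y" if "y \<in> path_image c" for y using g that by (simp add: homeomorphism_def)
  have cont_g: "continuous_on (path_image c) g" using g by (simp add: homeomorphism_def)
  have sub_c: "c ` {0<..<1} \<subseteq> path_image c" by (auto simp: path_image_def)
  have side: "(\<exists>w>\<tau>. \<forall>v. \<tau> < v \<longrightarrow> v \<le> w \<longrightarrow> c v \<in> \<gamma> k ` {0<..<1/2}) \<or>
      (\<exists>w<\<tau>. \<forall>v. w \<le> v \<longrightarrow> v < \<tau> \<longrightarrow> c v \<in> \<gamma> k ` {0<..<1/2})" if k: "k \<in> K" for k
  proof -
    have kE: "fst k \<in> E" using k by (auto simp: K_def)
    have start: "\<gamma> k 0 = x" using k by (auto simp: K_def \<gamma>_def pathstart_def pathfinish_def)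
    have cont: "continuous_on {0..1} (\<gamma> k)"
    proof -
      have "continuous_on {0..1} (\<lambda>s. fst k (if snd k then 1 - s else s))"
        using E(1)[OF kE] unfolding path_def
        by (cases "snd k") (auto intro!: continuous_on_compose2[of "{0..1}" "fst k"] continuous_intros)
      then show ?thesis by (simp add: \<gamma>_def)
    qed
    have avoid: "\<gamma> k s \<noteq> x" if "0 < s" "s < 1" for s
    proof -
      have "\<gamma> k s \<in> fst k ` {0<..<1}" using that by (auto simp: \<gamma>_def)
      then show ?thesis using E(3)[OF kE] x by (auto simp: disjnt_def)
    qed
    have inH: "\<gamma> k s \<in> H" if "0 \<le> s" "s \<le> 1" for s
      using E(4)[OF kE] that by (auto simp: \<gamma>_def)
    have "\<forall>\<^sub>F s in at 0 within {0..1}. \<gamma> k s \<in> N"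
      using cont N(1,2) start unfolding continuous_on_def
      by (metis atLeastAtMost_iff order_refl topological_tendstoD zero_le_one)
    then obtain d where d: "d > 0" "\<And>s. s \<in> {0..1} \<Longrightarrow> s \<noteq> 0 \<Longrightarrow> dist s 0 < d \<Longrightarrow> \<gamma> k s \<in> N"
      unfolding eventually_at by blast
    \<comment> \<open>Up to \<open>\<delta>\<close> the edge end stays in \<open>N\<close>, where
      \<open>H\<close> is part of the arc, and in the first half of its edge, so that the two ends
      of a loop do not overlap.\<close>
    define \<delta> where "\<delta> = min (d / 2) (1 / 4)"
    have \<delta>: "0 < \<delta>" "\<delta> < d" "\<delta> < 1/2" using d(1) by (auto simp: \<delta>_def)
    have inc: "\<gamma> k s \<in> c ` {0<..<1}" if "s \<in> {0..\<delta>}" for s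
    proof -
      have "\<gamma> k s \<in> N" using d(2)[of s] that \<delta> N(2) start by (cases "s = 0") auto
      then show ?thesis using N(3) inH[of s] that \<delta> by auto
    qed
    \<comment> \<open>The position on \<open>c\<close> of a point leaving \<open>x\<close> along the
      edge. It starts at \<open>\<tau>\<close>, ends elsewhere, and by the intermediate value
      theorem takes all positions in between.\<close>
    define \<psi> where "\<psi> = (\<lambda>s. g (\<gamma> k s))"
    have cont\<psi>: "continuous_on {0..\<delta>} \<psi>" unfolding \<psi>_def
      using inc sub_c \<delta> by (intro continuous_on_compose2[OF cont_g] continuous_on_subset[OF cont]) auto
    have c\<psi>: "c (\<psi> s) = \<gamma> k s" if "s \<in> {0..\<delta>}" for s
      using cg inc[OF that] sub_c unfolding \<psi>_def by blast
    have \<psi>0: "\<psi> 0 = \<tau>" using start c(2,3) gc[of \<tau>] by (simp add: \<psi>_def)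
    have hit: "c v \<in> \<gamma> k ` {0<..<1/2}" if "s \<in> {0..\<delta>}" "\<psi> s = v" "v \<noteq> \<tau>" for s v
    proof -
      have "s \<noteq> 0" using that \<psi>0 by auto
      then have "s \<in> {0<..<1/2}" using that(1) \<delta>(3) by auto
      moreover have "c v = \<gamma> k s" using c\<psi>[OF that(1)] that(2) by simp
      ultimately show ?thesis by blast
    qed
    have "\<psi> \<delta> \<noteq> \<tau>"
    proof
      assume "\<psi> \<delta> = \<tau>"
      then have "\<gamma> k \<delta> = x" using c\<psi>[of \<delta>] c(3) \<delta>(1) by simp
      then show False using avoid[of \<delta>] \<delta> by simp
    qed
    then consider "\<tau> < \<psi> \<delta>" | "\<psi> \<delta> < \<tau>" by linarith
    then show ?thesis
    proof cases
      case 1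
      have "c v \<in> \<gamma> k ` {0<..<1/2}" if v: "\<tau> < v" "v \<le> \<psi> \<delta>" for v
      proof -
        obtain s where "0 \<le> s" "s \<le> \<delta>" "\<psi> s = v"
          using IVT'[of \<psi> 0 v \<delta>] v \<psi>0 \<delta>(1) cont\<psi> by auto
        then show ?thesis using hit[of s v] v by simp
      qed
      then show ?thesis using 1 by blast
    next
      case 2
      have "c v \<in> \<gamma> k ` {0<..<1/2}" if v: "\<psi> \<delta> \<le> v" "v < \<tau>" for v
      proof -
        obtain s where "0 \<le> s" "s \<le> \<delta>" "\<psi> s = v"
          using IVT2'[of \<psi> \<delta> v 0] v \<psi>0 \<delta>(1) cont\<psi> by auto
        then show ?thesis using hit[of s v] v by simp
      qed
      then show ?thesis using 2 by blast
    qed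
  qed
  have ends_disjoint: "\<gamma> k ` {0<..<1/2} \<inter> \<gamma> l ` {0<..<1/2} = {}" if k: "k \<in> K" and l: "l \<in> K" and kl: "k \<noteq> l" for k l
  proof -
    have kE: "fst k \<in> E" "fst l \<in> E" using k l by (auto simp: K_def)
    have False if s: "s \<in> {0<..<1/2}" "t \<in> {0<..<1/2}" and eq: "\<gamma> k s = \<gamma> l t" for s t
    proof (cases "fst k = fst l")
      case True
      then have ne: "snd k \<noteq> snd l" using kl by (simp add: prod_eq_iff)
      have "(if snd k then 1 - s else s) = (if snd l then 1 - t else t)"
        using eq E(2)[OF kE(1)] s True unfolding \<gamma>_def by (auto simp: inj_on_def split: if_splits)
      then show False using ne s by (auto split: if_splits)
    next
      case False
      have "\<gamma> k s \<in> fst k ` {0<..<1}" "\<gamma> l t \<in> fst l ` {0<..<1}" using s by (auto simp: \<gamma>_def)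
      then show False using disj[OF kE False] eq by (auto simp: disjnt_def)
    qed
    then show ?thesis by blast
  qed
  \<comment> \<open>Every edge end covers an interval to the right or to the left of
    \<open>\<tau>\<close>. Of more than two ends, two agree in the value of \<open>right\<close> and
    hence cover a common side.\<close>
  define right where "right = (\<lambda>k. \<exists>w>\<tau>. \<forall>v. \<tau> < v \<longrightarrow> v \<le> w \<longrightarrow> c v \<in> \<gamma> k ` {0<..<1/2})"
  have "\<not> inj_on right K"
  proof
    assume "inj_on right K"
    then have "card K \<le> card (UNIV :: bool set)" by (intro card_inj_on_le) auto
    then show False using \<open>card K > 2\<close> by simp
  qed
  then obtain k l where kl: "k \<in> K" "l \<in> K" "k \<noteq> l" "right k = right l" by (auto simp: inj_on_def)
  have "\<exists>v. c v \<in> \<gamma> k ` {0<..<1/2} \<and> c v \<in> \<gamma> l ` {0<..<1/2}"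
  proof (cases "right k")
    case True
    then obtain w w' where "w > \<tau>" "\<forall>v. \<tau> < v \<longrightarrow> v \<le> w \<longrightarrow> c v \<in> \<gamma> k ` {0<..<1/2}"
        "w' > \<tau>" "\<forall>v. \<tau> < v \<longrightarrow> v \<le> w' \<longrightarrow> c v \<in> \<gamma> l ` {0<..<1/2}"
      using kl(4) unfolding right_def by blast
    then show ?thesis by (intro exI[of _ "min w w'"]) auto
  next
    case False
    then obtain w w' where "w < \<tau>" "\<forall>v. w \<le> v \<longrightarrow> v < \<tau> \<longrightarrow> c v \<in> \<gamma> k ` {0<..<1/2}"
        "w' < \<tau>" "\<forall>v. w' \<le> v \<longrightarrow> v < \<tau> \<longrightarrow> c v \<in> \<gamma> l ` {0<..<1/2}"
      using kl(4) side[OF kl(1)] side[OF kl(2)] unfolding right_def by blast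
    then show ?thesis by (intro exI[of _ "max w w'"]) auto
  qed
  then show False using ends_disjoint[OF kl(1-3)] by blast
qed

text \<open>One formula with clamped parameters for all three thirds, from which continuity is
  evident without matching values at the breakpoints.\<close>

lemma petal_clamp:
  fixes p :: "_ \<Rightarrow> 'b::real_vector"
  assumes "\<tau> \<in> {0..1}"
  shows "petal p e \<tau> = p (Axis (fst e)) + max 0 (min 1 (3 * \<tau>)) *\<^sub>R (p (Low e) - p (Axis (fst e)))
     + max 0 (min 1 (3 * \<tau> - 1)) *\<^sub>R (p (High e) - p (Low e))
     + max 0 (min 1 (3 * \<tau> - 2)) *\<^sub>R (p (Axis (snd e)) - p (High e))"
proof -
  consider "\<tau> \<le> 1/3" | "1/3 < \<tau>" "\<tau> \<le> 2/3" | "2/3 < \<tau>" by linarith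
  then show ?thesis
  proof cases
    case 1
    then have "max 0 (min 1 (3 * \<tau>)) = 3 * \<tau>" "max 0 (min 1 (3 * \<tau> - 1)) = 0" "max 0 (min 1 (3 * \<tau> - 2)) = 0"
      using assms by auto
    then show ?thesis using 1 by (simp add: petal_def edge_pt_def algebra_simps)
  next
    case 2
    then have "max 0 (min 1 (3 * \<tau>)) = 1" "max 0 (min 1 (3 * \<tau> - 1)) = 3 * \<tau> - 1" "max 0 (min 1 (3 * \<tau> - 2)) = 0"
      using assms by auto
    then show ?thesis using 2 by (simp add: petal_def edge_pt_def algebra_simps scaleR_2)
  next
    case 3
    then have "max 0 (min 1 (3 * \<tau>)) = 1" "max 0 (min 1 (3 * \<tau> - 1)) = 1" "max 0 (min 1 (3 * \<tau> - 2)) = 3 * \<tau> - 2"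
      using assms by auto
    moreover have "3 *\<^sub>R x = x + (x + x)" for x :: 'b
      using scaleR_left_distrib[of 2 1 x] by (simp add: scaleR_2 add.assoc)
    ultimately show ?thesis using 3 by (simp add: petal_def edge_pt_def algebra_simps scaleR_2)
  qed
qed

lemma path_petal: "path (petal p e :: real \<Rightarrow> 'a::real_normed_vector)"
proof -
  have "continuous_on {0..1} (\<lambda>\<tau>. p (Axis (fst e)) + max 0 (min 1 (3 * \<tau>)) *\<^sub>R (p (Low e) - p (Axis (fst e)))
     + max 0 (min 1 (3 * \<tau> - 1)) *\<^sub>R (p (High e) - p (Low e))
     + max 0 (min 1 (3 * \<tau> - 2)) *\<^sub>R (p (Axis (snd e)) - p (High e)))"
    by (intro continuous_intros)
  then show ?thesis unfolding path_def by (rule continuous_on_eq) (simp add: petal_clamp)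
qed

lemma polygonal_line_petal: "polygonal_line (petal p e ` {0..1})"
proof -
  have "petal p e ` {0..1} = realization p (petal_edges {e})" by (simp add: realization_petal_edges)
  also have "\<dots> = closed_segment (p (Axis (fst e))) (p (Low e)) \<union> (closed_segment (p (Low e)) (p (High e)) \<union>
      closed_segment (p (High e)) (p (Axis (snd e))))"
    by (simp add: realization_def petal_edges_def)
  finally have *: "petal p e ` {0..1} = \<dots>" .
  define xs where "xs = [p (Axis (fst e)), p (Low e), p (High e), p (Axis (snd e))]"
  have "{..<length xs - 1} = {0, 1, 2}" by (auto simp: xs_def)
  then have "(\<Union>i<length xs - 1. closed_segment (xs ! i) (xs ! Suc i)) = petal p e ` {0..1}"
    unfolding * by (simp add: xs_def numeral_2_eq_2)
  moreover have "2 \<le> length xs" by (simp add: xs_def)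
  ultimately show ?thesis unfolding polygonal_line_def by metis
qed

lemma petal_pos3_ends:
  "petal (pos3 n) e 0 = vector [0, 0, fst e $ 3]" "petal (pos3 n) e 1 = vector [0, 0, snd e $ 3]"
  by (simp_all add: petal_def edge_pt_def pos3_def)

text \<open>Off the axis the projection is injective, and a vertex inside a petal has degree at most
  2 in every structure on \<open>H\<close>. The axis is projected to the origin, which is singular
  because the two ends of an arc have different heights.\<close>

lemma petals_single_singular_point:
  assumes finA: "finite A" "A \<noteq> {}" and up: "\<And>e. e \<in> A \<Longrightarrow> fst e $ 3 < snd e $ 3"
    and n: "\<And>e f. e \<in> A \<Longrightarrow> f \<in> A \<Longrightarrow> e \<noteq> f \<Longrightarrow> n e + 1 \<le> n f \<or> n f + 1 \<le> n e"
  defines "H \<equiv> realization (pos3 n) (petal_edges A)"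
  shows "spatial_graph H \<and> (\<exists>\<pi>. orthogonal_projection \<pi> \<and> (\<exists>!q. q \<in> singular_points \<pi> H))"
proof -
  let ?p = "petal (pos3 n)"
  let ?V = "(\<Union>e\<in>A. {?p e 0, ?p e 1})"
  have H: "H = (\<Union>e\<in>A. ?p e ` {0..1})" unfolding H_def by (rule realization_petal_edges)
  have proj_inj: "\<tau> \<in> {0, 1} \<and> \<sigma> \<in> {0, 1} \<or> e = f \<and> \<tau> = \<sigma>"
    if e: "e \<in> A" and f: "f \<in> A" and \<tau>: "\<tau> \<in> {0..1}" and \<sigma>: "\<sigma> \<in> {0..1}"
      and eq: "?p e \<tau> $ 1 = ?p f \<sigma> $ 1" "?p e \<tau> $ 2 = ?p f \<sigma> $ 2" for e f \<tau> \<sigma>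
    using eq \<tau> \<sigma> by (intro petal_projection_inj[OF e f \<tau> \<sigma> n]) (simp_all add: petal_pos3)
  have inj: "e = f \<and> \<tau> = \<sigma>"
    if "e \<in> A" "f \<in> A" "\<tau> \<in> {0<..<1}" "\<sigma> \<in> {0..1}" "?p e \<tau> = ?p f \<sigma>" for e f \<tau> \<sigma>
  proof -
    have "\<tau> \<in> {0..1}" "\<tau> \<notin> {0, 1}" using that(3) by auto
    then show ?thesis using proj_inj[OF that(1,2) _ that(4), of \<tau>] that(5) by simp
  qed
  have V2: "x $ 1 = 0" "x $ 2 = 0" if x: "x \<in> ?V" for x
    using x by (auto simp: petal_pos3_ends)
  have graph: "graph_structure H ?V (?p ` A)"
    unfolding graph_structure_def
  proof (intro conjI ballI)
    show "finite ?V" "finite (?p ` A)" "?p ` A \<noteq> {}" using finA by auto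
    fix c assume "c \<in> ?p ` A"
    then obtain e where e: "e \<in> A" "c = ?p e" by blast
    show "path c" unfolding e(2) by (rule path_petal)
    show "pathstart c \<in> ?V" "pathfinish c \<in> ?V" using e by (auto simp: pathstart_def pathfinish_def)
    show "inj_on c {0<..<1}"
      unfolding e(2) by (rule inj_onI) (use inj[OF e(1) e(1)] in auto)
    show "disjnt (c ` {0<..<1}) ?V"
    proof -
      have False if "\<tau> \<in> {0<..<1}" "f \<in> A" "\<sigma> \<in> {0, 1}" "?p e \<tau> = ?p f \<sigma>" for \<tau> f \<sigma>
        using inj[OF e(1) that(2,1) _ that(4)] that by auto
      then show ?thesis unfolding disjnt_def e(2) by blast
    qed
  next
    show "pairwise (\<lambda>c d. disjnt (c ` {0<..<1}) (d ` {0<..<1})) (?p ` A)"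
    proof (rule pairwiseI)
      fix c d assume "c \<in> ?p ` A" "d \<in> ?p ` A" "c \<noteq> d"
      then obtain e f where ef: "e \<in> A" "c = ?p e" "f \<in> A" "d = ?p f" "e \<noteq> f" by blast
      have False if "\<tau> \<in> {0<..<1}" "\<sigma> \<in> {0<..<1}" "?p e \<tau> = ?p f \<sigma>" for \<tau> \<sigma>
        using inj[OF ef(1,3) that(1) _ that(3)] that(2) ef(5) by auto
      then show "disjnt (c ` {0<..<1}) (d ` {0<..<1})" unfolding disjnt_def ef(2,4) by blast
    qed
    show "H = ?V \<union> (\<Union>c\<in>?p ` A. path_image c)"
    proof -
      have "{?p e 0, ?p e 1} \<subseteq> ?p e ` {0..1}" for e by auto
      then have "?V \<subseteq> H" unfolding H by blast
      moreover have "(\<Union>c\<in>?p ` A. path_image c) = H" unfolding H path_image_def by simp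
      ultimately show ?thesis by blast
    qed
  qed
  have "locally_planar H v" if v: "v \<in> ?V" for v
  proof -
    define Z where "Z = (\<lambda>e. fst e $ 3) ` A \<union> (\<lambda>e. snd e $ 3) ` A"
    have "finite Z" using finA by (simp add: Z_def)
    then obtain d where d: "d > 0" "\<forall>z\<in>Z. z \<noteq> v $ 3 \<longrightarrow> d \<le> dist (v $ 3) z"
      using finite_set_avoid by blast
    let ?P = "{x::real^3. axis 3 1 \<bullet> x = v $ 3}"
    have "x \<in> ?P" if x: "x \<in> H \<inter> ball v (min d 1)" for x
    proof -
      obtain e \<tau> where e: "e \<in> A" "\<tau> \<in> {0..1}" "x = ?p e \<tau>" using x unfolding H by blast
      have close: "dist v x < d" "dist v x < 1" using x by auto
      have "\<bar>x $ i - v $ i\<bar> \<le> dist v x" for i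
        using component_le_norm_cart[of "x - v" i] by (simp add: dist_norm norm_minus_commute)
      from this[of 2] this[of 3] have c: "\<bar>x $ 2 - v $ 2\<bar> < 1" "\<bar>x $ 3 - v $ 3\<bar> < d" using close by linarith+
      \<comment> \<open>Within distance 1 of the axis vertex the depth is below 1, which leaves the
        outer thirds. There the height is that of a cut point, and the radius \<open>d\<close>
        leaves only the height of \<open>v\<close> itself, so the graph lies in a horizontal plane
        near \<open>v\<close>.\<close>
      have "bump \<tau> < 1" using c(1) V2(2)[OF v] e(3) petal_pos3(2)[OF e(2), of n e] by simp
      then have "\<tau> \<le> 1/3 \<or> 2/3 \<le> \<tau>" by (auto simp: bump_def min_def split: if_splits)
      then have "x $ 3 \<in> Z" using petal_pos3(3,4)[OF e(2), of n e] e by (auto simp: Z_def)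
      then have "x $ 3 = v $ 3" using d(2) c(2) by (force simp: dist_real_def)
      then show ?thesis by (simp add: inner_axis')
    qed
    moreover have "affine ?P" by (rule affine_hyperplane)
    moreover have "aff_dim ?P = 2" by (subst aff_dim_hyperplane) (auto simp: axis_eq_0_iff)
    ultimately show ?thesis unfolding locally_planar_def using d(1)
      by (intro exI[of _ "min d 1"] conjI disjI1 exI[of _ ?P]) auto
  qed
  moreover have "polygonal_line (path_image c)" if "c \<in> ?p ` A" for c
    using that polygonal_line_petal unfolding path_image_def by blast
  ultimately have spatial: "spatial_graph H"
    using graph unfolding spatial_graph_def spatial_structure_def by blast
  \<comment> \<open>The height is projected away, whereas the arcs were arranged by viewing them
    along coordinate 2.\<close>
  define \<pi> where "\<pi> = (\<lambda>x::real^3. vector [axis 1 1 \<bullet> x, axis 2 1 \<bullet> x] :: real^2)"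
  have \<pi>: "\<pi> x = vector [x $ 1, x $ 2]" for x by (simp add: \<pi>_def inner_axis')
  have \<pi>_eq: "\<pi> x = \<pi> y \<longleftrightarrow> x $ 1 = y $ 1 \<and> x $ 2 = y $ 2" for x y
    by (auto simp: \<pi> vec_eq_iff forall_2)
  have "orthogonal_projection \<pi>"
    unfolding orthogonal_projection_def
    by (intro exI[of _ "axis 1 1"] exI[of _ "axis 2 1"]) (simp add: \<pi>_def orthogonal_def inner_axis_axis)
  moreover have "\<exists>!q. q \<in> singular_points \<pi> H"
  proof (rule ex1I[of _ "\<pi> 0"])
    obtain e where e: "e \<in> A" using finA(2) by blast
    have "?p e 0 \<in> H" "?p e 1 \<in> H" unfolding H by (intro UN_I[OF e] imageI; simp)+
    moreover have "?p e 0 \<noteq> ?p e 1"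
    proof
      assume "?p e 0 = ?p e 1"
      then have "?p e 0 $ 3 = ?p e 1 $ 3" by simp
      then show False using up[OF e] by (simp add: petal_pos3_ends)
    qed
    moreover have "\<pi> (?p e 0) = \<pi> 0" "\<pi> (?p e 1) = \<pi> 0" by (simp_all add: \<pi>_eq petal_pos3_ends)
    ultimately show "\<pi> 0 \<in> singular_points \<pi> H" unfolding singular_points_def by blast
  next
    fix q assume "q \<in> singular_points \<pi> H"
    then consider x y where "x \<in> H" "y \<in> H" "x \<noteq> y" "\<pi> x = q" "\<pi> y = q" | v where "branch_vertex H v" "\<pi> v = q"
      unfolding singular_points_def by blast
    then show "q = \<pi> 0"
    proof cases
      case 1
      obtain e \<tau> where e: "e \<in> A" "\<tau> \<in> {0..1}" "x = ?p e \<tau>" using 1(1) unfolding H by blast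
      obtain f \<sigma> where f: "f \<in> A" "\<sigma> \<in> {0..1}" "y = ?p f \<sigma>" using 1(2) unfolding H by blast
      have "x $ 1 = y $ 1" "x $ 2 = y $ 2" using 1(4,5) \<pi>_eq by metis+
      then have "\<tau> \<in> {0, 1}" using proj_inj[OF e(1) f(1) e(2) f(2)] e(3) f(3) 1(3) by auto
      then have "x \<in> ?V" using e by auto
      then have "\<pi> x = \<pi> 0" unfolding \<pi>_eq using V2[of x] by simp
      then show ?thesis using 1(4) by simp
    next
      case 2
      obtain V E where VE: "graph_structure H V E" "v \<in> V" "3 \<le> degree_at E v"
        using 2(1) unfolding branch_vertex_def by blast
      then have "v \<in> H" by (auto simp: graph_structure_def)
      then obtain e \<tau> where e: "e \<in> A" "\<tau> \<in> {0..1}" "v = ?p e \<tau>" unfolding H by blast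
      have "\<tau> \<in> {0, 1}"
      proof (rule ccontr)
        assume "\<tau> \<notin> {0, 1}"
        then have \<tau>: "\<tau> \<in> {0<..<1}" using e(2) by auto
        \<comment> \<open>Removing the axis vertices and the other petals leaves an open set in
          which \<open>H\<close> is the open arc of \<open>e\<close>, as
          \<open>degree_le_2_on_arc\<close> requires.\<close>
        let ?N = "- (?V \<union> (\<Union>f\<in>A - {e}. path_image (?p f)))"
        have "closed (?V \<union> (\<Union>f\<in>A - {e}. path_image (?p f)))"
        proof (rule closed_Un)
          show "closed ?V" using finA by (intro finite_imp_closed) auto
          show "closed (\<Union>f\<in>A - {e}. path_image (?p f))"
            using finA by (intro closed_UN ballI closed_path_image path_petal) simp
        qed
        then have "open ?N" by (simp only: open_Compl)
        moreover have "v \<in> ?N"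
        proof -
          have ne: "v \<noteq> ?p f \<sigma>" if "f \<in> A" "\<sigma> \<in> {0..1}" "f \<noteq> e \<or> \<sigma> \<in> {0, 1}" for f \<sigma>
            using inj[OF e(1) that(1) \<tau> that(2)] e(3) that(3) \<tau> by auto
          have "v \<notin> path_image (?p f)" if f: "f \<in> A - {e}" for f
            using ne[of f] f unfolding path_image_def by fast
          moreover have "v \<noteq> ?p f 0" "v \<noteq> ?p f 1" if "f \<in> A" for f
            using ne[OF that, of 0] ne[OF that, of 1] by simp_all
          ultimately show ?thesis by blast
        qed
        moreover have "?N \<inter> H \<subseteq> ?p e ` {0<..<1}"
        proof
          fix y assume y: "y \<in> ?N \<inter> H"
          then obtain f \<sigma> where f: "f \<in> A" "\<sigma> \<in> {0..1}" "y = ?p f \<sigma>" unfolding H by blast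
          have "f = e" using y f unfolding path_image_def by blast
          moreover have "\<sigma> \<noteq> 0" "\<sigma> \<noteq> 1" using y f by blast+
          ultimately show "y \<in> ?p e ` {0<..<1}" using f by auto
        qed
        moreover have "arc (?p e)"
          unfolding arc_def
        proof (intro conjI path_petal inj_onI)
          fix s t assume st: "s \<in> {0..1::real}" "t \<in> {0..1::real}" "?p e s = ?p e t"
          have ends: "?p e 0 $ 3 \<noteq> ?p e 1 $ 3" using up[OF e(1)] by (simp add: petal_pos3_ends)
          from proj_inj[OF e(1) e(1) st(1,2)] st(3) have "s \<in> {0, 1} \<and> t \<in> {0, 1} \<or> s = t" by auto
          then show "s = t" using st(3) ends by auto
        qed
        ultimately have "degree_at E v \<le> 2"
          using degree_le_2_on_arc[OF VE(1,2) _ \<tau>, of "?p e" ?N] e(3) by blast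
        then show False using VE(3) by simp
      qed
      then have "v \<in> ?V" using e by auto
      then have "\<pi> v = \<pi> 0" unfolding \<pi>_eq using V2[of v] by simp
      then show ?thesis using 2(2) by simp
    qed
  qed
  ultimately show ?thesis using spatial by blast
qed

section \<open>From polygonal edges to nondegenerate segments\<close>

lemma drop_degenerate_segments:
  fixes a b :: "'i \<Rightarrow> 'a::euclidean_space"
  assumes "finite I" "connected C" "infinite C" and C: "C = (\<Union>i\<in>I. closed_segment (a i) (b i))"
  shows "C = (\<Union>i\<in>{i\<in>I. a i \<noteq> b i}. closed_segment (a i) (b i))"
proof -
  define N where "N = (\<Union>i\<in>{i\<in>I. a i \<noteq> b i}. closed_segment (a i) (b i))"
  \<comment> \<open>Repeated points in a polygonal line give degenerate segments, which add only
    finitely many points outside \<open>N\<close>. The disjoint closed sets \<open>N\<close> and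
    \<open>F\<close> cover the connected set \<open>C\<close>, so one of them misses it; it is
    \<open>F\<close>, because \<open>C\<close> is infinite.\<close>
  define F where "F = a ` {i\<in>I. a i = b i} - N"
  have F: "finite F" using assms(1) by (simp add: F_def)
  have N: "closed N" unfolding N_def using assms(1) by (intro closed_UN) auto
  have sub: "C \<subseteq> N \<union> F" unfolding C N_def F_def by fastforce
  have "N \<inter> F \<inter> C = {}" unfolding F_def by blast
  then have "N \<inter> C = {} \<or> F \<inter> C = {}"
    using assms(2)[unfolded connected_closed] N finite_imp_closed[OF F] sub by metis
  moreover have "N \<inter> C \<noteq> {}"
  proof
    assume "N \<inter> C = {}"
    then have "C \<subseteq> F" using sub by blast
    then show False using F assms(3) finite_subset by blast
  qed
  ultimately have "C \<subseteq> N" using sub by blast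
  moreover have "N \<subseteq> C" unfolding C N_def by blast
  ultimately show ?thesis unfolding N_def by (rule subset_antisym)
qed

lemma polygonal_line_segments:
  fixes C :: "'a::euclidean_space set"
  assumes "polygonal_line C" "connected C" "infinite C"
  shows "\<exists>S. finite S \<and> (\<forall>a b. (a, b) \<in> S \<longrightarrow> a \<noteq> b) \<and> C = support S"
proof -
  obtain xs where xs: "C = (\<Union>i<length xs - 1. closed_segment (xs ! i) (xs ! Suc i))"
    using assms(1) unfolding polygonal_line_def by blast
  define I where "I = {i \<in> {..<length xs - 1}. xs ! i \<noteq> xs ! Suc i}"
  have "C = (\<Union>i\<in>I. closed_segment (xs ! i) (xs ! Suc i))"
    unfolding I_def by (rule drop_degenerate_segments[OF _ assms(2,3) xs]) simp
  moreover have "finite I" by (simp add: I_def)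
  ultimately show ?thesis
    by (intro exI[of _ "(\<lambda>i. (xs ! i, xs ! Suc i)) ` I"]) (auto simp: realization_def I_def)
qed

text \<open>All degrees are positive, so every vertex lies on an edge and the graph is the union of
  its polygonal edges.\<close>

lemma spatial_J_graph_segments:
  assumes J: "\<And>j. j \<in> J \<Longrightarrow> 3 \<le> j" and G: "spatial_J_graph J G"
  shows "\<exists>S. finite S \<and> S \<noteq> {} \<and> (\<forall>a b. (a, b) \<in> S \<longrightarrow> a \<noteq> b) \<and> G = support S"
proof -
  obtain V E where VE: "graph_structure G V E" "\<And>c. c \<in> E \<Longrightarrow> polygonal_line (path_image c)"
      and deg: "\<And>v. v \<in> V \<Longrightarrow> degree_at E v = 2 \<or> degree_at E v \<in> J"
    using G unfolding spatial_J_graph_def spatial_structure_def by blast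
  have E: "finite E" "E \<noteq> {}" "\<And>c. c \<in> E \<Longrightarrow> path c \<and> inj_on c {0<..<1}" "G = V \<union> (\<Union>c\<in>E. path_image c)"
    using VE(1) unfolding graph_structure_def by auto
  have inf: "infinite (path_image c)" if "c \<in> E" for c
  proof -
    have "infinite (c ` {0<..<1})" using E(3)[OF that] by (simp add: finite_image_iff infinite_Ioo)
    moreover have "c ` {0<..<1} \<subseteq> path_image c" by (auto simp: path_image_def)
    ultimately show ?thesis using finite_subset by blast
  qed
  have "\<exists>S. finite S \<and> (\<forall>a b. (a, b) \<in> S \<longrightarrow> a \<noteq> b) \<and> path_image c = support S" if "c \<in> E" for c
    using polygonal_line_segments[OF VE(2)[OF that] connected_path_image inf[OF that]] E(3)[OF that] by blast
  then obtain S where S: "\<And>c. c \<in> E \<Longrightarrow> finite (S c) \<and> (\<forall>a b. (a, b) \<in> S c \<longrightarrow> a \<noteq> b) \<and> path_image c = support (S c)"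
    by metis
  have "V \<subseteq> (\<Union>c\<in>E. path_image c)"
  proof
    fix v assume "v \<in> V"
    then have "degree_at E v \<noteq> 0" using deg[of v] J by force
    then have "{c\<in>E. pathstart c = v} \<noteq> {} \<or> {c\<in>E. pathfinish c = v} \<noteq> {}"
      unfolding degree_at_def by (metis add.right_neutral card.empty)
    then show "v \<in> (\<Union>c\<in>E. path_image c)" using pathstart_in_path_image pathfinish_in_path_image by blast
  qed
  then have "G = (\<Union>c\<in>E. path_image c)" using E(4) by blast
  also have "\<dots> = support (\<Union>c\<in>E. S c)" using S by (simp add: realization_def)
  finally have "G = support (\<Union>c\<in>E. S c)" .
  moreover have "(\<Union>c\<in>E. S c) \<noteq> {}"
  proof -
    obtain c where "c \<in> E" using E(2) by blast
    then have "support (S c) \<noteq> {}" using inf S by fastforce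
    then show ?thesis using \<open>c \<in> E\<close> by (auto simp: realization_def)
  qed
  moreover have "finite (\<Union>c\<in>E. S c)" using E(1) S by blast
  moreover have "\<forall>a b. (a, b) \<in> (\<Union>c\<in>E. S c) \<longrightarrow> a \<noteq> b" using S by blast
  ultimately show ?thesis by blast
qed

theorem corollary4:
  fixes J :: "nat set" and G :: "(real^3) set"
  assumes "finite J" and "\<And>j. j \<in> J \<Longrightarrow> 3 \<le> j"
    and "spatial_J_graph J G"
  shows "\<exists>H. spatial_graph H \<and> non_rigidly_isotopic G H \<and>
           (\<exists>\<pi>. orthogonal_projection \<pi> \<and> (\<exists>!q. q \<in> singular_points \<pi> H))"
proof -
  obtain S where S: "finite S" "S \<noteq> {}" "\<And>a b. (a, b) \<in> S \<Longrightarrow> a \<noteq> b" "G = support S"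
    using spatial_J_graph_segments[OF assms(2,3)] by blast
  obtain X A where A: "arc_diagram X A" "pl_equiv G (support A)"
    using arc_diagram_of_segments[OF S(1-3)] S(4) by blast
  obtain n where n: "\<forall>e\<in>A. \<forall>f\<in>A. e \<noteq> f \<longrightarrow> n e + 1 \<le> n f \<or> n f + 1 \<le> n e"
      "pl_equiv (support A) (realization (pos3 n) (petal_edges A))"
    using pl_equiv_petals[OF A(1)] by blast
  have "finite A" "A \<noteq> {}" "\<And>e. e \<in> A \<Longrightarrow> fst e $ 3 < snd e $ 3"
    using A(1) by (simp_all add: arc_diagram_def)
  then have "spatial_graph (realization (pos3 n) (petal_edges A)) \<and>
      (\<exists>\<pi>. orthogonal_projection \<pi> \<and> (\<exists>!q. q \<in> singular_points \<pi> (realization (pos3 n) (petal_edges A))))"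
    using petals_single_singular_point n(1) by blast
  moreover have "non_rigidly_isotopic G (realization (pos3 n) (petal_edges A))"
    using pl_equiv_imp_non_rigidly_isotopic pl_equiv_trans[OF A(2) n(2)] by blast
  ultimately show ?thesis by blast
qed

end
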